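(* Let $X$ be a geometrically doubling metric space, let $m>0$, and let $\mu$ be a doubling Borel measure on $X$ for which there is a constant $C$ with $\mu(B(x,\rho))\le C\rho^m$ for all $x\in X$, $\rho>0$. Let $T$ be a Calderon-Zygmund operator with respect to $\mu$ with a Calderon-Zygmund kernel $K$ of singularity $m$. Then there is a constant $C(T)$, not depending on $w$, such that for every weight $w\in A_{2,\mu}$ $$\|T\|_{L^2(w\,d\mu)\to L^2(w\,d\mu)}\le C(T)\,[w]_{2,\mu},$$ that is, $\|Tf\|_{L^2(w\,d\mu)}\le C(T)[w]_{2,\mu}\|f\|_{L^2(w\,d\mu)}$ for all $f\in L^2(\mu)\cap L^2(w\,d\mu)$.
   Context: A metric space $X$ with metric $|xy|$ is geometrically doubling if there is a constant $A$ such that every ball of radius $\rho$ can be covered by at most $A$ balls of radius $\rho/2$. $B(x,\rho)$ denotes the ball of radius $\rho$ centered at $x$. A measure $\mu$ is doubling if $0<\mu(B(x,2\rho))\le C'\mu(B(x,\rho))<\infty$ for all $x\in X,\rho>0$ with a constant $C'$. A (measurable) function $K(x,y)$ on $X\times X$ (defined for $x\neq y$), real-valued, is a Calderon-Zygmund kernel of singularity $m$ if for some $\varepsilon>0$ $$|K(x,y)|\le \frac1{|xy|^m}\quad (x\ne y),$$ $$|K(x,y)-K(x',y)|+|K(y,x)-K(y,x')|\le \frac{|xx'|^\varepsilon}{|xy|^{m+\varepsilon}}\quad\text{whenever } |xx'|\le \tfrac12|xy|,\ x\neq y.$$ $T$ is a Calderon-Zygmund operator with kernel $K$ if $T$ is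 a bounded linear operator $L^2(\mu)\to L^2(\mu)$ and, for $f\in L^2(\mu)$, $Tf(x)=\int K(x,y)f(y)\,d\mu(y)$ for ($\mu$-a.e.) $x\notin\operatorname{supp} f$. For $w>0$ $\mu$-a.e. (measurable), $w\in A_{2,\mu}$ means $$[w]_{2,\mu}=\sup_B \frac1{\mu(B)}\int_B w\,d\mu\cdot\frac1{\mu(B)}\int_B w^{-1}\,d\mu<\infty,$$ the supremum being over all balls $B\subset X$. *)

theory Defs
  imports "HOL-Analysis.Analysis"
begin

text \<open>The metric space is a type of class \<open>metric_space\<close>; balls are open balls of positive radius.\<close>

definition geometrically_doubling :: "'a::metric_space set \<Rightarrow> bool" where
  "geometrically_doubling X \<longleftrightarrow>
     (\<exists>A::nat. \<forall>x\<in>X. \<forall>\<rho>>0. \<exists>F\<subseteq>X. finite F \<and> card F \<le> A \<and>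
        X \<inter> ball x \<rho> \<subseteq> (\<Union>y\<in>F. ball y (\<rho> / 2)))"

definition doubling_measure :: "'a::metric_space measure \<Rightarrow> bool" where
  "doubling_measure M \<longleftrightarrow>
     (\<exists>C'::real. \<forall>x. \<forall>\<rho>>0.
        0 < emeasure M (ball x (2 * \<rho>)) \<and>
        emeasure M (ball x (2 * \<rho>)) \<le> ennreal C' * emeasure M (ball x \<rho>) \<and>
        ennreal C' * emeasure M (ball x \<rho>) < \<infinity>)"

text \<open>A kernel is only defined off the diagonal: no condition mentions the values \<open>K x x\<close>.\<close>

definition CZ_kernel :: "real \<Rightarrow> ('a::metric_space \<Rightarrow> 'a \<Rightarrow> real) \<Rightarrow> bool" where
  "CZ_kernel m K \<longleftrightarrow>
     (\<lambda>(x, y). K x y) \<in> borel_measurable (restrict_space borel {(x, y). x \<noteq> y}) \<and>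
     (\<exists>\<epsilon>>0.
        (\<forall>x y. x \<noteq> y \<longrightarrow> \<bar>K x y\<bar> \<le> 1 / dist x y powr m) \<and>
        (\<forall>x x' y. x \<noteq> y \<and> dist x x' \<le> dist x y / 2 \<longrightarrow>
           \<bar>K x y - K x' y\<bar> + \<bar>K y x - K y x'\<bar> \<le> dist x x' powr \<epsilon> / dist x y powr (m + \<epsilon>)))"

text \<open>Elements of \<open>L\<^sup>2\<close> are represented by functions; identities between them are meant almost
  everywhere.\<close>

definition L2_space :: "'a measure \<Rightarrow> ('a \<Rightarrow> real) set" where
  "L2_space M = {f \<in> borel_measurable M. integrable M (\<lambda>x. (f x)\<^sup>2)}"

text \<open>Only meaningful for members of \<^const>\<open>L2_space\<close>, since the integral of a non-integrable
  function is \<open>0\<close> by convention.\<close>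

definition L2_norm :: "'a measure \<Rightarrow> ('a \<Rightarrow> real) \<Rightarrow> real" where
  "L2_norm M f = sqrt (\<integral>x. (f x)\<^sup>2 \<partial>M)"

text \<open>The support of an almost-everywhere class: the complement of the union of all open sets on
  which \<open>f\<close> vanishes almost everywhere.\<close>

definition ae_support :: "'a::topological_space measure \<Rightarrow> ('a \<Rightarrow> real) \<Rightarrow> 'a set" where
  "ae_support M f = - \<Union>{U. open U \<and> (AE x in M. x \<in> U \<longrightarrow> f x = 0)}"

text \<open>Linearity and boundedness together imply that \<open>T\<close> respects almost-everywhere equality,
  so \<open>T\<close> induces an operator on classes.\<close>

definition bounded_linear_L2 :: "'a measure \<Rightarrow> (('a \<Rightarrow> real) \<Rightarrow> 'a \<Rightarrow> real) \<Rightarrow> bool" where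
  "bounded_linear_L2 M T \<longleftrightarrow>
     (\<forall>f\<in>L2_space M. T f \<in> L2_space M) \<and>
     (\<forall>f\<in>L2_space M. \<forall>g\<in>L2_space M. AE x in M. T (\<lambda>y. f y + g y) x = T f x + T g x) \<and>
     (\<forall>c. \<forall>f\<in>L2_space M. AE x in M. T (\<lambda>y. c * f y) x = c * T f x) \<and>
     (\<exists>B. \<forall>f\<in>L2_space M. L2_norm M (T f) \<le> B * L2_norm M f)"

definition CZ_operator ::
  "'a::metric_space measure \<Rightarrow> ('a \<Rightarrow> 'a \<Rightarrow> real) \<Rightarrow> (('a \<Rightarrow> real) \<Rightarrow> 'a \<Rightarrow> real) \<Rightarrow> bool" where
  "CZ_operator M K T \<longleftrightarrow>
     bounded_linear_L2 M T \<and>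
     (\<forall>f\<in>L2_space M. AE x in M. x \<notin> ae_support M f \<longrightarrow> T f x = (\<integral>y. K x y * f y \<partial>M))"

text \<open>The averages are formed in \<^typ>\<open>ennreal\<close>, so that a divergent integral makes the
  characteristic infinite.\<close>

definition A2_char :: "'a::metric_space measure \<Rightarrow> ('a \<Rightarrow> real) \<Rightarrow> ennreal" where
  "A2_char M w = (SUP (x, \<rho>) \<in> UNIV \<times> {0<..}.
     ((\<integral>\<^sup>+y\<in>ball x \<rho>. ennreal (w y) \<partial>M) / emeasure M (ball x \<rho>)) *
     ((\<integral>\<^sup>+y\<in>ball x \<rho>. ennreal (1 / w y) \<partial>M) / emeasure M (ball x \<rho>)))"

definition A2_weight :: "'a::metric_space measure \<Rightarrow> ('a \<Rightarrow> real) \<Rightarrow> bool" where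
  "A2_weight M w \<longleftrightarrow>
     w \<in> borel_measurable M \<and> (AE x in M. 0 < w x) \<and> A2_char M w < \<infinity>"

abbreviation weighted :: "'a measure \<Rightarrow> ('a \<Rightarrow> real) \<Rightarrow> 'a measure" where
  "weighted M w \<equiv> density M (\<lambda>x. ennreal (w x))"

end

theory Submission
  imports Defs
begin

text \<open>
  The proof is a sparse domination. Fix dyadic cells, and attach to a cell \<open>Q\<close> of scale \<open>r\<close> the ball
  \<open>B\<^sub>Q\<close> of radius \<open>16 r\<close> about its centre and the function \<open>f\<^sub>Q = f 1\<^bsub>B\<^sub>Q\<^esub>\<close>. By the weak type \<open>(1,1)\<close> bound for
  \<open>T\<close>, the average \<open>a\<^sub>Q\<close> of \<open>|f|\<close> over \<open>B\<^sub>Q\<close> controls \<open>|T f\<^sub>Q|\<close> off a small part of \<open>Q\<close>. Stop at the maximal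
  cells \<open>P\<close> inside \<open>Q\<close> on which \<open>a\<^sub>P\<close> is much larger than \<open>a\<^sub>Q\<close> or at least half of which is exceptional; they fill
  at most half of \<open>Q\<close>. On such a \<open>P\<close> one has \<open>|T f\<^sub>Q| \<le> |T f\<^sub>P| + A a\<^sub>Q\<close> by the regularity of the kernel, and iterating
  gives \<open>|T f| \<le> A \<Sum>\<^sub>Q a\<^sub>Q 1\<^sub>Q\<close> over a family of cells of which a fixed proportion can be chosen disjoint.

  The sparse operator is linear in the \<open>A\<^sub>2\<close> characteristic: pairing it with \<open>g\<close> and writing \<open>\<sigma> = 1/w\<close>, each term is at
  most \<open>[w]\<close> times the product of \<open>\<sigma>(3B)\<^sup>-\<^sup>1 \<integral>\<^sub>B |f|\<close>, \<open>w(3B)\<^sup>-\<^sup>1 \<integral>\<^sub>B |g|\<close> and the measure of the disjoint part, and the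
  maximal functions of this form are bounded on \<open>L\<^sup>2(\<sigma>)\<close> and \<open>L\<^sup>2(w)\<close> with absolute constants, by the Vitali covering
  lemma.
\<close>

section \<open>Dyadic systems\<close>

text \<open>The only bound on \<open>T\<close> that enters the stopping argument is the weak type
  bound for \<open>T\<close> itself, without maximal truncations. What makes this enough is that on
  a cell P the difference T f_Q - T f_P is a kernel integral whose oscillation sums geometrically
  over the ancestors between P and Q, so one point where both terms are small controls the whole
  cell. Such a point is sought in the parent of a stopping cell, where neither stopping condition
  holds; the last step to the child costs only the size of the kernel. Growth of the measure turns
  r^(-m) times an integral into an average. Since averages run over dilated balls instead of cells,
  a single dyadic system suffices. It has a coarsest scale s, so the first result bounds T(f 1_B), B
  of radius 16 s, on one coarsest cell; the constants do not depend on s, and Fatou's lemma removes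
  the cut-off. In the weighted estimate the function g is the sparse sum S itself: with X the
  integral of S^2 w this gives X^2 <= const F X, so X must be known to be finite, which is why sums
  stay finite until the end.\<close>

lemma geometrically_doubling_cover:
  fixes x :: "'a::metric_space"
  assumes gd: "geometrically_doubling (UNIV :: 'a set)" and e: "e > 0"
  obtains F where "finite F" and "ball x R \<subseteq> (\<Union>y\<in>F. ball y e)"
proof (cases "R > 0")
  case True
  have step: "\<exists>F. finite F \<and> ball y \<rho> \<subseteq> (\<Union>z\<in>F. ball z (\<rho> / 2))" if "\<rho> > 0" for y :: 'a and \<rho>
    using gd that unfolding geometrically_doubling_def by fastforce
  have "\<exists>F. finite F \<and> ball x R \<subseteq> (\<Union>z\<in>F. ball z (R / 2 ^ k))" for k :: nat
  proof (induction k)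
    case 0
    show ?case by (intro exI[of _ "{x}"]) auto
  next
    case (Suc k)
    then obtain F where F: "finite F" "ball x R \<subseteq> (\<Union>z\<in>F. ball z (R / 2 ^ k))" by blast
    have "\<forall>z::'a. \<exists>G. finite G \<and> ball z (R / 2 ^ k) \<subseteq> (\<Union>y\<in>G. ball y (R / 2 ^ k / 2))"
      using step[of "R / 2 ^ k"] True by simp
    then obtain G where
      G: "\<And>z::'a. finite (G z) \<and> ball z (R / 2 ^ k) \<subseteq> (\<Union>y\<in>G z. ball y (R / 2 ^ k / 2))"
      by metis
    show ?case
    proof (intro exI[of _ "\<Union>z\<in>F. G z"] conjI)
      show "finite (\<Union>z\<in>F. G z)" using F G by auto
      have "R / 2 ^ Suc k = R / 2 ^ k / 2" by simp
      then show "ball x R \<subseteq> (\<Union>z\<in>\<Union>z\<in>F. G z. ball z (R / 2 ^ Suc k))"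
        using F(2) G by (simp only:) blast
    qed
  qed
  moreover obtain k where "R / e < 2 ^ k"
    using real_arch_pow[of 2 "R / e"] by auto
  then have "R / 2 ^ k \<le> e" using e by (simp add: field_simps)
  then have "ball z (R / 2 ^ k) \<subseteq> ball z e" for z :: 'a by (rule subset_ball)
  ultimately show ?thesis using that by (meson SUP_mono' subset_trans)
next
  case False
  then show ?thesis using that[of "{}"] by simp
qed

lemma finite_separated_Int_ball:
  fixes x :: "'a::metric_space"
  assumes gd: "geometrically_doubling (UNIV :: 'a set)" and e: "e > 0"
    and sep: "\<And>y z. y \<in> N \<Longrightarrow> z \<in> N \<Longrightarrow> y \<noteq> z \<Longrightarrow> e \<le> dist y z"
  shows "finite (N \<inter> ball x R)"
proof -
  obtain F where F: "finite F" "ball x R \<subseteq> (\<Union>y\<in>F. ball y (e / 2))"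
    using geometrically_doubling_cover[OF gd, of "e / 2" x R] e by auto
  have "finite (N \<inter> ball y (e / 2))" for y
  proof (cases "N \<inter> ball y (e / 2) = {}")
    case False
    then obtain z where z: "z \<in> N" "dist y z < e / 2" by auto
    have "N \<inter> ball y (e / 2) \<subseteq> {z}"
    proof
      fix u assume u: "u \<in> N \<inter> ball y (e / 2)"
      have "dist u z \<le> dist y u + dist y z" by (metis dist_commute dist_triangle)
      then show "u \<in> {z}" using sep[of u z] u z by force
    qed
    then show ?thesis using finite_subset by blast
  qed simp
  then have "finite (\<Union>y\<in>F. N \<inter> ball y (e / 2))" using F(1) by blast
  moreover have "N \<inter> ball x R \<subseteq> (\<Union>y\<in>F. N \<inter> ball y (e / 2))" using F(2) by blast
  ultimately show ?thesis using finite_subset by blast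
qed

lemma maximal_separated_set:
  fixes x0 :: "'a::metric_space"
  obtains N where "x0 \<in> N" "\<And>y z. y \<in> N \<Longrightarrow> z \<in> N \<Longrightarrow> y \<noteq> z \<Longrightarrow> e \<le> dist y z"
    "\<And>y. y \<in> N \<or> (\<exists>z\<in>N. dist y z < e)"
proof -
  let ?A = "{N. x0 \<in> N \<and> (\<forall>y\<in>N. \<forall>z\<in>N. y \<noteq> z \<longrightarrow> e \<le> dist y z)}"
  have "{x0} \<in> ?A" by auto
  then have A_ne: "?A \<noteq> {}" by blast
  have A_chain: "\<Union>\<C> \<in> ?A" if ne: "\<C> \<noteq> {}" and ch: "subset.chain ?A \<C>" for \<C>
  proof -
    have sub: "\<C> \<subseteq> ?A" and tot: "\<And>Y Z. Y \<in> \<C> \<Longrightarrow> Z \<in> \<C> \<Longrightarrow> Y \<subseteq> Z \<or> Z \<subseteq> Y"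
      using ch by (auto simp: subset.chain_def)
    have "e \<le> dist y z" if "Y \<in> \<C>" "y \<in> Y" "Z \<in> \<C>" "z \<in> Z" "y \<noteq> z" for Y y Z z
    proof -
      from tot[OF that(1,3)] show ?thesis
      proof
        assume "Y \<subseteq> Z"
        then show ?thesis using sub that by blast
      next
        assume "Z \<subseteq> Y"
        then show ?thesis using sub that by blast
      qed
    qed
    moreover have "x0 \<in> \<Union>\<C>" using ne sub by blast
    ultimately show ?thesis by simp
  qed
  have "\<exists>N\<in>?A. \<forall>X\<in>?A. N \<subseteq> X \<longrightarrow> X = N"
    by (rule subset_Zorn_nonempty[OF A_ne]) (rule A_chain)
  then obtain N where N: "N \<in> ?A" and max: "\<forall>X\<in>?A. N \<subseteq> X \<longrightarrow> X = N"
    by (rule bexE)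
  have "y \<in> N \<or> (\<exists>z\<in>N. dist y z < e)" for y
  proof (rule ccontr)
    assume neg: "\<not> (y \<in> N \<or> (\<exists>z\<in>N. dist y z < e))"
    then have "\<forall>z\<in>N. e \<le> dist y z \<and> e \<le> dist z y" by (simp add: dist_commute not_less)
    then have "insert y N \<in> ?A" using N by auto
    then show False using max[rule_format, of "insert y N"] neg by blast
  qed
  then show ?thesis using N by (intro that[of N]) blast+
qed

text \<open>The two-stage choice reconciles two demands. Points within \<open>e / 2\<close> of a net
  point must go there, which is unambiguous because net points are \<open>e\<close> apart, and which
  gives each fibre an inner ball; all other points go to the first net point within
  \<open>e\<close>. Taking first indices in an enumeration keeps the map Borel, and doubling makes
  the net locally finite, hence countable.\<close>

lemma rounding_map:
  fixes x0 :: "'a::metric_space"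
  assumes gd: "geometrically_doubling (UNIV :: 'a set)" and e: "e > 0"
  shows "\<exists>p. p \<in> measurable borel (count_space UNIV) \<and> countable (range p) \<and>
    (\<forall>y. dist y (p y) < e) \<and> (\<forall>z\<in>range p. \<forall>y. dist y z < e / 2 \<longrightarrow> p y = z) \<and>
    (\<forall>y R. finite (range p \<inter> ball y R)) \<and> x0 \<in> range p"
proof -
  obtain N where N: "x0 \<in> N" "\<And>y z. y \<in> N \<Longrightarrow> z \<in> N \<Longrightarrow> y \<noteq> z \<Longrightarrow> e \<le> dist y z"
    "\<And>y. y \<in> N \<or> (\<exists>z\<in>N. dist y z < e)"
    using maximal_separated_set[of x0 e] by metis
  have fin: "finite (N \<inter> ball y R)" for y R
    using finite_separated_Int_ball[OF gd e N(2)] by blast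
  have "N = (\<Union>n. N \<inter> ball x0 (real n))"
    by (auto simp: reals_Archimedean2)
  then have cN: "countable N"
    using fin by (metis countable_UN countableI_type countable_finite)
  define nn where "nn = from_nat_into N"
  have nnN: "nn i \<in> N" for i using N(1) unfolding nn_def by (metis empty_iff from_nat_into)
  have nsurj: "\<exists>i. nn i = z" if "z \<in> N" for z
    using that cN from_nat_into_surj unfolding nn_def by metis
  have cov: "\<exists>i. dist y (nn i) < e" for y
    using N(3)[of y] nsurj e by (metis dist_self)
  define p where "p y = (if \<exists>i. dist y (nn i) < e / 2 then nn (LEAST i. dist y (nn i) < e / 2)
      else nn (LEAST i. dist y (nn i) < e))" for y
  have pN: "p y \<in> N" for y unfolding p_def using nnN by simp
  have pd: "dist y (p y) < e" for y
  proof (cases "\<exists>i. dist y (nn i) < e / 2")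
    case True
    then have "dist y (nn (LEAST i. dist y (nn i) < e / 2)) < e / 2" by (rule LeastI_ex)
    then show ?thesis using True e unfolding p_def by auto
  next
    case False
    then show ?thesis using LeastI_ex[OF cov[of y]] unfolding p_def by auto
  qed
  have pz: "p y = z" if z: "z \<in> N" and d: "dist y z < e / 2" for y z
  proof -
    have ex: "\<exists>i. dist y (nn i) < e / 2" using nsurj[OF z] d by auto
    then have "dist y (nn (LEAST i. dist y (nn i) < e / 2)) < e / 2" by (rule LeastI_ex)
    then have py: "dist y (p y) < e / 2" using ex unfolding p_def by simp
    have "dist (p y) z \<le> dist y (p y) + dist y z" by (metis dist_commute dist_triangle)
    then show ?thesis using N(2)[OF pN[of y] z] py d by force
  qed
  have rp: "range p = N"
  proof
    show "range p \<subseteq> N" using pN by auto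
    show "N \<subseteq> range p" using pz e by (metis dist_self half_gt_zero rangeI subsetI)
  qed
  have Mp: "p \<in> measurable borel (count_space UNIV)"
  proof -
    have Lm: "(\<lambda>y. nn (LEAST i. dist y (nn i) < d)) \<in> measurable borel (count_space UNIV)" for d
    proof -
      have "{y. dist y (nn i) < d} = ball (nn i) d" for i by (auto simp: dist_commute)
      then have nnM: "Measurable.pred borel (\<lambda>y. dist y (nn i) < d)" for i by (simp add: pred_def)
      have "(\<lambda>y. LEAST i. dist y (nn i) < d) \<in> measurable borel (count_space UNIV)"
        by (rule measurable_Least) (rule nnM)
      from measurable_compose[OF this, of nn "count_space UNIV"] show ?thesis by simp
    qed
    have "{y. \<exists>i. dist y (nn i) < e / 2} = (\<Union>i. ball (nn i) (e / 2))"
      by (auto simp: dist_commute)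
    also have "\<dots> \<in> sets borel" by (rule borel_open) auto
    finally have "Measurable.pred borel (\<lambda>y. \<exists>i. dist y (nn i) < e / 2)" by (simp add: pred_def)
    then show ?thesis unfolding p_def[abs_def] using Lm by measurable
  qed
  show ?thesis
    by (intro exI[of _ p]) (use Mp cN pd pz fin N(1) in \<open>auto simp: rp\<close>)
qed

text \<open>A cell is a fibre of \<open>c k\<close> and \<open>c k y\<close> is its centre, so
  partition and measurability are properties of one map. The clause with radius
  \<open>s / 8 ^ k / 4\<close> gives each cell an inner ball and makes \<open>c k\<close>
  idempotent. The last clause puts a whole ball about \<open>x0\<close> inside one coarsest cell,
  which is what allows localisation to a prescribed ball.\<close>

definition dyadic_system :: "'a::metric_space \<Rightarrow> real \<Rightarrow> (nat \<Rightarrow> 'a \<Rightarrow> 'a) \<Rightarrow> bool" where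
  "dyadic_system x0 s c \<longleftrightarrow> s > 0 \<and>
     (\<forall>k. countable (range (c k))) \<and>
     (\<forall>k. c k \<in> measurable borel (count_space UNIV)) \<and>
     (\<forall>k y. dist y (c k y) < 2 * (s / 8 ^ k)) \<and>
     (\<forall>k y y'. dist y (c k y') < s / 8 ^ k / 4 \<longrightarrow> c k y = c k y') \<and>
     (\<forall>k y y'. c (Suc k) y = c (Suc k) y' \<longrightarrow> c k y = c k y') \<and>
     (\<forall>y. dist y x0 < s / 4 \<longrightarrow> c 0 y = x0)"

text \<open>Pushing a point through the roundings at the scales \<open>k + j, k + j - 1, \<dots>, k\<close> gives systems of
  nested cells, which however depend on the finest scale \<open>k + j\<close>. As only finitely many cells of scale
  \<open>k\<close> can occur near a given point, some chain of cells is hit for infinitely many \<open>j\<close>; the least such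
  chain (in an enumeration) does not depend on \<open>j\<close>.\<close>

primrec iterated_rounding :: "(nat \<Rightarrow> 'a \<Rightarrow> 'a) \<Rightarrow> nat \<Rightarrow> nat \<Rightarrow> 'a \<Rightarrow> 'a" where
  "iterated_rounding p 0 = p"
| "iterated_rounding p (Suc j) = (\<lambda>k y. p k (iterated_rounding p j (Suc k) y))"

primrec limit_cell :: "(nat \<Rightarrow> 'a \<Rightarrow> 'a) \<Rightarrow> nat \<Rightarrow> 'a \<Rightarrow> 'a" where
  "limit_cell p 0 = (\<lambda>y. from_nat_into (range (p 0))
      (LEAST i. \<exists>\<^sub>\<infinity>j. iterated_rounding p j 0 y = from_nat_into (range (p 0)) i))"
| "limit_cell p (Suc k) = (\<lambda>y. from_nat_into (range (p (Suc k)))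
      (LEAST i. p k (from_nat_into (range (p (Suc k))) i) = limit_cell p k y \<and>
        (\<exists>\<^sub>\<infinity>j. iterated_rounding p j (Suc k) y = from_nat_into (range (p (Suc k))) i)))"

theorem dyadic_system_exists:
  fixes x0 :: "'a::metric_space"
  assumes gd: "geometrically_doubling (UNIV :: 'a set)" and s: "s > 0"
  obtains c where "dyadic_system x0 s c"
proof -
  define r where "r k = s / 8 ^ k" for k :: nat
  have r: "r k > 0" "r (Suc k) = r k / 8" for k using s by (auto simp: r_def)
  have "\<forall>k. \<exists>p. p \<in> measurable borel (count_space UNIV) \<and> countable (range p) \<and>
    (\<forall>y. dist y (p y) < r k) \<and> (\<forall>z\<in>range p. \<forall>y. dist y z < r k / 2 \<longrightarrow> p y = z) \<and>
    (\<forall>y R. finite (range p \<inter> ball y R)) \<and> x0 \<in> range p"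
    using rounding_map[OF gd r(1)] by blast
  from choice[OF this] obtain p where "\<And>k. p k \<in> measurable borel (count_space UNIV) \<and>
    countable (range (p k)) \<and> (\<forall>y. dist y (p k y) < r k) \<and>
    (\<forall>z\<in>range (p k). \<forall>y. dist y z < r k / 2 \<longrightarrow> p k y = z) \<and>
    (\<forall>y R. finite (range (p k) \<inter> ball y R)) \<and> x0 \<in> range (p k)"
    by blast
  then have p: "\<And>k. p k \<in> measurable borel (count_space UNIV)" "\<And>k. countable (range (p k))"
    "\<And>k y. dist y (p k y) < r k" "\<And>k y z. z \<in> range (p k) \<Longrightarrow> dist y z < r k / 2 \<Longrightarrow> p k y = z"
    "\<And>k y R. finite (range (p k) \<inter> ball y R)" "x0 \<in> range (p 0)"
    by blast+
  define u where "u = iterated_rounding p"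
  define nn where "nn k = from_nat_into (range (p k))" for k
  define c where "c = limit_cell p"
  have u0: "u 0 k y = p k y" and uS: "u (Suc j) k y = p k (u j (Suc k) y)" for j k y
    by (auto simp: u_def)
  have c0: "c 0 y = nn 0 (LEAST i. \<exists>\<^sub>\<infinity>j. u j 0 y = nn 0 i)" for y
    by (simp add: c_def nn_def u_def)
  have cS: "c (Suc k) y = nn (Suc k) (LEAST i. p k (nn (Suc k) i) = c k y \<and>
      (\<exists>\<^sub>\<infinity>j. u j (Suc k) y = nn (Suc k) i))" for k y
    by (simp add: c_def nn_def u_def)
  have nnr: "nn k i \<in> range (p k)" for k i
    unfolding nn_def by (rule from_nat_into) simp
  have nsurj: "\<exists>i. nn k i = z" if "z \<in> range (p k)" for k z
    using from_nat_into_surj[OF p(2) that] unfolding nn_def by metis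
  have ur: "u j k y \<in> range (p k)" for j k y
    by (cases j) (auto simp: u0 uS)
  \<comment> \<open>The successive displacements sum to \<open>r k\<close> times 1 + 1/8 + 1/64 +
    ..., which is \<open>8 / 7 * r k\<close>.\<close>
  have ud: "dist y (u j k y) < 8 / 7 * r k" for j k y
  proof (induction j arbitrary: k)
    case 0
    show ?case using p(3)[of y k] r(1)[of k] by (simp add: u0)
  next
    case (Suc j)
    have "dist y (u (Suc j) k y) \<le> dist y (u j (Suc k) y) + dist (u j (Suc k) y) (p k (u j (Suc k) y))"
      unfolding uS by (rule dist_triangle)
    then show ?case using Suc[of "Suc k"] p(3)[of "u j (Suc k) y" k] r[of k] by simp
  qed
  \<comment> \<open>A point handed to \<open>p k\<close> has already moved by up to
    \<open>8 / 7 * r (Suc k)\<close>, that is \<open>r k / 7\<close>. As 1/7 + 1/4 < 1/2, it is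
    still in the zone where \<open>p k\<close> returns \<open>z\<close>; the scale ratio 8 leaves
    this margin.\<close>
  have uz: "u j k y = z" if "z \<in> range (p k)" "dist y z < r k / 4" for j k y z
  proof (cases j)
    case 0
    show ?thesis unfolding 0 u0 by (rule p(4)) (use that r(1)[of k] in auto)
  next
    case (Suc i)
    have "dist (u i (Suc k) y) z \<le> dist y (u i (Suc k) y) + dist y z"
      by (metis dist_commute dist_triangle)
    then show ?thesis unfolding Suc uS
      by (intro p(4)) (use that ud[of y i "Suc k"] r[of k] in auto)
  qed
  have ufin: "finite (range (\<lambda>j. u j k y))" for y k
  proof (rule finite_subset)
    show "range (\<lambda>j. u j k y) \<subseteq> range (p k) \<inter> ball y (8 / 7 * r k)" using ur ud by auto
  qed (rule p(5))
  \<comment> \<open>Pigeonhole: an iterate with j > 0 that reaches \<open>c k y\<close> comes from a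
    point of the net of scale \<open>Suc k\<close>, and only finitely many of these occur for
    \<open>y\<close>, so one of them is used infinitely often.\<close>
  have child: "\<exists>i. p k (nn (Suc k) i) = c k y \<and> (\<exists>\<^sub>\<infinity>j. u j (Suc k) y = nn (Suc k) i)"
    if "\<exists>\<^sub>\<infinity>j. u j k y = c k y" for k y
  proof -
    have "infinite {j. u j k y = c k y}" using that by (simp add: INFM_iff_infinite)
    \<comment> \<open>The index 0 is split off because that iterate rounds \<open>y\<close> directly
      at scale \<open>k\<close> and passes through no finer cell.\<close>
    moreover have "{j. u j k y = c k y} \<subseteq> insert 0 (Suc ` {j. u (Suc j) k y = c k y})"
    proof
      fix j assume "j \<in> {j. u j k y = c k y}"
      then show "j \<in> insert 0 (Suc ` {j. u (Suc j) k y = c k y})" by (cases j) auto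
    qed
    ultimately have "infinite {j. u (Suc j) k y = c k y}"
      by (meson finite.insertI finite_imageI finite_subset)
    then obtain a0 where a0: "u (Suc a0) k y = c k y"
      "infinite {a \<in> {j. u (Suc j) k y = c k y}. u a (Suc k) y = u a0 (Suc k) y}"
      using pigeonhole_infinite[of "{j. u (Suc j) k y = c k y}" "\<lambda>j. u j (Suc k) y"]
        finite_subset[OF image_mono[OF subset_UNIV] ufin[of "Suc k" y]] by blast
    then have "\<exists>\<^sub>\<infinity>j. u j (Suc k) y = u a0 (Suc k) y"
      unfolding INFM_iff_infinite by (elim infinite_super[rotated]) auto
    moreover have "p k (u a0 (Suc k) y) = c k y" using a0(1) by (simp add: uS)
    ultimately show ?thesis using nsurj[OF ur] by metis
  qed
  have cinf: "\<exists>\<^sub>\<infinity>j. u j k y = c k y" for k y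
  proof (induction k)
    case 0
    obtain a0 where "infinite {a \<in> UNIV. u a 0 y = u a0 0 y}"
      using pigeonhole_infinite[of UNIV "\<lambda>j. u j 0 y"] ufin[of 0 y] by auto
    then have "\<exists>\<^sub>\<infinity>j. u j 0 y = u a0 0 y" by (simp add: INFM_iff_infinite)
    then have "\<exists>i. \<exists>\<^sub>\<infinity>j. u j 0 y = nn 0 i" using nsurj[OF ur] by metis
    from LeastI_ex[OF this] show ?case by (simp add: c0)
  next
    case (Suc k)
    from LeastI_ex[OF child[OF Suc]] show ?case by (simp add: cS)
  qed
  have cpar: "p k (c (Suc k) y) = c k y" for k y
    using LeastI_ex[OF child[OF cinf[of k y]]] by (simp add: cS)
  have cr: "c k y \<in> range (p k)" for k y
    using nnr by (cases k) (auto simp: c0 cS)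
  \<comment> \<open>Each limit centre is an actual iterate, so the distance bound and the inner
    balls pass to the limit unchanged.\<close>
  have cu: "\<exists>j. c k y = u j k y" for k y
    using frequently_ex[OF cinf[of k y]] by metis
  have cz: "c k y = z" if "z \<in> range (p k)" "dist y z < r k / 4" for k y z
    using cu[of k y] uz[OF that] by metis
  have cM: "c k \<in> measurable borel (count_space UNIV)" for k
  proof -
    have uM: "u j k \<in> measurable borel (count_space UNIV)" for j k
    proof (induction j arbitrary: k)
      case 0
      show ?case using p(1) by (simp add: u_def)
    next
      case (Suc j)
      have "(\<lambda>y. p k (u j (Suc k) y)) \<in> measurable borel (count_space UNIV)"
        by (rule measurable_compose[OF Suc]) simp
      then show ?case by (simp add: u_def)
    qed
    have eqM: "Measurable.pred borel (\<lambda>y. f y = z)" if "f \<in> measurable borel (count_space UNIV)"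
      for f :: "'a \<Rightarrow> 'a" and z
      using that by measurable
    have iM: "Measurable.pred borel (\<lambda>y. \<exists>\<^sub>\<infinity>j. u j k y = z)" for k z
      unfolding INFM_nat using eqM[OF uM] by measurable
    show ?thesis
    proof (induction k)
      case 0
      have "(\<lambda>y. nn 0 (LEAST i. \<exists>\<^sub>\<infinity>j. u j 0 y = nn 0 i)) \<in> measurable borel (count_space UNIV)"
        by (rule measurable_compose[OF measurable_Least[OF iM]]) simp
      then show ?case unfolding c0[abs_def, symmetric] by (simp add: c0[abs_def])
    next
      case (Suc k)
      have "Measurable.pred borel (\<lambda>y. p k (nn (Suc k) i) = c k y)" for i
        using eqM[OF Suc, of "p k (nn (Suc k) i)"] by (simp only: eq_commute)
      then have "Measurable.pred borel (\<lambda>y. p k (nn (Suc k) i) = c k y \<and>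
          (\<exists>\<^sub>\<infinity>j. u j (Suc k) y = nn (Suc k) i))" for i
        using iM by (rule pred_intros_logic)
      then have "(\<lambda>y. nn (Suc k) (LEAST i. p k (nn (Suc k) i) = c k y \<and>
          (\<exists>\<^sub>\<infinity>j. u j (Suc k) y = nn (Suc k) i))) \<in> measurable borel (count_space UNIV)"
        by (intro measurable_compose[OF measurable_Least]) simp_all
      then show ?case by (simp add: cS[abs_def])
    qed
  qed
  have "dyadic_system x0 s c"
    unfolding dyadic_system_def r_def[symmetric]
  proof (intro conjI allI impI)
    fix k y y' z
    show "countable (range (c k))"
      by (rule countable_subset[OF _ p(2)[of k]]) (use cr in auto)
    show "c k \<in> measurable borel (count_space UNIV)" by (rule cM)
    show "dist y (c k y) < 2 * r k"
    proof -
      obtain j where "c k y = u j k y" using cu by blast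
      then show ?thesis using ud[of y j k] r(1)[of k] by simp
    qed
    show "c k y = c k y'" if "dist y (c k y') < r k / 4" using cz[OF cr that] .
    show "c k y = c k y'" if "c (Suc k) y = c (Suc k) y'" using cpar that by metis
    show "c 0 y = x0" if "dist y x0 < s / 4"
      by (rule cz[OF p(6)]) (use that in \<open>simp add: r_def\<close>)
  qed (rule s)
  then show ?thesis using that by blast
qed

section \<open>Maximal cells and differentiation\<close>

lemma finite_initial_segment:
  assumes "countable I"
  shows "finite {i \<in> I. to_nat_on I i < n}"
proof (rule finite_imageD)
  show "finite (to_nat_on I ` {i \<in> I. to_nat_on I i < n})" by (rule finite_subset[of _ "{..<n}"]) auto
  show "inj_on (to_nat_on I) {i \<in> I. to_nat_on I i < n}"
    by (rule inj_on_subset[OF inj_on_to_nat_on[OF assms]]) auto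
qed

text \<open>Inner and outer approximation are carried together because complementation exchanges
  them; this is what lets the induction over the generated sigma-algebra go through.\<close>

lemma finite_borel_measure_regular:
  fixes M :: "'a::metric_space measure"
  assumes finite_M: "finite_measure M" and sets_M: "sets M = sets borel"
    and A: "A \<in> sets borel" and e: "e > 0"
  shows "\<exists>F U. closed F \<and> open U \<and> F \<subseteq> A \<and> A \<subseteq> U \<and> emeasure M (U - F) < ennreal e"
proof -
  interpret finite_measure M by (rule finite_M)
  have [measurable]: "\<And>S. open S \<Longrightarrow> S \<in> sets M" "\<And>S. closed S \<Longrightarrow> S \<in> sets M"
    using sets_M by auto
  have "A \<in> sigma_sets UNIV {S::'a set. open S}"
    using A by (simp add: borel_def)
  then show ?thesis using e
  proof (induction arbitrary: e)
    case (Basic A)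
    then have oA: "open A" by simp
    define F where "F n = {x. \<forall>y. y \<notin> A \<longrightarrow> 1 / real (Suc n) \<le> dist y x}" for n
    have Fc: "closed (F n)" for n
    proof -
      have "F n = (\<Inter>y\<in>-A. - ball y (1 / real (Suc n)))" by (auto simp: F_def not_less)
      then show ?thesis by auto
    qed
    have FA: "F n \<subseteq> A" for n unfolding F_def by force
    have Finc: "F n \<subseteq> F m" if "n \<le> m" for n m
    proof -
      have "1 / real (Suc m) \<le> 1 / real (Suc n)" using that by (simp add: frac_le)
      then show ?thesis unfolding F_def by force
    qed
    have Int_empty: "(\<Inter>n. A - F n) = {}"
    proof -
      have "\<exists>n. x \<in> F n" if "x \<in> A" for x
      proof -
        obtain d where d: "d > 0" "ball x d \<subseteq> A" using oA \<open>x \<in> A\<close> open_contains_ball by blast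
        obtain n where "inverse (real (Suc n)) < d" using d reals_Archimedean by blast
        then have "x \<in> F n" using d(2) unfolding F_def
          by (force simp: dist_commute inverse_eq_divide subset_eq not_less)
        then show ?thesis by blast
      qed
      then show ?thesis by blast
    qed
    have "(\<lambda>n. emeasure M (A - F n)) \<longlonglongrightarrow> emeasure M (\<Inter>n. A - F n)"
    proof (rule Lim_emeasure_decseq)
      show "range (\<lambda>n. A - F n) \<subseteq> sets M" using Fc oA by auto
      show "decseq (\<lambda>n. A - F n)" using Finc unfolding decseq_def by blast
    qed (simp add: emeasure_finite)
    then have "(\<lambda>n. emeasure M (A - F n)) \<longlonglongrightarrow> 0"
      by (simp only: Int_empty emeasure_empty)
    then have "\<forall>\<^sub>F n in sequentially. emeasure M (A - F n) < ennreal e"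
      by (rule order_tendstoD) (use Basic in simp)
    then obtain n where "emeasure M (A - F n) < ennreal e"
      by (auto simp: eventually_sequentially)
    then show ?case using Fc[of n] FA[of n] oA by blast
  next
    case Empty
    then show ?case by (intro exI[of _ "{}"]) auto
  next
    case (Compl A)
    from Compl.IH[OF Compl.prems] obtain F U
      where FU: "closed F" "open U" "F \<subseteq> A" "A \<subseteq> U" "emeasure M (U - F) < ennreal e"
      by (elim exE conjE)
    have "- F - (- U) = U - F" by blast
    then show ?case using FU
      by (intro exI[of _ "- U"] exI[of _ "- F"]) auto
  next
    case (Union A)
    \<comment> \<open>These errors sum to \<open>e / 2\<close>, and the other half keeps the final
      inequality strict.\<close>
    have "\<exists>F U. closed F \<and> open U \<and> F \<subseteq> A n \<and> A n \<subseteq> U \<and> emeasure M (U - F) < ennreal (e / 4 * (1/2) ^ n)"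
      for n using Union by simp
    then obtain F U where FU: "\<And>n. closed (F n)" "\<And>n. open (U n)" "\<And>n. F n \<subseteq> A n" "\<And>n. A n \<subseteq> U n"
      "\<And>n. emeasure M (U n - F n) < ennreal (e / 4 * (1/2) ^ n)" by metis
    define V where "V = (\<Union>n. U n)"
    \<comment> \<open>A countable union of closed sets need not be closed, so only finite unions are
      taken and the loss is controlled by continuity from above.\<close>
    define G where "G n = (\<Union>i<n. F i)" for n
    have Gc: "closed (G n)" for n unfolding G_def using FU by auto
    have oV: "open V" unfolding V_def using FU by auto
    have "(\<lambda>n. emeasure M (V - G n)) \<longlonglongrightarrow> emeasure M (\<Inter>n. V - G n)"
    proof (rule Lim_emeasure_decseq)
      show "range (\<lambda>n. V - G n) \<subseteq> sets M" using Gc oV by auto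
      show "decseq (\<lambda>n. V - G n)" unfolding decseq_def G_def by force
    qed (simp add: emeasure_finite)
    moreover have "emeasure M (\<Inter>n. V - G n) < ennreal e"
    proof -
      have "(\<Inter>n. V - G n) \<subseteq> (\<Union>n. U n - F n)" unfolding V_def G_def by blast
      then have "emeasure M (\<Inter>n. V - G n) \<le> emeasure M (\<Union>n. U n - F n)"
        by (rule emeasure_mono) (use FU in auto)
      also have "\<dots> \<le> (\<Sum>n. emeasure M (U n - F n))"
        by (rule emeasure_subadditive_countably) (use FU in auto)
      also have "\<dots> \<le> (\<Sum>n. ennreal (e / 4 * (1/2) ^ n))"
        by (intro suminf_le less_imp_le[OF FU(5)]) auto
      also have "\<dots> = ennreal (\<Sum>n. e / 4 * (1/2) ^ n)"
        by (rule suminf_ennreal2) (use \<open>e > 0\<close> in \<open>auto intro!: summable_mult summable_geometric\<close>)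
      also have "(\<Sum>n. e / 4 * (1/2::real) ^ n) = e / 2"
        by (subst suminf_mult) (auto simp: suminf_geometric summable_geometric)
      also have "ennreal (e / 2) < ennreal e" using \<open>e > 0\<close> by (simp add: ennreal_lessI)
      finally show ?thesis .
    qed
    ultimately have "\<forall>\<^sub>F n in sequentially. emeasure M (V - G n) < ennreal e"
      by (rule order_tendstoD)
    then obtain n where "emeasure M (V - G n) < ennreal e"
      by (auto simp: eventually_sequentially)
    moreover have "G n \<subseteq> (\<Union>i. A i)" using FU(3) unfolding G_def by blast
    moreover have "(\<Union>i. A i) \<subseteq> V" using FU(4) unfolding V_def by blast
    ultimately show ?case using Gc[of n] oV by (intro exI conjI)
  qed
qed

lemma UN_balls: "(\<Union>n. ball x0 (real n)) = UNIV"
  by (auto simp: reals_Archimedean2)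

lemma sigma_finite_measure_balls:
  fixes M :: "'a::metric_space measure"
  assumes sets_M: "sets M = sets borel" and fin: "\<And>x \<rho>. emeasure M (ball x \<rho>) < \<infinity>"
  shows "sigma_finite_measure M"
proof
  fix x0 :: 'a
  show "\<exists>A. countable A \<and> A \<subseteq> sets M \<and> \<Union> A = space M \<and> (\<forall>a\<in>A. emeasure M a \<noteq> \<infinity>)"
    by (intro exI[of _ "range (\<lambda>n. ball x0 (real n))"])
      (use fin sets_eq_imp_space_eq[OF sets_M] in \<open>auto simp: UN_balls sets_M less_top[symmetric]\<close>)
qed

section \<open>Doubling measures\<close>

locale homogeneous_space =
  fixes \<mu> :: "'a::metric_space measure" and D :: real
  assumes sets_\<mu>: "sets \<mu> = sets borel"
    and D_ge_1: "D \<ge> 1"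
    and emeasure_ball_pos: "\<rho> > 0 \<Longrightarrow> 0 < emeasure \<mu> (ball x \<rho>)"
    and emeasure_ball_finite: "emeasure \<mu> (ball x \<rho>) < \<infinity>"
    and doubling: "\<rho> > 0 \<Longrightarrow> emeasure \<mu> (ball x (2 * \<rho>)) \<le> ennreal D * emeasure \<mu> (ball x \<rho>)"
begin

lemma space_\<mu> [simp]: "space \<mu> = UNIV"
  using sets_eq_imp_space_eq[OF sets_\<mu>] by simp

lemmas [measurable_cong] = sets_\<mu>

lemma ball_sets [measurable, simp]: "ball x \<rho> \<in> sets \<mu>"
  by (simp add: sets_\<mu>)

lemma doubling_power:
  assumes "\<rho> > 0"
  shows "emeasure \<mu> (ball x (2 ^ k * \<rho>)) \<le> ennreal (D ^ k) * emeasure \<mu> (ball x \<rho>)"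
proof (induction k)
  case (Suc k)
  have "emeasure \<mu> (ball x (2 ^ Suc k * \<rho>)) \<le> ennreal D * emeasure \<mu> (ball x (2 ^ k * \<rho>))"
    using doubling[of "2 ^ k * \<rho>" x] assms by (simp add: mult.assoc)
  also have "\<dots> \<le> ennreal D * (ennreal (D ^ k) * emeasure \<mu> (ball x \<rho>))"
    by (intro mult_left_mono Suc) simp
  also have "\<dots> = ennreal (D ^ Suc k) * emeasure \<mu> (ball x \<rho>)"
    using D_ge_1 by (simp add: ennreal_mult mult.assoc)
  finally show ?case .
qed simp

sublocale sigma_finite_measure \<mu>
  by (rule sigma_finite_measure_balls[OF sets_\<mu> emeasure_ball_finite])

end

section \<open>Cells of a dyadic system\<close>

locale dyadic_space = homogeneous_space \<mu> D for \<mu> :: "'a::metric_space measure" and D +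
  fixes x0 :: 'a and s :: real and c :: "nat \<Rightarrow> 'a \<Rightarrow> 'a"
  assumes dyadic: "dyadic_system x0 s c"
begin

definition r :: "nat \<Rightarrow> real" where "r k = s / 8 ^ k"

definition cell :: "nat \<Rightarrow> 'a \<Rightarrow> 'a set" where "cell k z = {y. c k y = z}"

lemma s_pos: "s > 0"
  using dyadic unfolding dyadic_system_def by (rule conjunct1)

lemma r_pos [simp]: "r k > 0" and r_Suc: "r (Suc k) = r k / 8"
  using s_pos by (auto simp: r_def)

lemma r_nonneg [simp]: "0 \<le> r k" "r k \<noteq> 0"
  using r_pos[of k] by linarith+

lemma c_measurable [measurable]: "c k \<in> measurable \<mu> (count_space UNIV)"
proof -
  have "c k \<in> measurable borel (count_space UNIV)"
    using dyadic unfolding dyadic_system_def by blast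
  then show ?thesis by (simp cong: measurable_cong_sets add: sets_\<mu>)
qed

lemma cell_sets [measurable, simp]: "cell k z \<in> sets \<mu>"
proof -
  have "c k -` {z} \<inter> space \<mu> \<in> sets \<mu>" using c_measurable by (rule measurable_sets) simp
  then show ?thesis by (simp add: vimage_def cell_def)
qed

lemma dist_c: "dist y (c k y) < 2 * r k"
  using dyadic unfolding r_def dyadic_system_def by blast

lemma c_near: "dist y (c k y') < r k / 4 \<Longrightarrow> c k y = c k y'"
  using dyadic unfolding r_def dyadic_system_def by blast

lemma c_top: "dist y x0 < s / 4 \<Longrightarrow> c 0 y = x0"
  using dyadic unfolding r_def dyadic_system_def by blast

lemma c_idem [simp]: "c k (c k y) = c k y"
  using c_near[of "c k y" k y] by simp

lemma c_mono: "j \<le> k \<Longrightarrow> c k y = c k y' \<Longrightarrow> c j y = c j y'"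
proof (induction k rule: dec_induct)
  case (step k)
  then show ?case using dyadic unfolding dyadic_system_def by blast
qed

lemma c_ancestor: "j \<le> k \<Longrightarrow> c j (c k y) = c j y"
  using c_mono[of j k "c k y" y] by simp

lemma cell_subset_ball: "cell k z \<subseteq> ball z (2 * r k)"
  using dist_c by (auto simp: cell_def dist_commute)

lemma ball_subset_cell: "c k z = z \<Longrightarrow> ball z (r k / 4) \<subseteq> cell k z"
  using c_near[of _ k z] by (auto simp: cell_def dist_commute)

lemma cell_mono:
  assumes "c k z = z" "j \<le> k"
  shows "cell k z \<subseteq> cell j (c j z)"
proof -
  have "c j y = c j z" if "c k y = z" for y
    using c_mono[OF assms(2), of y z] assms(1) that by simp
  then show ?thesis unfolding cell_def by blast
qed

lemma mem_cell [simp]: "x \<in> cell k (c k x)"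
  by (simp add: cell_def)

lemma emeasure_cell_pos: "c k z = z \<Longrightarrow> 0 < emeasure \<mu> (cell k z)"
  using emeasure_mono[OF ball_subset_cell cell_sets] emeasure_ball_pos[of "r k / 4" z]
  by (meson less_le_trans r_pos divide_pos_pos zero_less_numeral)

lemma emeasure_cell_finite: "emeasure \<mu> (cell k z) < \<infinity>"
  using emeasure_mono[OF cell_subset_ball ball_sets] emeasure_ball_finite le_less_trans by blast

text \<open>A cell contains the ball of radius \<open>r k / 4\<close> about its centre, so i
  doublings cost \<open>D ^ i\<close>. The exponents used later are 4, 6 and 7, for the radii 4, 16
  and 32 times \<open>r k\<close>.\<close>

lemma emeasure_ball_le_cell:
  assumes "c k z = z"
  shows "emeasure \<mu> (ball z (2 ^ i * (r k / 4))) \<le> ennreal (D ^ i) * emeasure \<mu> (cell k z)"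
proof -
  have "emeasure \<mu> (ball z (2 ^ i * (r k / 4))) \<le> ennreal (D ^ i) * emeasure \<mu> (ball z (r k / 4))"
    by (rule doubling_power) simp
  also have "\<dots> \<le> ennreal (D ^ i) * emeasure \<mu> (cell k z)"
    by (intro mult_left_mono emeasure_mono ball_subset_cell assms) auto
  finally show ?thesis .
qed

text \<open>Cells are indexed by scale and centre, not by point set, because the same set may be a
  cell at several scales. This one selection rule serves differentiation, the Calderon-Zygmund
  decomposition and the stopping cells.\<close>

definition maximal_cells :: "(nat \<Rightarrow> 'a \<Rightarrow> bool) \<Rightarrow> (nat \<times> 'a) set" where
  "maximal_cells S = {(k, z). c k z = z \<and> S k z \<and> (\<forall>j<k. \<not> S j (c j z))}"

abbreviation cells :: "nat \<times> 'a \<Rightarrow> 'a set" where "cells P \<equiv> cell (fst P) (snd P)"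

lemma countable_centres: "countable (SIGMA k:UNIV. range (c k))"
proof (rule countable_SIGMA)
  show "countable (range (c k))" for k using dyadic unfolding dyadic_system_def by blast
qed simp

lemma countable_maximal_cells: "countable (maximal_cells S)"
proof (rule countable_subset[OF _ countable_centres])
  show "maximal_cells S \<subseteq> (SIGMA k:UNIV. range (c k))"
    by (auto simp: maximal_cells_def) (metis rangeI)
qed

lemma disjoint_maximal_cells: "disjoint_family_on cells (maximal_cells S)"
proof -
  have less: False if "(j, z) \<in> maximal_cells S" "(k, z') \<in> maximal_cells S" "j < k"
    "x \<in> cell j z" "x \<in> cell k z'" for j k z z' x
  proof -
    have "c k z' = c k x" using that by (simp add: cell_def maximal_cells_def)
    then have "c j z' = z" using that c_mono[of j k z' x] by (simp add: cell_def)
    then show False using that by (auto simp: maximal_cells_def)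
  qed
  show ?thesis unfolding disjoint_family_on_def
  proof (intro ballI impI)
    fix P Q assume PQ: "P \<in> maximal_cells S" "Q \<in> maximal_cells S" "P \<noteq> Q"
    show "cells P \<inter> cells Q = {}"
    proof (rule ccontr)
      assume "cells P \<inter> cells Q \<noteq> {}"
      then obtain x where x: "x \<in> cells P" "x \<in> cells Q" by blast
      then have "fst P = fst Q"
        using less[of "fst P" "snd P" "fst Q" "snd Q" x] less[of "fst Q" "snd Q" "fst P" "snd P" x] PQ
        by force
      then show False using x PQ(3) by (auto simp: cell_def prod_eq_iff)
    qed
  qed
qed

text \<open>Scales start at 0, so among the selected cells containing a point there is always a
  coarsest one.\<close>

lemma UN_maximal_cells: "(\<Union>P\<in>maximal_cells S. cells P) = {x. \<exists>k. S k (c k x)}"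
proof safe
  fix k z x assume "(k, z) \<in> maximal_cells S" "x \<in> cells (k, z)"
  then show "\<exists>k. S k (c k x)" by (auto simp: maximal_cells_def cell_def)
next
  fix x k assume "S k (c k x)"
  define m where "m = (LEAST k. S k (c k x))"
  have "S m (c m x)" unfolding m_def using \<open>S k (c k x)\<close> by (rule LeastI)
  moreover have "\<not> S j (c j (c m x))" if "j < m" for j
    using not_less_Least[of j "\<lambda>k. S k (c k x)"] that c_ancestor[of j m x] by (simp add: m_def)
  ultimately have "(m, c m x) \<in> maximal_cells S" by (auto simp: maximal_cells_def)
  then show "x \<in> (\<Union>P\<in>maximal_cells S. cells P)" by force
qed

lemma emeasure_UN_cells:
  assumes "sets N = sets \<mu>" "countable I" "disjoint_family_on cells I"
  shows "emeasure N (\<Union>P\<in>I. cells P) = (\<integral>\<^sup>+P. emeasure N (cells P) \<partial>count_space I)"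
  by (rule emeasure_UN_countable) (use assms in auto)

text \<open>A one-sided form of Lebesgue differentiation. If the bad set had positive measure,
  enclose it in a slightly larger open set and cover it by disjoint cells inside that set, each
  meeting the bad set. On every such cell the average is at most \<open>t\<close>, while on the bad
  set \<open>h\<close> exceeds \<open>t\<close> by a fixed amount; the excess is then bounded by the
  measure lost in the enclosure.\<close>

lemma AE_le_of_cell_averages_le:
  assumes h [measurable]: "h \<in> borel_measurable \<mu>"
  shows "AE x in \<mu>. (\<forall>k\<ge>n. (\<integral>\<^sup>+y\<in>cell k (c k x). h y \<partial>\<mu>) \<le> ennreal t * emeasure \<mu> (cell k (c k x)))
    \<longrightarrow> h x \<le> ennreal t"
proof -
  define G where "G x \<longleftrightarrow>
    (\<forall>k\<ge>n. (\<integral>\<^sup>+y\<in>cell k (c k x). h y \<partial>\<mu>) \<le> ennreal t * emeasure \<mu> (cell k (c k x)))" for x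
  have [measurable]: "Measurable.pred \<mu> G"
  proof -
    have "Measurable.pred \<mu> (\<lambda>x. \<phi> (c k x))" for \<phi> :: "'a \<Rightarrow> bool" and k
      using measurable_compose[OF c_measurable[of k], of \<phi> "count_space UNIV"] by simp
    then show ?thesis unfolding G_def by measurable
  qed
  \<comment> \<open>The index \<open>q\<close> quantifies the excess over \<open>t\<close>, and the
    ball of radius \<open>R\<close> keeps the measure finite so that regularity applies.\<close>
  define A where "A q R = {x. G x \<and> ennreal t + ennreal (1 / real (Suc q)) \<le> h x \<and> x \<in> ball x0 (real R)}" for q R
  have A [measurable]: "A q R \<in> sets \<mu>" for q R
  proof -
    have "{x \<in> space \<mu>. G x \<and> ennreal t + ennreal (1 / real (Suc q)) \<le> h x \<and> x \<in> ball x0 (real R)} \<in> sets \<mu>"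
      by measurable
    then show ?thesis by (simp add: A_def)
  qed
  have null: "emeasure \<mu> (A q R) = 0" for q R
  proof -
    define a where "a = measure \<mu> (A q R)"
    have "emeasure \<mu> (A q R) \<le> emeasure \<mu> (ball x0 (real R))"
      by (rule emeasure_mono) (auto simp: A_def)
    then have fin: "emeasure \<mu> (A q R) < \<infinity>" using emeasure_ball_finite le_less_trans by blast
    then have ea: "emeasure \<mu> (A q R) = ennreal a" by (simp add: a_def emeasure_eq_ennreal_measure)
    have "a / real (Suc q) \<le> max t 0 * e" if e: "e > 0" for e
    proof -
      define M where "M = density \<mu> (indicator (ball x0 (real R)))"
      have eM: "emeasure M B = emeasure \<mu> (ball x0 (real R) \<inter> B)" if "B \<in> sets borel" for B
        using that by (simp add: M_def emeasure_restricted sets_\<mu>)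
      interpret M: finite_measure M
      proof (rule finite_measureI)
        have "emeasure M (space M) = emeasure \<mu> (ball x0 (real R))"
          using eM[of UNIV] by (simp add: M_def)
        then show "emeasure M (space M) \<noteq> \<infinity>"
          using emeasure_ball_finite[of x0 "real R"] by simp
      qed
      obtain F U where FU: "closed F" "open U" "F \<subseteq> A q R" "A q R \<subseteq> U" "emeasure M (U - F) < ennreal e"
        using finite_borel_measure_regular[OF M.finite_measure_axioms _ _ e, of "A q R"] A[of q R] by (auto simp: M_def sets_\<mu>)
      define V where "V = U \<inter> ball x0 (real R)"
      have V: "open V" "A q R \<subseteq> V" using FU by (auto simp: V_def A_def)
      have VA: "emeasure \<mu> V \<le> ennreal a + ennreal e"
      proof -
        have Fs: "F \<in> sets \<mu>" "U \<in> sets \<mu>" using FU by (auto simp: sets_\<mu>)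
        have "emeasure \<mu> V \<le> emeasure \<mu> (A q R \<union> (ball x0 (real R) \<inter> (U - F)))"
          by (rule emeasure_mono) (use FU Fs in \<open>auto simp: V_def\<close>)
        also have "\<dots> \<le> emeasure \<mu> (A q R) + emeasure \<mu> (ball x0 (real R) \<inter> (U - F))"
          by (rule emeasure_subadditive) (use Fs in auto)
        also have "\<dots> \<le> ennreal a + ennreal e"
          using FU(5) ea eM[of "U - F"] FU(1,2) by (intro add_mono) (auto simp: sets_\<mu>)
        finally show ?thesis .
      qed
      \<comment> \<open>A cell that meets the bad set contains a point at which the hypothesis on
        averages holds, and that hypothesis concerns the cell itself.\<close>
      define S where "S k z \<longleftrightarrow> k \<ge> n \<and> cell k z \<subseteq> V \<and> A q R \<inter> cell k z \<noteq> {}" for k z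
      define W where "W = (\<Union>P\<in>maximal_cells S. cells P)"
      have W: "A q R \<subseteq> W" "W \<subseteq> V"
      proof -
        show "A q R \<subseteq> W"
        proof
          fix x assume x: "x \<in> A q R"
          then obtain d where d: "d > 0" "ball x d \<subseteq> V" using V open_contains_ball by blast
          obtain k0 where k0: "4 * s / d < 8 ^ k0" using real_arch_pow[of 8 "4 * s / d"] by auto
          define k where "k = max k0 n"
          have "(8::real) ^ k0 \<le> 8 ^ k" by (simp add: k_def)
          then have "4 * s / d < 8 ^ k" using k0 by linarith
          then have rk: "4 * r k < d" using d(1) by (simp add: r_def field_simps)
          have "cell k (c k x) \<subseteq> ball x d"
          proof
            fix y assume "y \<in> cell k (c k x)"
            then have "dist y (c k x) < 2 * r k" using dist_c[of y k] by (simp add: cell_def)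
            moreover have "dist x (c k x) < 2 * r k" by (rule dist_c)
            moreover have "dist x y \<le> dist x (c k x) + dist y (c k x)" by (rule dist_triangle2)
            ultimately show "y \<in> ball x d" using rk by simp
          qed
          then have "S k (c k x)" unfolding S_def using d x by (auto simp: k_def)
          then show "x \<in> W" unfolding W_def UN_maximal_cells by blast
        qed
        show "W \<subseteq> V" unfolding W_def by (auto simp: maximal_cells_def S_def)
      qed
      have cellS: "(\<integral>\<^sup>+y\<in>cells P. h y \<partial>\<mu>) \<le> ennreal t * emeasure \<mu> (cells P)" if "P \<in> maximal_cells S" for P
      proof -
        obtain x where x: "x \<in> A q R" "x \<in> cells P" "n \<le> fst P"
          using \<open>P \<in> maximal_cells S\<close> unfolding maximal_cells_def S_def by auto
        then have "c (fst P) x = snd P" by (simp add: cell_def)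
        then show ?thesis using x unfolding A_def G_def by auto
      qed
      have Ws: "W \<in> sets \<mu>" unfolding W_def
        by (intro sets.countable_UN'' countable_maximal_cells) simp
      have "(ennreal t + ennreal (1 / real (Suc q))) * ennreal a
          = (\<integral>\<^sup>+y\<in>A q R. (ennreal t + ennreal (1 / real (Suc q))) \<partial>\<mu>)"
        by (simp add: ea nn_integral_cmult_indicator)
      also have "\<dots> \<le> (\<integral>\<^sup>+y\<in>W. h y \<partial>\<mu>)"
        by (intro nn_integral_mono) (use W in \<open>auto simp: A_def indicator_def\<close>)
      also have "\<dots> = emeasure (density \<mu> h) W"
        using Ws by (simp add: emeasure_density)
      also have "\<dots> = (\<integral>\<^sup>+P. emeasure (density \<mu> h) (cells P) \<partial>count_space (maximal_cells S))"
        unfolding W_def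
        by (intro emeasure_UN_cells countable_maximal_cells disjoint_maximal_cells) simp
      also have "\<dots> \<le> (\<integral>\<^sup>+P. ennreal t * emeasure \<mu> (cells P) \<partial>count_space (maximal_cells S))"
        by (intro nn_integral_mono) (use cellS in \<open>auto simp: emeasure_density\<close>)
      also have "\<dots> = ennreal t * emeasure \<mu> W"
        unfolding W_def
        by (subst emeasure_UN_cells) (auto intro: countable_maximal_cells disjoint_maximal_cells nn_integral_cmult)
      also have "\<dots> \<le> ennreal t * (ennreal a + ennreal e)"
      proof (rule mult_left_mono)
        have "emeasure \<mu> W \<le> emeasure \<mu> V"
          by (rule emeasure_mono[OF W(2)]) (simp add: sets_\<mu> V(1))
        then show "emeasure \<mu> W \<le> ennreal a + ennreal e" using VA by (rule order_trans)
      qed simp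
      finally have "(ennreal t + ennreal (1 / real (Suc q))) * ennreal a \<le> ennreal t * (ennreal a + ennreal e)" .
      \<comment> \<open>A negative \<open>t\<close> is sent to 0 by \<open>ennreal\<close>; the real
        computation below has to use that value.\<close>
      moreover have "ennreal t = ennreal (max t 0)" by (simp add: max_def ennreal_neg)
      ultimately have "ennreal (max t 0 + 1 / real (Suc q)) * ennreal a \<le> ennreal (max t 0) * ennreal (a + e)"
        using e by (subst ennreal_plus; simp add: a_def)+
      then have "(max t 0 + 1 / real (Suc q)) * a \<le> max t 0 * (a + e)"
        using e by (subst (asm) (1 2) ennreal_mult[symmetric]) (auto simp: a_def)
      then show ?thesis by (simp add: algebra_simps)
    qed
    then have "a \<le> 0"
    proof -
      assume *: "\<And>e. e > 0 \<Longrightarrow> a / real (Suc q) \<le> max t 0 * e"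
      show "a \<le> 0"
      proof (rule ccontr)
        assume "\<not> a \<le> 0"
        define b where "b = a / real (Suc q)"
        define u where "u = max t 0 + 1"
        have b: "b > 0" using \<open>\<not> a \<le> 0\<close> by (simp add: b_def)
        have u: "u > 0" "max t 0 \<le> u" by (auto simp: u_def)
        have e: "b / (2 * u) > 0" using b u(1) by simp
        have "b \<le> max t 0 * (b / (2 * u))" using *[OF e] by (simp only: b_def)
        also have "\<dots> \<le> u * (b / (2 * u))" using u(2) e by (intro mult_right_mono) auto
        also have "\<dots> = b / 2" using u(1) by simp
        finally show False using b by linarith
      qed
    qed
    then show ?thesis using ea by (simp add: ennreal_neg)
  qed
  have "AE x in \<mu>. \<forall>q R. x \<notin> A q R"
    unfolding AE_all_countable using null by (auto intro!: AE_not_in simp: null_sets_def)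
  then show ?thesis
  proof (rule AE_mp, intro AE_I2 impI)
    fix x assume x: "\<forall>q R. x \<notin> A q R"
      and "\<forall>k\<ge>n. (\<integral>\<^sup>+y\<in>cell k (c k x). h y \<partial>\<mu>) \<le> ennreal t * emeasure \<mu> (cell k (c k x))"
    then have G: "G x" by (simp add: G_def)
    obtain R where R: "x \<in> ball x0 (real R)" using UN_balls[of x0] by blast
    show "h x \<le> ennreal t"
    proof (rule ennreal_le_epsilon)
      fix e :: real assume "e > 0"
      then obtain q where q: "inverse (real (Suc q)) < e" using reals_Archimedean by blast
      have "x \<notin> A q R" using x by blast
      then have "h x < ennreal t + ennreal (1 / real (Suc q))" using G R by (auto simp: A_def not_le)
      also have "\<dots> \<le> ennreal t + ennreal e" using q by (intro add_left_mono ennreal_leI) (simp add: inverse_eq_divide)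
      finally show "h x \<le> ennreal t + ennreal e" by simp
    qed
  qed
qed

end

section \<open>Maximal inequalities\<close>

text \<open>The value \<open>top\<close> is included because the maximal functions to which this is
  applied may be infinite.\<close>

lemma layer_cake_square:
  fixes u :: ennreal
  shows "(\<integral>\<^sup>+t. ennreal (2 * t) * indicator {t. 0 < t \<and> ennreal t < u} t \<partial>lborel) = u\<^sup>2"
proof -
  have fin: "(\<integral>\<^sup>+t. ennreal (2 * t) * indicator {t. 0 < t \<and> ennreal t < ennreal a} t \<partial>lborel) = (ennreal a)\<^sup>2"
    if "a \<ge> 0" for a
  proof -
    have "(\<integral>\<^sup>+t. ennreal (2 * t) * indicator {t. 0 < t \<and> ennreal t < ennreal a} t \<partial>lborel)
        = (\<integral>\<^sup>+t. ennreal (2 * t) * indicator {0..a} t \<partial>lborel)"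
    proof (rule nn_integral_cong_AE)
      have "AE t in lborel. t \<noteq> a" by (rule AE_lborel_singleton)
      then show "AE t in lborel. ennreal (2 * t) * indicator {t. 0 < t \<and> ennreal t < ennreal a} t
          = ennreal (2 * t) * indicator {0..a} t"
        by eventually_elim (auto simp: indicator_def ennreal_less_iff)
    qed
    also have "\<dots> = ennreal (a\<^sup>2 - 0\<^sup>2)"
      by (rule nn_integral_FTC_Icc) (use that in \<open>auto intro!: derivative_eq_intros\<close>)
    finally show ?thesis using that by (simp add: ennreal_power)
  qed
  show ?thesis
  proof (cases u)
    case (real a)
    then show ?thesis using fin by simp
  next
    case top
    have "ennreal (real n) \<le> (\<integral>\<^sup>+t. ennreal (2 * t) * indicator {t. 0 < t \<and> ennreal t < u} t \<partial>lborel)"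
      for n :: nat
    proof -
      have "ennreal (real n) \<le> ennreal ((real n)\<^sup>2)"
      proof (rule ennreal_leI)
        show "real n \<le> (real n)\<^sup>2" by (cases n) (auto simp: power2_eq_square)
      qed
      also have "\<dots> = (ennreal (real n))\<^sup>2" by (simp add: ennreal_power)
      also have "\<dots> = (\<integral>\<^sup>+t. ennreal (2 * t) * indicator {t. 0 < t \<and> ennreal t < ennreal (real n)} t \<partial>lborel)"
        using fin[of "real n"] by simp
      also have "\<dots> \<le> (\<integral>\<^sup>+t. ennreal (2 * t) * indicator {t. 0 < t \<and> ennreal t < u} t \<partial>lborel)"
        by (intro nn_integral_mono) (auto simp: indicator_def top)
      finally show ?thesis .
    qed
    then have "\<not> (\<integral>\<^sup>+t. ennreal (2 * t) * indicator {t. 0 < t \<and> ennreal t < u} t \<partial>lborel) < of_nat n"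
      for n by (simp add: ennreal_of_nat_eq_real_of_nat not_less)
    then have "(\<integral>\<^sup>+t. ennreal (2 * t) * indicator {t. 0 < t \<and> ennreal t < u} t \<partial>lborel) = top"
      using ennreal_Ex_less_of_nat by (metis less_top)
    then show ?thesis using top by (simp add: power2_eq_square ennreal_mult_eq_top_iff)
  qed
qed

text \<open>Pick a ball of largest radius and discard all balls meeting it. They have no larger
  radius, so tripling the chosen ball swallows them; induct on the rest.\<close>

lemma finite_Vitali_covering:
  fixes z :: "'i \<Rightarrow> 'a::metric_space"
  assumes "finite I"
  shows "\<exists>J\<subseteq>I. disjoint_family_on (\<lambda>i. ball (z i) (\<rho> i)) J \<and>
    (\<Union>i\<in>I. ball (z i) (\<rho> i)) \<subseteq> (\<Union>i\<in>J. ball (z i) (3 * \<rho> i))"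
  using assms
proof (induction I rule: finite_psubset_induct)
  case (psubset I)
  show ?case
  proof (cases "I = {}")
    case False
    then have "Max (\<rho> ` I) \<in> \<rho> ` I" using psubset.hyps by (intro Max_in) auto
    then obtain i where i: "i \<in> I" "\<rho> i = Max (\<rho> ` I)" by auto
    have max: "\<rho> j \<le> \<rho> i" if "j \<in> I" for j
      using psubset.hyps that by (simp add: i(2))
    define I' where "I' = {j \<in> I - {i}. ball (z j) (\<rho> j) \<inter> ball (z i) (\<rho> i) = {}}"
    have "I' \<subset> I" using i(1) by (auto simp: I'_def)
    from psubset.IH[OF this] obtain J where J: "J \<subseteq> I'"
      "disjoint_family_on (\<lambda>i. ball (z i) (\<rho> i)) J"
      "(\<Union>i\<in>I'. ball (z i) (\<rho> i)) \<subseteq> (\<Union>i\<in>J. ball (z i) (3 * \<rho> i))"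
      by (elim exE conjE)
    have near: "ball (z j) (\<rho> j) \<subseteq> ball (z i) (3 * \<rho> i)" if j: "j \<in> I" "j \<notin> I'" for j
    proof
      fix x assume x: "x \<in> ball (z j) (\<rho> j)"
      show "x \<in> ball (z i) (3 * \<rho> i)"
      proof (cases "j = i")
        case True
        then show ?thesis using x by (auto intro: less_le_trans zero_le_dist)
            (smt (verit) zero_le_dist)
      next
        case False
        then obtain y where y: "dist (z j) y < \<rho> j" "dist (z i) y < \<rho> i"
          using j by (auto simp: I'_def)
        have "dist (z i) x \<le> dist (z i) y + (dist (z j) y + dist (z j) x)"
          by (metis add_left_mono dist_commute dist_triangle order_trans)
        then show ?thesis using x y max[OF j(1)] by simp
      qed
    qed
    show ?thesis
    proof (intro exI[of _ "insert i J"] conjI)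
      show "insert i J \<subseteq> I" using J(1) i(1) by (auto simp: I'_def)
      show "disjoint_family_on (\<lambda>i. ball (z i) (\<rho> i)) (insert i J)"
        using J(1,2) unfolding disjoint_family_on_def I'_def by blast
      show "(\<Union>i\<in>I. ball (z i) (\<rho> i)) \<subseteq> (\<Union>i\<in>insert i J. ball (z i) (3 * \<rho> i))"
        using J(3) near by blast
    qed
  qed (auto simp: disjoint_family_on_def)
qed

text \<open>Vitali selection returns tripled balls, and the hypothesis measures exactly those.
  Summing it over the disjoint selected balls gives the integral over their union.\<close>

lemma weak_maximal_inequality:
  fixes \<nu> :: "'a::metric_space measure" and z :: "'i \<Rightarrow> 'a"
  assumes sets_\<nu>: "sets \<nu> = sets borel" and I: "finite I"
    and h [measurable]: "h \<in> borel_measurable \<nu>"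
    and large: "\<And>i. i \<in> I \<Longrightarrow> t * emeasure \<nu> (ball (z i) (3 * \<rho> i)) \<le> (\<integral>\<^sup>+y\<in>ball (z i) (\<rho> i). h y \<partial>\<nu>)"
  shows "t * emeasure \<nu> (\<Union>i\<in>I. ball (z i) (\<rho> i)) \<le> (\<integral>\<^sup>+y\<in>(\<Union>i\<in>I. ball (z i) (\<rho> i)). h y \<partial>\<nu>)"
proof -
  have [measurable, simp]: "ball a b \<in> sets \<nu>" for a b by (simp add: sets_\<nu>)
  obtain J where J: "J \<subseteq> I" and dJ: "disjoint_family_on (\<lambda>i. ball (z i) (\<rho> i)) J"
    and cov: "(\<Union>i\<in>I. ball (z i) (\<rho> i)) \<subseteq> (\<Union>i\<in>J. ball (z i) (3 * \<rho> i))"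
    using finite_Vitali_covering[OF I, of z \<rho>] by (elim exE conjE)
  have fJ: "finite J" using J I finite_subset by blast
  have "t * emeasure \<nu> (\<Union>i\<in>I. ball (z i) (\<rho> i)) \<le> t * emeasure \<nu> (\<Union>i\<in>J. ball (z i) (3 * \<rho> i))"
    by (intro mult_left_mono emeasure_mono cov) (use fJ in auto)
  also have "\<dots> \<le> t * (\<Sum>i\<in>J. emeasure \<nu> (ball (z i) (3 * \<rho> i)))"
    by (intro mult_left_mono emeasure_subadditive_finite fJ) auto
  also have "\<dots> \<le> (\<Sum>i\<in>J. \<integral>\<^sup>+y\<in>ball (z i) (\<rho> i). h y \<partial>\<nu>)"
    unfolding sum_distrib_left using large J by (intro sum_mono) blast
  also have "\<dots> = (\<Sum>i\<in>J. emeasure (density \<nu> h) (ball (z i) (\<rho> i)))"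
    by (simp add: emeasure_density)
  also have "\<dots> = emeasure (density \<nu> h) (\<Union>i\<in>J. ball (z i) (\<rho> i))"
    by (rule sum_emeasure) (use dJ fJ in auto)
  also have "\<dots> \<le> emeasure (density \<nu> h) (\<Union>i\<in>I. ball (z i) (\<rho> i))"
    by (rule emeasure_mono) (use J I in auto)
  also have "\<dots> = (\<integral>\<^sup>+y\<in>(\<Union>i\<in>I. ball (z i) (\<rho> i)). h y \<partial>\<nu>)"
    using I by (subst emeasure_density) auto
  finally show ?thesis .
qed

lemma weak_maximal_inequality_countable:
  fixes \<nu> :: "'a::metric_space measure" and z :: "'i \<Rightarrow> 'a"
  assumes sets_\<nu>: "sets \<nu> = sets borel" and I: "countable I"
    and h [measurable]: "h \<in> borel_measurable \<nu>"
    and large: "\<And>i. i \<in> I \<Longrightarrow> t * emeasure \<nu> (ball (z i) (3 * \<rho> i)) \<le> (\<integral>\<^sup>+y\<in>ball (z i) (\<rho> i). h y \<partial>\<nu>)"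
  shows "t * emeasure \<nu> (\<Union>i\<in>I. ball (z i) (\<rho> i)) \<le> (\<integral>\<^sup>+y\<in>(\<Union>i\<in>I. ball (z i) (\<rho> i)). h y \<partial>\<nu>)"
proof (cases "I = {}")
  case False
  define U where "U n = (\<Union>i\<in>from_nat_into I ` {..<n}. ball (z i) (\<rho> i))" for n
  have sub: "from_nat_into I ` {..<n} \<subseteq> I" for n using from_nat_into[OF False] by auto
  have U: "(\<Union>i\<in>I. ball (z i) (\<rho> i)) = (\<Union>n. U n)"
  proof
    show "(\<Union>i\<in>I. ball (z i) (\<rho> i)) \<subseteq> (\<Union>n. U n)"
    proof
      fix x assume "x \<in> (\<Union>i\<in>I. ball (z i) (\<rho> i))"
      then obtain i where i: "i \<in> I" "x \<in> ball (z i) (\<rho> i)" by blast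
      obtain k where "from_nat_into I k = i" using from_nat_into_surj[OF I i(1)] by blast
      then have "x \<in> U (Suc k)" using i(2) unfolding U_def by blast
      then show "x \<in> (\<Union>n. U n)" by blast
    qed
    show "(\<Union>n. U n) \<subseteq> (\<Union>i\<in>I. ball (z i) (\<rho> i))" unfolding U_def using sub by blast
  qed
  have SUP_U: "(SUP n. emeasure \<nu> (U n)) = emeasure \<nu> (\<Union>n. U n)"
  proof (rule SUP_emeasure_incseq)
    show "range U \<subseteq> sets \<nu>" by (auto simp: U_def sets_\<nu>)
    show "incseq U" unfolding U_def by (intro monoI UN_mono) auto
  qed
  have "t * emeasure \<nu> (\<Union>i\<in>I. ball (z i) (\<rho> i)) = (SUP n. t * emeasure \<nu> (U n))"
    unfolding U SUP_U[symmetric] by (rule SUP_mult_left_ennreal)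
  also have "\<dots> \<le> (\<integral>\<^sup>+y\<in>(\<Union>i\<in>I. ball (z i) (\<rho> i)). h y \<partial>\<nu>)"
  proof (rule SUP_least)
    fix n
    have "t * emeasure \<nu> (U n) \<le> (\<integral>\<^sup>+y\<in>U n. h y \<partial>\<nu>)"
      unfolding U_def using sub[of n] by (intro weak_maximal_inequality[OF sets_\<nu> _ h] large) auto
    also have "\<dots> \<le> (\<integral>\<^sup>+y\<in>(\<Union>i\<in>I. ball (z i) (\<rho> i)). h y \<partial>\<nu>)"
      unfolding U by (intro nn_integral_mono) (auto simp: indicator_def)
    finally show "t * emeasure \<nu> (U n) \<le> (\<integral>\<^sup>+y\<in>(\<Union>i\<in>I. ball (z i) (\<rho> i)). h y \<partial>\<nu>)" .
  qed
  finally show ?thesis .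
qed simp

text \<open>Dividing by the measure of the tripled ball makes the constant independent of the measure, which
  need not be doubling with a controlled constant.\<close>

lemma strong_maximal_inequality:
  fixes \<nu> :: "'a::metric_space measure" and z :: "'i \<Rightarrow> 'a"
  assumes sets_\<nu>: "sets \<nu> = sets borel" and sf: "sigma_finite_measure \<nu>" and I: "finite I"
    and h [measurable]: "h \<in> borel_measurable \<nu>"
    and pos: "\<And>i. i \<in> I \<Longrightarrow> 0 < emeasure \<nu> (ball (z i) (3 * \<rho> i))"
    and fin: "\<And>i. i \<in> I \<Longrightarrow> emeasure \<nu> (ball (z i) (3 * \<rho> i)) < \<infinity>"
    and \<rho>: "\<And>i. i \<in> I \<Longrightarrow> 0 \<le> \<rho> i"
  shows "(\<integral>\<^sup>+x. (SUP i\<in>I. (\<integral>\<^sup>+y\<in>ball (z i) (\<rho> i). h y \<partial>\<nu>) / emeasure \<nu> (ball (z i) (3 * \<rho> i))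
      * indicator (ball (z i) (\<rho> i)) x)\<^sup>2 \<partial>\<nu>) \<le> 8 * (\<integral>\<^sup>+x. (h x)\<^sup>2 \<partial>\<nu>)"
proof -
  interpret sigma_finite_measure \<nu> by (rule sf)
  interpret pair_sigma_finite \<nu> lborel ..
  have [measurable, simp]: "ball a b \<in> sets \<nu>" for a b by (simp add: sets_\<nu>)
  define B where "B i = ball (z i) (\<rho> i)" for i
  have [measurable, simp]: "B i \<in> sets \<nu>" for i by (simp add: B_def)
  define m where "m i = (\<integral>\<^sup>+y\<in>B i. h y \<partial>\<nu>) / emeasure \<nu> (ball (z i) (3 * \<rho> i))" for i
  define M where "M x = (SUP i\<in>I. m i * indicator (B i) x)" for x
  have M [measurable]: "M \<in> borel_measurable \<nu>"
    unfolding M_def using I by (intro borel_measurable_SUP) (auto intro: countable_finite)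
  have weak: "ennreal t * emeasure \<nu> {x. ennreal t < M x}
      \<le> 2 * (\<integral>\<^sup>+y. h y * indicator {y. ennreal (t / 2) < h y} y \<partial>\<nu>)" if t: "t > 0" for t
  proof -
    \<comment> \<open>The part of \<open>h\<close> below \<open>t / 2\<close> adds at most
      \<open>t / 2\<close> to any average, so an average above \<open>t\<close> forces one of
      \<open>h1\<close> above \<open>t / 2\<close>. Integrating only over large values of
      \<open>h\<close> is what later makes the integral in \<open>t\<close> converge.\<close>
    define h1 where "h1 y = h y * indicator {y. ennreal (t / 2) < h y} y" for y
    have [measurable]: "h1 \<in> borel_measurable \<nu>" unfolding h1_def by measurable
    define J where "J = {i \<in> I. ennreal t < m i}"
    have J: "finite J" "J \<subseteq> I" using I by (auto simp: J_def)
    have "{x. ennreal t < M x} = (\<Union>i\<in>J. B i)"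
      by (auto simp: M_def J_def less_SUP_iff indicator_def split: if_splits)
    have "ennreal (t / 2) * emeasure \<nu> (\<Union>i\<in>J. B i) \<le> (\<integral>\<^sup>+y\<in>(\<Union>i\<in>J. B i). h1 y \<partial>\<nu>)"
      unfolding B_def
    proof (rule weak_maximal_inequality[OF sets_\<nu> J(1)])
      fix i assume "i \<in> J"
      then have i: "i \<in> I" "ennreal t < m i" by (auto simp: J_def)
      let ?E = "emeasure \<nu> (ball (z i) (3 * \<rho> i))"
      have E: "0 < ?E" "?E < \<infinity>" using pos fin i by auto
      have "ennreal t * ?E \<le> m i * ?E" using i by (intro mult_right_mono) auto
      also have "\<dots> = (\<integral>\<^sup>+y\<in>B i. h y \<partial>\<nu>)"
        using E by (simp add: m_def ennreal_divide_times ennreal_mult_divide_eq less_top)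
      also have "\<dots> \<le> (\<integral>\<^sup>+y. h1 y * indicator (B i) y + ennreal (t / 2) * indicator (B i) y \<partial>\<nu>)"
        by (intro nn_integral_mono) (auto simp: h1_def indicator_def not_less)
      also have "\<dots> = (\<integral>\<^sup>+y\<in>B i. h1 y \<partial>\<nu>) + ennreal (t / 2) * emeasure \<nu> (B i)"
        by (subst nn_integral_add) (auto simp: nn_integral_cmult_indicator)
      also have "\<dots> \<le> (\<integral>\<^sup>+y\<in>B i. h1 y \<partial>\<nu>) + ennreal (t / 2) * ?E"
        using \<rho>[OF i(1)] unfolding B_def by (intro add_left_mono mult_left_mono emeasure_mono subset_ball) auto
      finally have "ennreal t * ?E \<le> (\<integral>\<^sup>+y\<in>B i. h1 y \<partial>\<nu>) + ennreal (t / 2) * ?E" .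
      moreover have "ennreal t * ?E = ennreal (t / 2) * ?E + ennreal (t / 2) * ?E"
        using t by (simp add: distrib_right[symmetric] ennreal_plus[symmetric] del: ennreal_plus)
      ultimately have "ennreal (t / 2) * ?E + ennreal (t / 2) * ?E \<le> ennreal (t / 2) * ?E + (\<integral>\<^sup>+y\<in>B i. h1 y \<partial>\<nu>)"
        by (simp add: add.commute)
      \<comment> \<open>Finiteness is what permits cancelling this term on both sides in
        \<open>ennreal\<close>.\<close>
      moreover have "ennreal (t / 2) * ?E < top" using E by (simp add: ennreal_mult_less_top)
      ultimately show "ennreal (t / 2) * ?E \<le> (\<integral>\<^sup>+y\<in>ball (z i) (\<rho> i). h1 y \<partial>\<nu>)"
        unfolding B_def by (auto simp: ennreal_add_left_cancel_le)
    qed simp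
    also have "\<dots> \<le> (\<integral>\<^sup>+y. h1 y \<partial>\<nu>)"
      by (intro nn_integral_mono) (auto simp: indicator_def)
    finally have *: "ennreal (t / 2) * emeasure \<nu> (\<Union>i\<in>J. B i) \<le> (\<integral>\<^sup>+y. h1 y \<partial>\<nu>)" .
    have "ennreal t = 2 * ennreal (t / 2)"
      using t ennreal_mult[of 2 "t / 2"] by simp
    then have "ennreal t * emeasure \<nu> (\<Union>i\<in>J. B i) = 2 * (ennreal (t / 2) * emeasure \<nu> (\<Union>i\<in>J. B i))"
      by (simp add: mult.assoc)
    also have "\<dots> \<le> 2 * (\<integral>\<^sup>+y. h1 y \<partial>\<nu>)" using * by (rule mult_left_mono) simp
    finally show ?thesis unfolding \<open>{x. ennreal t < M x} = (\<Union>i\<in>J. B i)\<close> h1_def .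
  qed
  have "(\<integral>\<^sup>+x. (M x)\<^sup>2 \<partial>\<nu>)
      = (\<integral>\<^sup>+x. \<integral>\<^sup>+t. ennreal (2 * t) * indicator {t. 0 < t \<and> ennreal t < M x} t \<partial>lborel \<partial>\<nu>)"
    by (simp add: layer_cake_square)
  also have "\<dots> = (\<integral>\<^sup>+t. \<integral>\<^sup>+x. ennreal (2 * t) * indicator {t. 0 < t \<and> ennreal t < M x} t \<partial>\<nu> \<partial>lborel)"
    by (rule Fubini'[symmetric]) measurable
  \<comment> \<open>The weight 2t and the weak bound with its factor 2 produce 4. Below, the set of
    \<open>t\<close> with \<open>t / 2\<close> less than \<open>h x\<close> has length
    \<open>2 * h x\<close>, which completes the constant 8.\<close>
  also have "\<dots> \<le> (\<integral>\<^sup>+t. \<integral>\<^sup>+x. 4 * (h x * indicator {t. 0 < t \<and> ennreal (t / 2) < h x} t) \<partial>\<nu> \<partial>lborel)"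
  proof (rule nn_integral_mono)
    fix t :: real
    show "(\<integral>\<^sup>+x. ennreal (2 * t) * indicator {t. 0 < t \<and> ennreal t < M x} t \<partial>\<nu>)
        \<le> (\<integral>\<^sup>+x. 4 * (h x * indicator {t. 0 < t \<and> ennreal (t / 2) < h x} t) \<partial>\<nu>)"
    proof (cases "t > 0")
      case True
      have [measurable]: "{x. ennreal t < M x} \<in> sets \<nu>"
      proof -
        have "{x \<in> space \<nu>. ennreal t < M x} \<in> sets \<nu>" by measurable
        then show ?thesis using sets_eq_imp_space_eq[OF sets_\<nu>] by simp
      qed
      have "(\<integral>\<^sup>+x. ennreal (2 * t) * indicator {t. 0 < t \<and> ennreal t < M x} t \<partial>\<nu>)
          = (\<integral>\<^sup>+x. ennreal (2 * t) * indicator {x. ennreal t < M x} x \<partial>\<nu>)"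
        using True by (intro nn_integral_cong) (auto simp: indicator_def)
      also have "\<dots> = 2 * (ennreal t * emeasure \<nu> {x. ennreal t < M x})"
      proof -
        have "ennreal (2 * t) = 2 * ennreal t" using True by (simp add: ennreal_mult)
        moreover have "(\<integral>\<^sup>+x. ennreal (2 * t) * indicator {x. ennreal t < M x} x \<partial>\<nu>)
            = ennreal (2 * t) * emeasure \<nu> {x. ennreal t < M x}"
          by (rule nn_integral_cmult_indicator) measurable
        ultimately show ?thesis by (simp only: mult.assoc)
      qed
      also have "\<dots> \<le> 2 * (2 * (\<integral>\<^sup>+y. h y * indicator {y. ennreal (t / 2) < h y} y \<partial>\<nu>))"
        by (intro mult_left_mono weak[OF True]) simp
      also have "\<dots> = 4 * (\<integral>\<^sup>+y. h y * indicator {y. ennreal (t / 2) < h y} y \<partial>\<nu>)"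
        by (simp add: mult.assoc[symmetric])
      also have "\<dots> = (\<integral>\<^sup>+x. 4 * (h x * indicator {x. ennreal (t / 2) < h x} x) \<partial>\<nu>)"
        by (rule nn_integral_cmult[symmetric]) measurable
      also have "\<dots> = (\<integral>\<^sup>+x. 4 * (h x * indicator {t. 0 < t \<and> ennreal (t / 2) < h x} t) \<partial>\<nu>)"
        using True by (intro nn_integral_cong) (auto simp: indicator_def)
      finally show ?thesis .
    qed (simp add: indicator_def)
  qed
  also have "\<dots> = (\<integral>\<^sup>+x. \<integral>\<^sup>+t. 4 * (h x * indicator {t. 0 < t \<and> ennreal (t / 2) < h x} t) \<partial>lborel \<partial>\<nu>)"
    by (rule Fubini') measurable
  also have "\<dots> \<le> (\<integral>\<^sup>+x. 8 * (h x)\<^sup>2 \<partial>\<nu>)"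
  proof (rule nn_integral_mono)
    fix x
    have super: "emeasure lborel {t. 0 < t \<and> ennreal (t / 2) < h x} \<le> 2 * h x"
    proof (cases "h x")
      case (real a)
      have "{t. 0 < t \<and> ennreal (t / 2) < h x} \<subseteq> {0..2 * a}"
        using real by (auto simp: ennreal_less_iff)
      then have "emeasure lborel {t. 0 < t \<and> ennreal (t / 2) < h x} \<le> emeasure lborel {0..2 * a}"
        by (rule emeasure_mono) simp
      then show ?thesis using real by (simp add: ennreal_mult)
    qed (simp add: ennreal_mult_top)
    have "(\<integral>\<^sup>+t. 4 * (h x * indicator {t. 0 < t \<and> ennreal (t / 2) < h x} t) \<partial>lborel)
        = 4 * h x * emeasure lborel {t. 0 < t \<and> ennreal (t / 2) < h x}"
      by (simp add: mult.assoc[symmetric] nn_integral_cmult_indicator)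
    also have "\<dots> \<le> 4 * h x * (2 * h x)" by (intro mult_left_mono super) simp
    also have "\<dots> = (4 * 2) * (h x * h x)" by (simp only: mult_ac)
    finally show "(\<integral>\<^sup>+t. 4 * (h x * indicator {t. 0 < t \<and> ennreal (t / 2) < h x} t) \<partial>lborel) \<le> 8 * (h x)\<^sup>2"
      by (simp add: power2_eq_square)
  qed
  also have "\<dots> = 8 * (\<integral>\<^sup>+x. (h x)\<^sup>2 \<partial>\<nu>)" by (rule nn_integral_cmult) measurable
  finally show ?thesis unfolding M_def m_def B_def .
qed

section \<open>Weighted bound for sparse operators\<close>

lemma ennreal_divide_mult_cancel:
  fixes a b :: ennreal
  assumes "0 < b" "b < \<infinity>"
  shows "a / b * b = a"
  using assms by (simp add: ennreal_divide_times ennreal_mult_divide_eq less_top)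

context homogeneous_space
begin

lemma A2_char_ball:
  assumes \<rho>: "\<rho> > 0"
  shows "(\<integral>\<^sup>+y\<in>ball x \<rho>. ennreal (w y) \<partial>\<mu>) * (\<integral>\<^sup>+y\<in>ball x \<rho>. ennreal (1 / w y) \<partial>\<mu>)
    \<le> A2_char \<mu> w * (emeasure \<mu> (ball x \<rho>))\<^sup>2"
proof -
  let ?b = "emeasure \<mu> (ball x \<rho>)"
  have b: "0 < ?b" "?b < \<infinity>" using emeasure_ball_pos[OF \<rho>] emeasure_ball_finite by auto
  let ?p = "\<integral>\<^sup>+y\<in>ball x \<rho>. ennreal (w y) \<partial>\<mu>" and ?q = "\<integral>\<^sup>+y\<in>ball x \<rho>. ennreal (1 / w y) \<partial>\<mu>"
  have "?p / ?b * (?q / ?b) \<le> A2_char \<mu> w"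
    unfolding A2_char_def by (rule SUP_upper2[of "(x, \<rho>)"]) (use \<rho> in auto)
  then have "?p / ?b * (?q / ?b) * ?b\<^sup>2 \<le> A2_char \<mu> w * ?b\<^sup>2" by (rule mult_right_mono) simp
  moreover have "?p / ?b * (?q / ?b) * ?b\<^sup>2 = (?p / ?b * ?b) * (?q / ?b * ?b)"
    by (simp only: power2_eq_square mult_ac)
  ultimately show ?thesis by (simp only: ennreal_divide_mult_cancel[OF b])
qed

text \<open>Both integrals are positive because \<open>w\<close> is positive almost everywhere and
  balls have positive measure. A finite product of positive factors in \<open>ennreal\<close> has
  finite factors.\<close>

lemma A2_weight_ball:
  assumes w: "A2_weight \<mu> w" and \<rho>: "\<rho> > 0"
  shows "0 < (\<integral>\<^sup>+y\<in>ball x \<rho>. ennreal (w y) \<partial>\<mu>)" "(\<integral>\<^sup>+y\<in>ball x \<rho>. ennreal (w y) \<partial>\<mu>) < \<infinity>"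
    "0 < (\<integral>\<^sup>+y\<in>ball x \<rho>. ennreal (1 / w y) \<partial>\<mu>)" "(\<integral>\<^sup>+y\<in>ball x \<rho>. ennreal (1 / w y) \<partial>\<mu>) < \<infinity>"
proof -
  have [measurable]: "w \<in> borel_measurable \<mu>" and w_pos: "AE x in \<mu>. 0 < w x"
    and A: "A2_char \<mu> w < \<infinity>" using w by (auto simp: A2_weight_def)
  let ?p = "\<integral>\<^sup>+y\<in>ball x \<rho>. ennreal (w y) \<partial>\<mu>" and ?q = "\<integral>\<^sup>+y\<in>ball x \<rho>. ennreal (1 / w y) \<partial>\<mu>"
  have pos: "0 < (\<integral>\<^sup>+y\<in>ball x \<rho>. ennreal (u y) \<partial>\<mu>)"
    if [measurable]: "u \<in> borel_measurable \<mu>" and u: "AE x in \<mu>. 0 < u x" for u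
  proof (rule ccontr)
    assume "\<not> ?thesis"
    then have "AE y in \<mu>. ennreal (u y) * indicator (ball x \<rho>) y = 0"
      by (subst nn_integral_0_iff_AE[symmetric]) auto
    with u have "AE y in \<mu>. y \<notin> ball x \<rho>"
      by eventually_elim (auto simp: indicator_def)
    then have "emeasure \<mu> (ball x \<rho>) = 0" by (subst (asm) AE_iff_measurable[of "ball x \<rho>"]) auto
    then show False using emeasure_ball_pos[OF \<rho>, of x] by simp
  qed
  show p: "0 < ?p" by (rule pos) (use w_pos in auto)
  show q: "0 < ?q" by (rule pos) (use w_pos in auto)
  have "?p * ?q < \<infinity>"
    by (rule le_less_trans[OF A2_char_ball[OF \<rho>]])
      (use A emeasure_ball_finite[of x \<rho>] in \<open>simp add: ennreal_mult_less_top power2_eq_square\<close>)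
  then show "?p < \<infinity>" "?q < \<infinity>" using p q by (auto simp: ennreal_mult_less_top)
qed

text \<open>After normalising by the measures of the tripled balls, both averages are controlled by maximal
  functions with respect to \<open>w d\<mu>\<close> and \<open>w\<^sup>-\<^sup>1 d\<mu>\<close>, whose bounds do not depend on the weight.\<close>

lemma sparse_operator_weighted_bound:
  fixes z :: "'i \<Rightarrow> 'a" and f :: "'a \<Rightarrow> real"
  assumes w: "A2_weight \<mu> w" and I: "finite I" and \<rho>: "\<And>i. i \<in> I \<Longrightarrow> \<rho> i > 0"
    and E [measurable]: "\<And>i. i \<in> I \<Longrightarrow> E i \<in> sets \<mu>"
    and E_sub: "\<And>i. i \<in> I \<Longrightarrow> E i \<subseteq> ball (z i) (\<rho> i)"
    and E_disj: "disjoint_family_on E I"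
    and sparse: "\<And>i. i \<in> I \<Longrightarrow> emeasure \<mu> (ball (z i) (\<rho> i)) \<le> ennreal \<kappa> * emeasure \<mu> (E i)"
    and f [measurable]: "f \<in> borel_measurable \<mu>"
    and fin: "\<And>i. i \<in> I \<Longrightarrow> (\<integral>\<^sup>+y\<in>ball (z i) (\<rho> i). ennreal \<bar>f y\<bar> \<partial>\<mu>) < \<infinity>"
  shows "(\<integral>\<^sup>+x. (\<Sum>i\<in>I. (\<integral>\<^sup>+y\<in>ball (z i) (\<rho> i). ennreal \<bar>f y\<bar> \<partial>\<mu>) / emeasure \<mu> (ball (z i) (\<rho> i))
        * indicator (ball (z i) (\<rho> i)) x)\<^sup>2 * ennreal (w x) \<partial>\<mu>)
    \<le> (8 * ennreal (D ^ 4) * ennreal \<kappa> * A2_char \<mu> w)\<^sup>2 * (\<integral>\<^sup>+x. ennreal ((f x)\<^sup>2) * ennreal (w x) \<partial>\<mu>)"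
proof -
  have [measurable]: "w \<in> borel_measurable \<mu>" and w_pos: "AE x in \<mu>. 0 < w x"
    using w by (auto simp: A2_weight_def)
  define B where "B i = ball (z i) (\<rho> i)" for i
  define B3 where "B3 i = ball (z i) (3 * \<rho> i)" for i
  have [measurable, simp]: "B i \<in> sets \<mu>" "B3 i \<in> sets \<mu>" for i by (simp_all add: B_def B3_def)
  define b where "b i = emeasure \<mu> (B i)" for i
  have b: "0 < b i" "b i < \<infinity>" if "i \<in> I" for i
    using that \<rho> emeasure_ball_pos emeasure_ball_finite by (auto simp: b_def B_def)
  define p where "p i = (\<integral>\<^sup>+y\<in>B i. ennreal \<bar>f y\<bar> \<partial>\<mu>)" for i
  define S where "S x = (\<Sum>i\<in>I. p i / b i * indicator (B i) x)" for x
  have S [measurable]: "S \<in> borel_measurable \<mu>" unfolding S_def by measurable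
  define X where "X = (\<integral>\<^sup>+x. (S x)\<^sup>2 * ennreal (w x) \<partial>\<mu>)"
  define F where "F = (\<integral>\<^sup>+x. ennreal ((f x)\<^sup>2) * ennreal (w x) \<partial>\<mu>)"
  define W where "W = weighted \<mu> w"
  define V where "V = weighted \<mu> (\<lambda>x. 1 / w x)"
  have sets_WV: "sets W = sets borel" "sets V = sets borel" by (auto simp: W_def V_def sets_\<mu>)
  have eW: "emeasure W A = (\<integral>\<^sup>+y\<in>A. ennreal (w y) \<partial>\<mu>)" and eV: "emeasure V A = (\<integral>\<^sup>+y\<in>A. ennreal (1 / w y) \<partial>\<mu>)"
    if "A \<in> sets \<mu>" for A using that by (simp_all add: W_def V_def emeasure_density)
  have WV_ball: "0 < emeasure W (ball x t)" "emeasure W (ball x t) < \<infinity>"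
    "0 < emeasure V (ball x t)" "emeasure V (ball x t) < \<infinity>" if "t > 0" for x t
    using A2_weight_ball[OF w that, of x] by (simp_all add: eW eV)
  have WV_fin: "emeasure W (ball x t) < \<infinity>" "emeasure V (ball x t) < \<infinity>" for x t
    using WV_ball[of t x] by (cases "t > 0"; simp add: not_less ball_empty)+
  \<comment> \<open>The dual function is \<open>S\<close> itself, so \<open>X\<close> equals the sum
    of \<open>p i / b i * q i\<close> and reappears on the right of the maximal estimate.\<close>
  define q where "q i = (\<integral>\<^sup>+y\<in>B i. S y * ennreal (w y) \<partial>\<mu>)" for i
  define m1 where "m1 i = p i / emeasure V (B3 i)" for i
  define m2 where "m2 i = q i / emeasure W (B3 i)" for i
  define M1 where "M1 x = (SUP i\<in>I. m1 i * indicator (B i) x)" for x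
  define M2 where "M2 x = (SUP i\<in>I. m2 i * indicator (B i) x)" for x
  have [measurable]: "M1 \<in> borel_measurable \<mu>" "M2 \<in> borel_measurable \<mu>"
    unfolding M1_def M2_def using I by (auto intro!: borel_measurable_SUP intro: countable_finite)
  define A where "A = A2_char \<mu> w"
  \<comment> \<open>Needed for the final division by \<open>X\<close>. The family is finite, its
    averages are finite, and \<open>w\<close> is integrable on balls.\<close>
  have X_fin: "X < \<infinity>"
  proof -
    have "X \<le> (\<integral>\<^sup>+x. (\<Sum>i\<in>I. (\<Sum>j\<in>I. p j / b j) * (p i / b i) * (ennreal (w x) * indicator (B i) x)) \<partial>\<mu>)"
      unfolding X_def
    proof (rule nn_integral_mono)
      fix x
      have "S x \<le> (\<Sum>j\<in>I. p j / b j)" unfolding S_def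
        by (intro sum_mono) (auto simp: indicator_def)
      then have "S x * S x \<le> (\<Sum>j\<in>I. p j / b j) * S x" by (rule mult_right_mono) simp
      then have "(S x)\<^sup>2 * ennreal (w x) \<le> (\<Sum>j\<in>I. p j / b j) * S x * ennreal (w x)"
        unfolding power2_eq_square by (rule mult_right_mono) simp
      also have "\<dots> = (\<Sum>i\<in>I. (\<Sum>j\<in>I. p j / b j) * (p i / b i) * (ennreal (w x) * indicator (B i) x))"
        unfolding S_def sum_distrib_left sum_distrib_right by (simp add: mult_ac)
      finally show "(S x)\<^sup>2 * ennreal (w x) \<le> (\<Sum>i\<in>I. (\<Sum>j\<in>I. p j / b j) * (p i / b i) * (ennreal (w x) * indicator (B i) x))" .
    qed
    also have "\<dots> = (\<Sum>i\<in>I. (\<Sum>j\<in>I. p j / b j) * (p i / b i) * emeasure W (B i))"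
      by (simp add: nn_integral_sum nn_integral_cmult eW)
    also have "\<dots> < \<infinity>"
    proof -
      have "p i / b i < top" if "i \<in> I" for i
        using fin[OF that] b[OF that] by (auto simp: p_def B_def ennreal_divide_eq_top_iff less_top[symmetric])
      then show ?thesis
        using WV_fin(1) by (auto simp: B_def ennreal_mult_less_top I)
    qed
    finally show ?thesis .
  qed
  \<comment> \<open>The tripled ball lies in the quadrupled one, costing \<open>D ^ 2\<close>, which
    the product in the characteristic squares to \<open>D ^ 4\<close>. Of the two factors
    \<open>b i\<close> that result, one cancels the denominator and the other is replaced by the
    measure of \<open>E i\<close> through sparseness.\<close>
  have term_le: "p i / b i * q i \<le> A * ennreal (D ^ 4) * ennreal \<kappa> * (m1 i * m2 i * emeasure \<mu> (E i))"
    if i: "i \<in> I" for i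
  proof -
    have \<rho>i: "3 * \<rho> i > 0" using \<rho>[OF i] by simp
    have "emeasure \<mu> (B3 i) \<le> emeasure \<mu> (ball (z i) (2 ^ 2 * \<rho> i))"
      unfolding B3_def using \<rho>[OF i] by (intro emeasure_mono subset_ball) auto
    also have "\<dots> \<le> ennreal (D ^ 2) * b i" unfolding b_def B_def by (rule doubling_power[OF \<rho>[OF i]])
    finally have B3b: "emeasure \<mu> (B3 i) \<le> ennreal (D ^ 2) * b i" .
    have "emeasure W (B3 i) * emeasure V (B3 i) \<le> A * (emeasure \<mu> (B3 i))\<^sup>2"
      using A2_char_ball[OF \<rho>i, of w "z i"] by (simp add: eW eV B3_def A_def)
    also have "\<dots> \<le> A * (ennreal (D ^ 2) * b i)\<^sup>2"
      by (intro mult_left_mono power_mono B3b) auto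
    also have "\<dots> = A * ennreal (D ^ 4) * b i * b i"
    proof -
      have "ennreal (D ^ 4) = ennreal (D ^ 2) * ennreal (D ^ 2)"
        using D_ge_1 by (simp add: ennreal_mult[symmetric] power_add[symmetric])
      then show ?thesis by (simp only: power2_eq_square mult_ac)
    qed
    finally have WV: "emeasure W (B3 i) * emeasure V (B3 i) \<le> A * ennreal (D ^ 4) * b i * b i" .
    have "p i = m1 i * emeasure V (B3 i)" "q i = m2 i * emeasure W (B3 i)"
      unfolding m1_def m2_def B3_def using WV_ball[OF \<rho>i] by (simp_all add: ennreal_divide_mult_cancel)
    then have "p i / b i * q i = m1 i * m2 i * (emeasure W (B3 i) * emeasure V (B3 i)) / b i"
      by (simp add: divide_ennreal_def mult_ac)
    also have "\<dots> \<le> m1 i * m2 i * (A * ennreal (D ^ 4) * b i * b i) / b i"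
      by (intro divide_right_mono_ennreal mult_left_mono WV) simp
    also have "\<dots> = m1 i * m2 i * (A * ennreal (D ^ 4)) * (b i * b i / b i)"
      by (simp add: divide_ennreal_def mult_ac)
    also have "b i * b i / b i = b i"
      using b[OF i] by (simp add: ennreal_mult_divide_eq)
    also have "m1 i * m2 i * (A * ennreal (D ^ 4)) * b i \<le> m1 i * m2 i * (A * ennreal (D ^ 4)) * (ennreal \<kappa> * emeasure \<mu> (E i))"
      using sparse[OF i] unfolding b_def B_def by (rule mult_left_mono) simp
    finally show ?thesis by (simp add: mult_ac)
  qed
  have "X = (\<integral>\<^sup>+x. (\<Sum>i\<in>I. p i / b i * (S x * ennreal (w x) * indicator (B i) x)) \<partial>\<mu>)"
  proof -
    have "(S x)\<^sup>2 * ennreal (w x) = (\<Sum>i\<in>I. p i / b i * (S x * ennreal (w x) * indicator (B i) x))" for x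
    proof -
      have "(S x)\<^sup>2 * ennreal (w x) = S x * (S x * ennreal (w x))"
        by (simp only: power2_eq_square mult.assoc)
      also have "\<dots> = (\<Sum>i\<in>I. p i / b i * indicator (B i) x) * (S x * ennreal (w x))"
        by (simp only: S_def)
      finally show ?thesis unfolding sum_distrib_right by (simp only: mult_ac)
    qed
    then show ?thesis unfolding X_def by simp
  qed
  also have "\<dots> = (\<Sum>i\<in>I. p i / b i * q i)"
    unfolding q_def by (simp add: nn_integral_sum nn_integral_cmult)
  also have "\<dots> \<le> (\<Sum>i\<in>I. A * ennreal (D ^ 4) * ennreal \<kappa> * (m1 i * m2 i * emeasure \<mu> (E i)))"
    by (intro sum_mono term_le)
  also have "\<dots> = A * ennreal (D ^ 4) * ennreal \<kappa> * (\<integral>\<^sup>+x. (\<Sum>i\<in>I. m1 i * m2 i * indicator (E i) x) \<partial>\<mu>)"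
    by (simp add: sum_distrib_left[symmetric] nn_integral_sum nn_integral_cmult_indicator)
  also have "\<dots> \<le> A * ennreal (D ^ 4) * ennreal \<kappa> * (\<integral>\<^sup>+x. M1 x * M2 x \<partial>\<mu>)"
  proof (intro mult_left_mono nn_integral_mono)
    fix x
    show "(\<Sum>i\<in>I. m1 i * m2 i * indicator (E i) x) \<le> M1 x * M2 x"
    proof (cases "\<exists>i\<in>I. x \<in> E i")
      case True
      then obtain i where i: "i \<in> I" "x \<in> E i" by blast
      have xB: "x \<in> B i" using E_sub[OF i(1)] i(2) by (auto simp: B_def)
      have "x \<notin> E j" if "j \<in> I - {i}" for j
        using E_disj i that by (auto simp: disjoint_family_on_def)
      then have "(\<Sum>j\<in>I - {i}. m1 j * m2 j * indicator (E j) x) = 0"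
        by (intro sum.neutral ballI) (simp add: indicator_def)
      then have "(\<Sum>i\<in>I. m1 i * m2 i * indicator (E i) x) = m1 i * m2 i * indicator (E i) x + 0"
        using sum.remove[OF I i(1), of "\<lambda>j. m1 j * m2 j * indicator (E j) x"] by (simp only:)
      also have "\<dots> = m1 i * m2 i" using i by simp
      also have "\<dots> \<le> M1 x * M2 x"
      proof (rule mult_mono)
        show "m1 i \<le> M1 x" unfolding M1_def by (rule SUP_upper2[OF i(1)]) (use xB in simp)
        show "m2 i \<le> M2 x" unfolding M2_def by (rule SUP_upper2[OF i(1)]) (use xB in simp)
      qed auto
      finally show ?thesis .
    next
      case False
      then have "(\<Sum>i\<in>I. m1 i * m2 i * indicator (E i) x) = 0" by (intro sum.neutral) auto
      then show ?thesis by simp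
    qed
  qed simp
  finally have X_le: "X \<le> A * ennreal (D ^ 4) * ennreal \<kappa> * (\<integral>\<^sup>+x. M1 x * M2 x \<partial>\<mu>)" .
  have "(\<integral>\<^sup>+x. M1 x * M2 x \<partial>\<mu>)
      = (\<integral>\<^sup>+x. (M1 x * ennreal (sqrt (1 / w x))) * (M2 x * ennreal (sqrt (w x))) \<partial>\<mu>)"
  proof (rule nn_integral_cong_AE)
    show "AE x in \<mu>. M1 x * M2 x = (M1 x * ennreal (sqrt (1 / w x))) * (M2 x * ennreal (sqrt (w x)))"
      using w_pos
    proof eventually_elim
      case (elim x)
      have "ennreal (sqrt (1 / w x)) * ennreal (sqrt (w x)) = 1"
        using elim by (simp add: ennreal_mult[symmetric] real_sqrt_divide)
      then show ?case by (metis mult.assoc mult.left_commute mult.right_neutral)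
    qed
  qed
  then have "(\<integral>\<^sup>+x. M1 x * M2 x \<partial>\<mu>)\<^sup>2
      \<le> (\<integral>\<^sup>+x. (M1 x * ennreal (sqrt (1 / w x)))\<^sup>2 \<partial>\<mu>) * (\<integral>\<^sup>+x. (M2 x * ennreal (sqrt (w x)))\<^sup>2 \<partial>\<mu>)"
    by (simp only:) (rule Cauchy_Schwarz_nn_integral; measurable)
  also have "(\<integral>\<^sup>+x. (M1 x * ennreal (sqrt (1 / w x)))\<^sup>2 \<partial>\<mu>) = (\<integral>\<^sup>+x. (M1 x)\<^sup>2 \<partial>V)"
  proof -
    have "(\<integral>\<^sup>+x. (M1 x)\<^sup>2 \<partial>V) = (\<integral>\<^sup>+x. ennreal (1 / w x) * (M1 x)\<^sup>2 \<partial>\<mu>)"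
      unfolding V_def by (rule nn_integral_density) measurable
    also have "\<dots> = (\<integral>\<^sup>+x. (M1 x * ennreal (sqrt (1 / w x)))\<^sup>2 \<partial>\<mu>)"
      using w_pos by (intro nn_integral_cong_AE, eventually_elim)
        (simp add: power_mult_distrib ennreal_power mult.commute)
    finally show ?thesis by simp
  qed
  also have "(\<integral>\<^sup>+x. (M2 x * ennreal (sqrt (w x)))\<^sup>2 \<partial>\<mu>) = (\<integral>\<^sup>+x. (M2 x)\<^sup>2 \<partial>W)"
  proof -
    have "(\<integral>\<^sup>+x. (M2 x)\<^sup>2 \<partial>W) = (\<integral>\<^sup>+x. ennreal (w x) * (M2 x)\<^sup>2 \<partial>\<mu>)"
      unfolding W_def by (rule nn_integral_density) measurable
    also have "\<dots> = (\<integral>\<^sup>+x. (M2 x * ennreal (sqrt (w x)))\<^sup>2 \<partial>\<mu>)"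
      using w_pos by (intro nn_integral_cong_AE, eventually_elim)
        (simp add: power_mult_distrib ennreal_power mult.commute)
    finally show ?thesis by simp
  qed
  also have "(\<integral>\<^sup>+x. (M1 x)\<^sup>2 \<partial>V) \<le> 8 * F"
  proof -
    \<comment> \<open>With respect to \<open>V\<close> the integral of |f| becomes that of |f| w,
      and the square of |f| w integrates against \<open>V\<close> to the integral of f^2 w.\<close>
    have p_eq: "p i = (\<integral>\<^sup>+y\<in>B i. ennreal (\<bar>f y\<bar> * w y) \<partial>V)" for i
    proof -
      have "(\<integral>\<^sup>+y\<in>B i. ennreal (\<bar>f y\<bar> * w y) \<partial>V)
          = (\<integral>\<^sup>+y. ennreal (1 / w y) * (ennreal (\<bar>f y\<bar> * w y) * indicator (B i) y) \<partial>\<mu>)"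
        unfolding V_def by (rule nn_integral_density) measurable
      also have "\<dots> = p i" unfolding p_def
        using w_pos by (intro nn_integral_cong_AE, eventually_elim)
          (auto simp: ennreal_mult[symmetric] indicator_def)
      finally show ?thesis by simp
    qed
    have "(\<integral>\<^sup>+x. (M1 x)\<^sup>2 \<partial>V) \<le> 8 * (\<integral>\<^sup>+x. (ennreal (\<bar>f x\<bar> * w x))\<^sup>2 \<partial>V)"
      unfolding M1_def m1_def p_eq B3_def B_def
    proof (rule strong_maximal_inequality[OF sets_WV(2) _ I])
      show "sigma_finite_measure V" by (rule sigma_finite_measure_balls[OF sets_WV(2) WV_fin(2)])
      show "(\<lambda>x. ennreal (\<bar>f x\<bar> * w x)) \<in> borel_measurable V" unfolding V_def by measurable
    qed (use WV_ball \<rho> in \<open>auto intro: less_imp_le\<close>)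
    also have "(\<integral>\<^sup>+x. (ennreal (\<bar>f x\<bar> * w x))\<^sup>2 \<partial>V) = (\<integral>\<^sup>+x. ennreal (1 / w x) * (ennreal (\<bar>f x\<bar> * w x))\<^sup>2 \<partial>\<mu>)"
      unfolding V_def by (rule nn_integral_density) measurable
    also have "\<dots> = F" unfolding F_def
      using w_pos by (intro nn_integral_cong_AE, eventually_elim)
        (simp add: ennreal_power ennreal_mult[symmetric] power2_eq_square)
    finally show ?thesis .
  qed
  also have "(\<integral>\<^sup>+x. (M2 x)\<^sup>2 \<partial>W) \<le> 8 * X"
  proof -
    have q_eq: "q i = (\<integral>\<^sup>+y\<in>B i. S y \<partial>W)" for i
    proof -
      have "(\<integral>\<^sup>+y\<in>B i. S y \<partial>W) = (\<integral>\<^sup>+y. ennreal (w y) * (S y * indicator (B i) y) \<partial>\<mu>)"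
        unfolding W_def by (rule nn_integral_density) measurable
      then show ?thesis unfolding q_def by (simp add: mult_ac)
    qed
    have "(\<integral>\<^sup>+x. (M2 x)\<^sup>2 \<partial>W) \<le> 8 * (\<integral>\<^sup>+x. (S x)\<^sup>2 \<partial>W)"
      unfolding M2_def m2_def q_eq B3_def B_def
    proof (rule strong_maximal_inequality[OF sets_WV(1) _ I])
      show "sigma_finite_measure W" by (rule sigma_finite_measure_balls[OF sets_WV(1) WV_fin(1)])
      show "S \<in> borel_measurable W" unfolding W_def by measurable
    qed (use WV_ball \<rho> in \<open>auto intro: less_imp_le\<close>)
    also have "(\<integral>\<^sup>+x. (S x)\<^sup>2 \<partial>W) = (\<integral>\<^sup>+x. ennreal (w x) * (S x)\<^sup>2 \<partial>\<mu>)"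
      unfolding W_def by (rule nn_integral_density) measurable
    also have "\<dots> = X" unfolding X_def by (simp add: mult.commute)
    finally show ?thesis .
  qed
  finally have MM: "(\<integral>\<^sup>+x. M1 x * M2 x \<partial>\<mu>)\<^sup>2 \<le> 8 * F * (8 * X)"
    by (simp add: mult_left_mono mult_right_mono)
  define Z where "Z = A * ennreal (D ^ 4) * ennreal \<kappa>"
  have "X\<^sup>2 \<le> (Z * (\<integral>\<^sup>+x. M1 x * M2 x \<partial>\<mu>))\<^sup>2"
    unfolding Z_def by (intro power_mono X_le) simp
  also have "\<dots> = Z\<^sup>2 * (\<integral>\<^sup>+x. M1 x * M2 x \<partial>\<mu>)\<^sup>2" by (rule power_mult_distrib)
  also have "\<dots> \<le> Z\<^sup>2 * (8 * F * (8 * X))" by (intro mult_left_mono MM) simp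
  also have "\<dots> = (8 * Z)\<^sup>2 * F * X" by (simp add: power2_eq_square mult_ac)
  finally have XX: "X * X \<le> (8 * Z)\<^sup>2 * F * X" by (simp add: power2_eq_square)
  \<comment> \<open>Dividing by \<open>X\<close> turns the quadratic inequality into the linear
    dependence on the characteristic. The 8 is the geometric mean of the two maximal
    constants.\<close>
  have "X \<le> (8 * Z)\<^sup>2 * F"
  proof (cases "X = 0")
    case False
    then have "0 < X" by (simp add: zero_less_iff_neq_zero)
    have "X * X / X \<le> (8 * Z)\<^sup>2 * F * X / X" by (rule divide_right_mono_ennreal[OF XX])
    then show ?thesis using \<open>0 < X\<close> X_fin by (simp add: ennreal_mult_divide_eq)
  qed simp
  then show ?thesis
    unfolding X_def S_def F_def Z_def p_def b_def B_def A_def by (simp add: mult_ac)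
qed

end

section \<open>The weak type bound\<close>

lemma nn_integral_ge_mult_emeasure:
  assumes "A \<in> sets M" "\<And>x. x \<in> A \<Longrightarrow> t \<le> u x"
  shows "t * emeasure M A \<le> (\<integral>\<^sup>+x\<in>A. u x \<partial>M)"
proof -
  have "t * emeasure M A = (\<integral>\<^sup>+x. t * indicator A x \<partial>M)"
    using assms(1) by (simp add: nn_integral_cmult_indicator)
  also have "\<dots> \<le> (\<integral>\<^sup>+x\<in>A. u x \<partial>M)"
    using assms(2) by (intro nn_integral_mono) (auto simp: indicator_def)
  finally show ?thesis .
qed

section \<open>Square integrable functions\<close>

lemma L2_space_iff:
  "f \<in> L2_space M \<longleftrightarrow> f \<in> borel_measurable M \<and> (\<integral>\<^sup>+x. ennreal ((f x)\<^sup>2) \<partial>M) < \<infinity>"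
  by (auto simp: L2_space_def integrable_iff_bounded)

lemma L2_space_measurable [measurable_dest]: "f \<in> L2_space M \<Longrightarrow> f \<in> borel_measurable M"
  by (simp add: L2_space_def)

lemma L2_norm_nn_integral:
  assumes "f \<in> L2_space M"
  shows "(\<integral>\<^sup>+x. ennreal ((f x)\<^sup>2) \<partial>M) = ennreal ((L2_norm M f)\<^sup>2)"
  using assms by (simp add: L2_space_def L2_norm_def nn_integral_eq_integral)

lemma L2_space_dominated:
  assumes "f \<in> L2_space M" "g \<in> borel_measurable M" "\<And>x. \<bar>g x\<bar> \<le> \<bar>f x\<bar>"
  shows "g \<in> L2_space M"
proof -
  have "(\<integral>\<^sup>+x. ennreal ((g x)\<^sup>2) \<partial>M) \<le> (\<integral>\<^sup>+x. ennreal ((f x)\<^sup>2) \<partial>M)"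
    using assms(3) by (intro nn_integral_mono ennreal_leI) (simp add: abs_le_square_iff)
  then show ?thesis using assms(1,2) by (auto simp: L2_space_iff)
qed

lemma L2_space_add:
  assumes "f \<in> L2_space M" "g \<in> L2_space M"
  shows "(\<lambda>x. f x + g x) \<in> L2_space M"
proof -
  note assms[measurable]
  have "(\<integral>\<^sup>+x. ennreal ((f x + g x)\<^sup>2) \<partial>M)
      \<le> (\<integral>\<^sup>+x. 2 * ennreal ((f x)\<^sup>2) + 2 * ennreal ((g x)\<^sup>2) \<partial>M)"
  proof (rule nn_integral_mono)
    fix x
    have "0 \<le> (f x - g x)\<^sup>2" by simp
    then have "(f x + g x)\<^sup>2 \<le> 2 * (f x)\<^sup>2 + 2 * (g x)\<^sup>2"
      by (simp add: power2_eq_square algebra_simps)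
    then have "ennreal ((f x + g x)\<^sup>2) \<le> ennreal (2 * (f x)\<^sup>2 + 2 * (g x)\<^sup>2)" by (rule ennreal_leI)
    then show "ennreal ((f x + g x)\<^sup>2) \<le> 2 * ennreal ((f x)\<^sup>2) + 2 * ennreal ((g x)\<^sup>2)"
      by (simp add: ennreal_mult)
  qed
  also have "\<dots> < \<infinity>"
    using assms by (simp add: nn_integral_add nn_integral_cmult L2_space_iff ennreal_mult_less_top)
  finally show ?thesis using assms by (simp add: L2_space_iff)
qed

lemma L2_space_cmult:
  assumes "f \<in> L2_space M"
  shows "(\<lambda>x. a * f x) \<in> L2_space M"
proof -
  note assms[measurable]
  have "(\<integral>\<^sup>+x. ennreal ((a * f x)\<^sup>2) \<partial>M) = ennreal (a\<^sup>2) * (\<integral>\<^sup>+x. ennreal ((f x)\<^sup>2) \<partial>M)"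
    by (simp add: power_mult_distrib ennreal_mult nn_integral_cmult)
  then show ?thesis using assms by (simp add: L2_space_iff ennreal_mult_less_top)
qed

lemma L2_space_diff:
  assumes "f \<in> L2_space M" "g \<in> L2_space M"
  shows "(\<lambda>x. f x - g x) \<in> L2_space M"
  using L2_space_add[OF assms(1) L2_space_cmult[OF assms(2), of "-1"]] by simp

lemma L2_space_zero [simp]: "(\<lambda>x. 0) \<in> L2_space M"
  by (simp add: L2_space_iff)

lemma L2_space_sum:
  assumes "finite I" "\<And>i. i \<in> I \<Longrightarrow> f i \<in> L2_space M"
  shows "(\<lambda>x. \<Sum>i\<in>I. f i x) \<in> L2_space M"
  using assms by (induction I rule: finite_induct) (auto intro: L2_space_add)

lemma L2_space_indicator:
  assumes "f \<in> L2_space M" "A \<in> sets M"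
  shows "(\<lambda>x. f x * indicator A x) \<in> L2_space M"
  by (rule L2_space_dominated[OF assms(1)])
    (use assms in \<open>auto simp: indicator_def dest: L2_space_measurable\<close>)

text \<open>The constants that the hypotheses only assert to exist are parameters here, so each
  constant below visibly depends on \<open>D\<close>, \<open>m\<close>, \<open>C\<close>,
  \<open>\<epsilon>\<close> and \<open>N\<close> alone, never on the weight or the function.\<close>

locale CZ_setting = homogeneous_space \<mu> D for \<mu> :: "'a::metric_space measure" and D +
  fixes m C \<epsilon> N :: real and K :: "'a \<Rightarrow> 'a \<Rightarrow> real" and T :: "('a \<Rightarrow> real) \<Rightarrow> 'a \<Rightarrow> real"
  assumes geometrically_doubling: "geometrically_doubling (UNIV :: 'a set)"
    and m_pos: "m > 0" and C_pos: "C > 0" and \<epsilon>_pos: "\<epsilon> > 0" and N_nonneg: "N \<ge> 0"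
    and growth: "\<rho> > 0 \<Longrightarrow> emeasure \<mu> (ball x \<rho>) \<le> ennreal (C * \<rho> powr m)"
    and K_measurable: "(\<lambda>(x, y). K x y) \<in> borel_measurable (restrict_space borel {(x, y). x \<noteq> y})"
    and K_size: "x \<noteq> y \<Longrightarrow> \<bar>K x y\<bar> \<le> 1 / dist x y powr m"
    and K_smooth: "x \<noteq> y \<Longrightarrow> dist x x' \<le> dist x y / 2 \<Longrightarrow>
      \<bar>K x y - K x' y\<bar> + \<bar>K y x - K y x'\<bar> \<le> dist x x' powr \<epsilon> / dist x y powr (m + \<epsilon>)"
    and T_L2: "f \<in> L2_space \<mu> \<Longrightarrow> T f \<in> L2_space \<mu>"
    and T_add: "f \<in> L2_space \<mu> \<Longrightarrow> g \<in> L2_space \<mu> \<Longrightarrow> AE x in \<mu>. T (\<lambda>y. f y + g y) x = T f x + T g x"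
    and T_cmult: "f \<in> L2_space \<mu> \<Longrightarrow> AE x in \<mu>. T (\<lambda>y. a * f y) x = a * T f x"
    and T_bound: "f \<in> L2_space \<mu> \<Longrightarrow> L2_norm \<mu> (T f) \<le> N * L2_norm \<mu> f"
    and T_kernel: "f \<in> L2_space \<mu> \<Longrightarrow>
      AE x in \<mu>. x \<notin> ae_support \<mu> f \<longrightarrow> T f x = (\<integral>y. K x y * f y \<partial>\<mu>)"
begin

lemma T_nn_bound:
  assumes "f \<in> L2_space \<mu>"
  shows "(\<integral>\<^sup>+x. ennreal ((T f x)\<^sup>2) \<partial>\<mu>) \<le> ennreal (N\<^sup>2) * (\<integral>\<^sup>+x. ennreal ((f x)\<^sup>2) \<partial>\<mu>)"
proof -
  have "L2_norm \<mu> (T f) \<ge> 0" by (simp add: L2_norm_def)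
  then have "(L2_norm \<mu> (T f))\<^sup>2 \<le> (N * L2_norm \<mu> f)\<^sup>2"
    using T_bound[OF assms] by (intro power_mono)
  then show ?thesis
    by (simp add: L2_norm_nn_integral T_L2 assms ennreal_mult[symmetric] power_mult_distrib)
qed

lemma T_diff:
  assumes "f \<in> L2_space \<mu>" "g \<in> L2_space \<mu>"
  shows "AE x in \<mu>. T (\<lambda>y. f y - g y) x = T f x - T g x"
  using T_add[OF assms(1) L2_space_cmult[OF assms(2), of "-1"]] T_cmult[OF assms(2), of "-1"]
  by eventually_elim simp

text \<open>Boundedness forces null functions to have null images; this is how \<open>T\<close> acts
  on classes although it is given on functions.\<close>

lemma T_eq_0:
  assumes f: "f \<in> L2_space \<mu>" and "AE x in \<mu>. f x = 0"
  shows "AE x in \<mu>. T f x = 0"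
proof -
  note f[measurable] T_L2[OF f, measurable]
  have "(\<integral>\<^sup>+x. ennreal ((f x)\<^sup>2) \<partial>\<mu>) = 0"
    using assms(2) by (subst nn_integral_0_iff_AE) auto
  then have "(\<integral>\<^sup>+x. ennreal ((T f x)\<^sup>2) \<partial>\<mu>) = 0" using T_nn_bound[OF f] by simp
  then show ?thesis by (subst (asm) nn_integral_0_iff_AE) auto
qed

lemma T_sum:
  assumes "finite I" "\<And>i. i \<in> I \<Longrightarrow> f i \<in> L2_space \<mu>"
  shows "AE x in \<mu>. T (\<lambda>y. \<Sum>i\<in>I. f i y) x = (\<Sum>i\<in>I. T (f i) x)"
  using assms
proof (induction I rule: finite_induct)
  case empty
  show ?case using T_eq_0[of "\<lambda>x. 0"] by simp
next
  case (insert i I)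
  have "AE x in \<mu>. T (\<lambda>y. f i y + (\<Sum>j\<in>I. f j y)) x = T (f i) x + T (\<lambda>y. \<Sum>j\<in>I. f j y) x"
    using insert by (intro T_add L2_space_sum) auto
  moreover have "AE x in \<mu>. T (\<lambda>y. \<Sum>i\<in>I. f i y) x = (\<Sum>i\<in>I. T (f i) x)"
    using insert by simp
  ultimately show ?case by eventually_elim (use insert(1,2) in simp)
qed

text \<open>Measurability is assumed off the diagonal only. A section leaves out a single point of
  the line, where any value is harmless because the point is closed.\<close>

lemma K_section_measurable [measurable]: "K x \<in> borel_measurable \<mu>"
proof -
  have "K x \<in> borel_measurable borel"
  proof (rule measurable_piecewise_restrict[of "{{x}, - {x}}"])
    fix \<Omega> assume "\<Omega> \<in> {{x}, - {x}}"
    then consider "\<Omega> = {x}" | "\<Omega> = - {x}" by blast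
    then show "K x \<in> borel_measurable (restrict_space borel \<Omega>)"
    proof cases
      case 1
      have "(\<lambda>y. K x x) \<in> borel_measurable (restrict_space borel \<Omega>)" by simp
      then show ?thesis
        by (rule measurable_cong[THEN iffD1, rotated]) (simp add: 1 space_restrict_space)
    next
      case 2
      have "Pair x \<in> measurable borel borel"
        by (intro borel_measurable_continuous_onI continuous_intros)
      then have "Pair x \<in> measurable (restrict_space borel \<Omega>) (restrict_space borel {(x, y). x \<noteq> y})"
        by (intro measurable_restrict_space3) (auto simp: 2)
      from measurable_compose[OF this K_measurable] show ?thesis by simp
    qed
  qed auto
  then show ?thesis by (simp cong: measurable_cong_sets add: sets_\<mu>)
qed

lemma not_in_ae_support:
  assumes "open U" "x \<in> U" "\<And>y. y \<in> U \<Longrightarrow> f y = 0"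
  shows "x \<notin> ae_support \<mu> f"
  using assms unfolding ae_support_def by blast

lemma L2_integrable_on_ball:
  assumes f: "f \<in> L2_space \<mu>" and supp: "\<And>y. y \<notin> ball z R \<Longrightarrow> f y = 0"
  shows "integrable \<mu> f"
proof (rule Bochner_Integration.integrable_bound)
  show "integrable \<mu> (\<lambda>x. (f x)\<^sup>2 + indicator (ball z R) x)"
    using f emeasure_ball_finite[of z R] by (auto simp: L2_space_def)
  show "f \<in> borel_measurable \<mu>" using f by measurable
  have "\<bar>t\<bar> \<le> t\<^sup>2 + 1" for t :: real
  proof -
    have "0 \<le> (\<bar>t\<bar> - 1 / 2)\<^sup>2" by simp
    then show ?thesis by (simp add: power2_eq_square algebra_simps)
  qed
  then show "AE x in \<mu>. norm (f x) \<le> norm ((f x)\<^sup>2 + indicator (ball z R) x)"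
    using supp by (intro AE_I2) (auto simp: indicator_def)
qed

text \<open>The vanishing integral permits subtracting the constant \<open>K x z\<close> from the
  kernel, and regularity then gains decay of order \<open>\<epsilon>\<close> beyond the size
  bound.\<close>

lemma T_mean_zero_bound:
  assumes f: "f \<in> L2_space \<mu>" and R: "R > 0" and supp: "\<And>y. y \<notin> ball z R \<Longrightarrow> f y = 0"
    and mean: "(\<integral>y. f y \<partial>\<mu>) = 0"
  shows "AE x in \<mu>. 2 * R \<le> dist x z \<longrightarrow>
    ennreal \<bar>T f x\<bar> \<le> ennreal (R powr \<epsilon> / dist x z powr (m + \<epsilon>)) * (\<integral>\<^sup>+y. ennreal \<bar>f y\<bar> \<partial>\<mu>)"
  using T_kernel[OF f]
proof eventually_elim
  case (elim x)
  note f[measurable]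
  have int: "integrable \<mu> f" by (rule L2_integrable_on_ball[OF f supp])
  show ?case
  proof
    assume d: "2 * R \<le> dist x z"
    define q where "q = R powr \<epsilon> / dist x z powr (m + \<epsilon>)"
    have q: "q \<ge> 0" by (simp add: q_def)
    have "x \<notin> ae_support \<mu> f"
    proof (rule not_in_ae_support)
      show "open (- cball z R)" by (intro open_Compl closed_cball)
      show "x \<in> - cball z R" using d R by (simp add: dist_commute)
    qed (use supp in auto)
    with elim have Tf: "T f x = (\<integral>y. K x y * f y \<partial>\<mu>)" by blast
    have bound: "\<bar>(K x y - K x z) * f y\<bar> \<le> q * \<bar>f y\<bar>" for y
    proof (cases "y \<in> ball z R")
      case True
      then have zx: "z \<noteq> x" "dist z y \<le> dist z x / 2" using d R by (auto simp: dist_commute)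
      \<comment> \<open>Regularity in the second variable is the second summand of
        \<open>K_smooth\<close>, read with \<open>z\<close> moved to \<open>y\<close> and
        \<open>x\<close> as the far point.\<close>
      then have "\<bar>K x z - K x y\<bar> \<le> dist z y powr \<epsilon> / dist z x powr (m + \<epsilon>)"
        using K_smooth[of z x y] by linarith
      also have "\<dots> \<le> q" unfolding q_def using True zx(1) \<epsilon>_pos m_pos
        by (intro frac_le powr_mono2) (auto simp: dist_commute)
      finally show ?thesis by (simp add: abs_mult abs_minus_commute mult_right_mono)
    qed (simp add: supp)
    have int': "integrable \<mu> (\<lambda>y. (K x y - K x z) * f y)"
    proof (rule Bochner_Integration.integrable_bound)
      show "integrable \<mu> (\<lambda>y. q * f y)" using int by simp
      show "AE y in \<mu>. norm ((K x y - K x z) * f y) \<le> norm (q * f y)"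
        using bound q by (intro AE_I2) (simp add: abs_mult)
    qed measurable
    have "T f x = (\<integral>y. (K x y - K x z) * f y + K x z * f y \<partial>\<mu>)"
      unfolding Tf by (simp add: algebra_simps)
    also have "\<dots> = (\<integral>y. (K x y - K x z) * f y \<partial>\<mu>)"
      using int int' mean by (subst Bochner_Integration.integral_add) auto
    finally have "ennreal \<bar>T f x\<bar> \<le> (\<integral>\<^sup>+y. ennreal \<bar>(K x y - K x z) * f y\<bar> \<partial>\<mu>)"
      using integral_norm_bound_ennreal[OF int'] by simp
    also have "\<dots> \<le> (\<integral>\<^sup>+y. ennreal q * ennreal \<bar>f y\<bar> \<partial>\<mu>)"
      using bound q by (intro nn_integral_mono) (simp add: ennreal_mult[symmetric] ennreal_leI)
    also have "\<dots> = ennreal q * (\<integral>\<^sup>+y. ennreal \<bar>f y\<bar> \<partial>\<mu>)"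
      by (rule nn_integral_cmult) measurable
    finally show "ennreal \<bar>T f x\<bar> \<le> ennreal (R powr \<epsilon> / dist x z powr (m + \<epsilon>)) * (\<integral>\<^sup>+y. ennreal \<bar>f y\<bar> \<partial>\<mu>)"
      unfolding q_def .
  qed
qed

definition tail_const :: real where
  "tail_const = C * 2 powr m / (1 - 2 powr (- \<epsilon>))"

lemma two_powr_minus_\<epsilon>: "0 < 2 powr (- \<epsilon>)" "2 powr (- \<epsilon>) < (1::real)"
  using \<epsilon>_pos powr_less_mono[of "- \<epsilon>" 0 2] by auto

lemma tail_const_pos: "tail_const > 0"
  using two_powr_minus_\<epsilon> C_pos by (simp add: tail_const_def)

text \<open>Split into dyadic annuli. Growth of order m cancels the power m of the kernel, and each
  annulus retains a factor \<open>2 powr (- \<epsilon>)\<close> over the previous one. The bound is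
  therefore independent of \<open>R\<close> and \<open>z\<close>.\<close>

lemma kernel_tail_integral:
  assumes R: "R > 0"
  shows "(\<integral>\<^sup>+x\<in>{x. 2 * R \<le> dist x z}. ennreal (R powr \<epsilon> / dist x z powr (m + \<epsilon>)) \<partial>\<mu>) \<le> ennreal tail_const"
proof -
  define d where "d k = 2 ^ Suc k * R" for k :: nat
  have d: "d k > 0" for k using R by (simp add: d_def)
  define q where "q = 2 powr (- \<epsilon>)"
  have q: "0 < q" "q < 1" using two_powr_minus_\<epsilon> by (auto simp: q_def)
  have "(\<integral>\<^sup>+x\<in>{x. 2 * R \<le> dist x z}. ennreal (R powr \<epsilon> / dist x z powr (m + \<epsilon>)) \<partial>\<mu>)
      \<le> (\<integral>\<^sup>+x. (\<Sum>k. ennreal (R powr \<epsilon> / d k powr (m + \<epsilon>)) * indicator (ball z (d (Suc k))) x) \<partial>\<mu>)"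
  proof (rule nn_integral_mono)
    fix x
    show "ennreal (R powr \<epsilon> / dist x z powr (m + \<epsilon>)) * indicator {x. 2 * R \<le> dist x z} x
        \<le> (\<Sum>k. ennreal (R powr \<epsilon> / d k powr (m + \<epsilon>)) * indicator (ball z (d (Suc k))) x)"
    proof (cases "2 * R \<le> dist x z")
      case True
      have "\<exists>k. dist x z < d (Suc k)"
      proof -
        obtain k where "dist x z / R < 2 ^ k" using real_arch_pow[of 2 "dist x z / R"] by auto
        then have "dist x z < 2 ^ k * R" using R by (simp add: field_simps)
        also have "\<dots> \<le> d (Suc k)" using R by (simp add: d_def)
        finally show ?thesis by blast
      qed
      define k where "k = (LEAST k. dist x z < d (Suc k))"
      have k1: "dist x z < d (Suc k)" unfolding k_def by (rule LeastI_ex) fact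
      have k2: "d k \<le> dist x z"
      proof (cases k)
        case 0
        then show ?thesis using True by (simp add: d_def)
      next
        case (Suc j)
        then show ?thesis using not_less_Least[of j "\<lambda>k. dist x z < d (Suc k)"] by (simp add: k_def)
      qed
      have "ennreal (R powr \<epsilon> / dist x z powr (m + \<epsilon>)) \<le> ennreal (R powr \<epsilon> / d k powr (m + \<epsilon>))"
        using k2 d[of k] m_pos \<epsilon>_pos R by (intro ennreal_leI frac_le powr_mono2) auto
      also have "\<dots> = (\<Sum>k\<in>{k}. ennreal (R powr \<epsilon> / d k powr (m + \<epsilon>)) * indicator (ball z (d (Suc k))) x)"
        using k1 by (simp add: dist_commute)
      also have "\<dots> \<le> (\<Sum>k. ennreal (R powr \<epsilon> / d k powr (m + \<epsilon>)) * indicator (ball z (d (Suc k))) x)"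
        by (rule sum_le_suminf) auto
      finally show ?thesis using True by simp
    qed simp
  qed
  also have "\<dots> = (\<Sum>k. ennreal (R powr \<epsilon> / d k powr (m + \<epsilon>)) * emeasure \<mu> (ball z (d (Suc k))))"
    by (simp add: nn_integral_suminf nn_integral_cmult_indicator)
  also have "\<dots> \<le> (\<Sum>k. ennreal (C * 2 powr m * q ^ k))"
  proof (rule suminf_le)
    fix k
    have "ennreal (R powr \<epsilon> / d k powr (m + \<epsilon>)) * emeasure \<mu> (ball z (d (Suc k)))
        \<le> ennreal (R powr \<epsilon> / d k powr (m + \<epsilon>)) * ennreal (C * d (Suc k) powr m)"
      by (intro mult_left_mono growth d) simp
    also have "\<dots> = ennreal (R powr \<epsilon> / d k powr (m + \<epsilon>) * (C * d (Suc k) powr m))"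
      by (rule ennreal_mult[symmetric]) (use C_pos in auto)
    also have "\<dots> \<le> ennreal (C * 2 powr m * q ^ k)"
    proof (rule ennreal_leI)
      have "d (Suc k) powr m = 2 powr m * d k powr m"
      proof -
        have "d (Suc k) = 2 * d k" by (simp add: d_def)
        then show ?thesis by (simp add: powr_mult)
      qed
      moreover have "d k powr (m + \<epsilon>) = d k powr m * d k powr \<epsilon>" by (rule powr_add)
      moreover have "d k powr m > 0" using d[of k] by simp
      ultimately have "R powr \<epsilon> / d k powr (m + \<epsilon>) * (C * d (Suc k) powr m)
          = C * 2 powr m * (R powr \<epsilon> / d k powr \<epsilon>)"
        by (simp add: field_simps)
      also have "R powr \<epsilon> / d k powr \<epsilon> = q ^ Suc k"
      proof -
        have "d k powr \<epsilon> = (2 ^ Suc k) powr \<epsilon> * R powr \<epsilon>"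
          using R unfolding d_def by (intro powr_mult)
        moreover have "(2 ^ Suc k :: real) powr \<epsilon> = (2 powr \<epsilon>) ^ Suc k"
          by (simp add: powr_realpow[symmetric] powr_powr mult.commute del: power_Suc)
        moreover have "q = 1 / 2 powr \<epsilon>" by (simp add: q_def powr_minus_divide)
        ultimately show ?thesis using R by (simp add: power_divide del: power_Suc)
      qed
      also have "C * 2 powr m * q ^ Suc k \<le> C * 2 powr m * q ^ k"
        using q C_pos by (intro mult_left_mono power_decreasing) auto
      finally show "R powr \<epsilon> / d k powr (m + \<epsilon>) * (C * d (Suc k) powr m) \<le> C * 2 powr m * q ^ k" .
    qed
    finally show "ennreal (R powr \<epsilon> / d k powr (m + \<epsilon>)) * emeasure \<mu> (ball z (d (Suc k)))
        \<le> ennreal (C * 2 powr m * q ^ k)" .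
  qed auto
  also have "\<dots> = ennreal (\<Sum>k. C * 2 powr m * q ^ k)"
    using q C_pos by (intro suminf_ennreal2) (auto intro!: summable_mult summable_geometric)
  also have "(\<Sum>k. C * 2 powr m * q ^ k) = tail_const"
    using q by (subst suminf_mult) (auto simp: suminf_geometric summable_geometric tail_const_def q_def)
  finally show ?thesis .
qed

text \<open>The three summands are the good part by Chebyshev and the bound \<open>N\<close>, the
  dilated selected cells, and the bad part away from them.\<close>

definition weak_const :: real where
  "weak_const = N\<^sup>2 * (2 + D ^ 7) + D ^ 4 + 2 * tail_const"

lemma weak_const_pos: "weak_const > 0"
  using tail_const_pos D_ge_1 by (auto simp: weak_const_def intro!: add_nonneg_pos add_nonneg_nonneg)

text \<open>A local Calderon-Zygmund decomposition at height \<open>t\<close>. Support in a ball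
  over which the average is at most \<open>t\<close> ensures that no coarsest cell is selected, so
  every selected cell has a parent. The level \<open>2 * t\<close> leaves \<open>t\<close> to the
  good part and \<open>t\<close> to the bad part.\<close>

theorem weak_type_bound:
  assumes f: "f \<in> L2_space \<mu>" and \<rho>: "\<rho> > 0" and supp: "\<And>y. y \<notin> ball z \<rho> \<Longrightarrow> f y = 0"
    and t: "t > 0" and avg: "(\<integral>\<^sup>+y. ennreal \<bar>f y\<bar> \<partial>\<mu>) \<le> ennreal t * emeasure \<mu> (ball z \<rho>)"
  shows "ennreal t * emeasure \<mu> {x. 2 * t < \<bar>T f x\<bar>} \<le> ennreal weak_const * (\<integral>\<^sup>+y. ennreal \<bar>f y\<bar> \<partial>\<mu>)"
proof -
  note f[measurable] T_L2[OF f, measurable]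
  have set_meas: "{x. P x} \<in> sets \<mu>" if "Measurable.pred \<mu> P" for P
    using that by (simp add: pred_def)
  define I1 where "I1 = (\<integral>\<^sup>+y. ennreal \<bar>f y\<bar> \<partial>\<mu>)"
  have I1_fin: "I1 < \<infinity>"
    using avg emeasure_ball_finite[of z \<rho>] by (auto simp: I1_def ennreal_mult_less_top elim!: le_less_trans)
  show ?thesis
  proof (cases "I1 = 0")
    case True
    then have "AE x in \<mu>. f x = 0" unfolding I1_def by (subst (asm) nn_integral_0_iff_AE) auto
    then have "AE x in \<mu>. T f x = 0" by (rule T_eq_0[OF f])
    then have "AE x in \<mu>. \<not> 2 * t < \<bar>T f x\<bar>" by eventually_elim (use t in simp)
    then have "emeasure \<mu> {x. 2 * t < \<bar>T f x\<bar>} = 0"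
      by (subst (asm) AE_iff_measurable[OF set_meas]) auto
    then show ?thesis by simp
  next
    case False
    \<comment> \<open>With coarsest scale \<open>4 * \<rho>\<close> the coarsest cell about
      \<open>z\<close> contains the ball of radius \<open>\<rho>\<close> that carries
      \<open>f\<close>.\<close>
    obtain c where c: "dyadic_system z (4 * \<rho>) c"
      using dyadic_system_exists[OF geometrically_doubling, of "4 * \<rho>"] \<rho> by auto
    interpret dyadic_space \<mu> D z "4 * \<rho>" c by unfold_locales (rule c)
    define J where "J A = (\<integral>\<^sup>+y\<in>A. ennreal \<bar>f y\<bar> \<partial>\<mu>)" for A
    have J_density: "J A = emeasure (density \<mu> (\<lambda>y. ennreal \<bar>f y\<bar>)) A" if "A \<in> sets \<mu>" for A
      using that by (simp add: J_def emeasure_density)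
    have J_mono: "J A \<le> J A'" if "A \<subseteq> A'" for A A'
      unfolding J_def using that by (intro nn_integral_mono) (auto simp: indicator_def)
    have J_le: "J A \<le> I1" for A
      unfolding J_def I1_def by (intro nn_integral_mono) (auto simp: indicator_def)
    define S where "S k p \<longleftrightarrow> ennreal t * emeasure \<mu> (cell k p) < J (cell k p)" for k p
    define MC where "MC = maximal_cells S"
    define \<Omega> where "\<Omega> = (\<Union>P\<in>MC. cells P)"
    have MC_count: "countable MC" unfolding MC_def by (rule countable_maximal_cells)
    have MC_disj: "disjoint_family_on cells MC" unfolding MC_def by (rule disjoint_maximal_cells)
    have \<Omega>_sets [measurable]: "\<Omega> \<in> sets \<mu>" unfolding \<Omega>_def
      by (intro sets.countable_UN'' MC_count) simp
    have MC: "c (fst P) (snd P) = snd P" "ennreal t * emeasure \<mu> (cells P) \<le> J (cells P)"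
      "J (cells P) \<le> ennreal (t * D ^ 7) * emeasure \<mu> (cells P)" if P: "P \<in> MC" for P
    proof -
      obtain k p where kp: "P = (k, p)" by (cases P)
      have cp: "c k p = p" and Sp: "S k p" and max: "\<And>j. j < k \<Longrightarrow> \<not> S j (c j p)"
        using P by (auto simp: MC_def maximal_cells_def kp)
      show "c (fst P) (snd P) = snd P" using cp kp by simp
      show "ennreal t * emeasure \<mu> (cells P) \<le> J (cells P)" using Sp kp by (simp add: S_def)
      \<comment> \<open>The coarsest cell about \<open>z\<close> contains the ball, so
        \<open>avg\<close> keeps its average at most \<open>t\<close>; on every other coarsest cell
        \<open>f\<close> vanishes.\<close>
      have "k \<noteq> 0"
      proof
        assume "k = 0"
        show False
        proof (cases "p = z")
          case True
          have "ball z \<rho> \<subseteq> cell 0 z" using c_top by (auto simp: cell_def dist_commute)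
          then have "ennreal t * emeasure \<mu> (ball z \<rho>) \<le> ennreal t * emeasure \<mu> (cell 0 z)"
            by (intro mult_left_mono emeasure_mono) auto
          then show False using Sp avg J_le[of "cell 0 z"] unfolding S_def \<open>k = 0\<close> True I1_def[symmetric]
            by (meson leD order_trans)
        next
          case False
          have "f y * indicator (cell 0 p) y = 0" for y
          proof (cases "y \<in> cell 0 p")
            case True
            then have "\<not> dist y z < \<rho>" using c_top[of y] False by (auto simp: cell_def)
            then show ?thesis using supp[of y] by (simp add: dist_commute)
          qed simp
          then have "J (cell 0 p) = 0" unfolding J_def
            by (intro nn_integral_0_iff_AE[THEN iffD2] AE_I2) (auto simp: indicator_def split: if_splits)
          then show False using Sp \<open>k = 0\<close> by (simp add: S_def)
        qed
      qed
      then obtain j where j: "k = Suc j" using not0_implies_Suc by blast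
      have "J (cell k p) \<le> J (cell j (c j p))"
        using cell_mono[OF cp, of j] j by (intro J_mono) simp
      also have "\<dots> \<le> ennreal t * emeasure \<mu> (cell j (c j p))"
        using max[of j] j by (simp add: S_def not_less)
      also have "\<dots> \<le> ennreal t * (ennreal (D ^ 7) * emeasure \<mu> (cell k p))"
      proof (intro mult_left_mono)
        \<comment> \<open>The parent lies within \<open>4 * r j\<close> of \<open>p\<close>, which
          is \<open>32 * r k\<close>, that is seven doublings of \<open>r k / 4\<close>.\<close>
        have "cell j (c j p) \<subseteq> ball p (2 ^ 7 * (r k / 4))"
        proof
          fix y assume "y \<in> cell j (c j p)"
          then have "dist (c j p) y < 2 * r j" using cell_subset_ball[of j "c j p"] by auto
          moreover have "dist p (c j p) < 2 * r j" by (rule dist_c)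
          moreover have "dist p y \<le> dist p (c j p) + dist (c j p) y" by (rule dist_triangle)
          ultimately show "y \<in> ball p (2 ^ 7 * (r k / 4))" by (simp add: j r_Suc)
        qed
        then have "emeasure \<mu> (cell j (c j p)) \<le> emeasure \<mu> (ball p (2 ^ 7 * (r k / 4)))"
          by (rule emeasure_mono) simp
        also have "\<dots> \<le> ennreal (D ^ 7) * emeasure \<mu> (cell k p)" by (rule emeasure_ball_le_cell[OF cp])
        finally show "emeasure \<mu> (cell j (c j p)) \<le> ennreal (D ^ 7) * emeasure \<mu> (cell k p)" .
      qed simp
      finally show "J (cells P) \<le> ennreal (t * D ^ 7) * emeasure \<mu> (cells P)"
        using t D_ge_1 by (simp add: kp ennreal_mult mult.assoc)
    qed
    \<comment> \<open>Linearity covers finite sums only, so the mean is subtracted on finitely many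
      selected cells. On the others \<open>f\<close> stays in the good part; it need not be bounded
      there, but its square integral is made at most \<open>t * I1\<close> by taking enough
      cells.\<close>
    obtain F where F: "finite F" "F \<subseteq> MC"
      "(\<integral>\<^sup>+y\<in>\<Omega> - (\<Union>P\<in>F. cells P). ennreal ((f y)\<^sup>2) \<partial>\<mu>) \<le> ennreal t * I1"
    proof -
      define F where "F n = {P \<in> MC. to_nat_on MC P < n}" for n
      have fF: "finite (F n)" for n unfolding F_def by (rule finite_initial_segment[OF MC_count])
      define M where "M = density \<mu> (\<lambda>y. ennreal ((f y)\<^sup>2))"
      define A where "A n = \<Omega> - (\<Union>P\<in>F n. cells P)" for n
      have As: "A n \<in> sets \<mu>" for n unfolding A_def using fF by (auto intro!: sets.finite_UN)
      have eM: "emeasure M B = (\<integral>\<^sup>+y\<in>B. ennreal ((f y)\<^sup>2) \<partial>\<mu>)" if "B \<in> sets \<mu>" for B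
        unfolding M_def using that by (simp add: emeasure_density)
      have "(\<lambda>n. emeasure M (A n)) \<longlonglongrightarrow> emeasure M (\<Inter>n. A n)"
      proof (rule Lim_emeasure_decseq)
        show "range A \<subseteq> sets M" using As by (auto simp: M_def)
        show "decseq A" unfolding decseq_def A_def F_def by force
        have "emeasure M (A n) \<le> (\<integral>\<^sup>+y. ennreal ((f y)\<^sup>2) \<partial>\<mu>)" for n
          unfolding eM[OF As] by (intro nn_integral_mono) (auto simp: indicator_def)
        then show "emeasure M (A n) \<noteq> \<infinity>" for n
          using f by (metis L2_space_iff infinity_ennreal_def leD)
      qed
      moreover have "(\<Inter>n. A n) = {}"
      proof -
        have "P \<in> F (Suc (to_nat_on MC P))" if "P \<in> MC" for P using that by (simp add: F_def)
        then show ?thesis unfolding A_def \<Omega>_def by blast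
      qed
      ultimately have "(\<lambda>n. emeasure M (A n)) \<longlonglongrightarrow> 0" by simp
      then have "\<forall>\<^sub>F n in sequentially. emeasure M (A n) < ennreal t * I1"
        by (rule order_tendstoD) (use t False in \<open>simp add: zero_less_iff_neq_zero\<close>)
      then obtain n where "emeasure M (A n) < ennreal t * I1" by (auto simp: eventually_sequentially)
      then show ?thesis using that[of "F n"] fF eM[OF As] by (auto simp: A_def F_def)
    qed
    note FMC = MC[OF subsetD[OF F(2)]]
    have F_disj: "disjoint_family_on cells F" using MC_disj F(2) by (rule disjoint_family_on_mono[rotated])
    define U where "U = (\<Union>P\<in>F. cells P)"
    have U_sets [measurable]: "U \<in> sets \<mu>" unfolding U_def using F(1) by (intro sets.finite_UN) auto
    have U\<Omega>: "U \<subseteq> \<Omega>" unfolding U_def \<Omega>_def using F(2) by blast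
    have sum_J: "(\<Sum>P\<in>F. J (cells P)) \<le> I1"
    proof -
      have "(\<Sum>P\<in>F. J (cells P)) = (\<Sum>P\<in>F. emeasure (density \<mu> (\<lambda>y. ennreal \<bar>f y\<bar>)) (cells P))"
        by (simp add: J_density)
      also have "\<dots> = emeasure (density \<mu> (\<lambda>y. ennreal \<bar>f y\<bar>)) U"
        unfolding U_def by (rule sum_emeasure) (use F F_disj in auto)
      also have "\<dots> = J U" by (simp add: J_density)
      finally show ?thesis using J_le by simp
    qed
    have f_int: "integrable \<mu> f" by (rule L2_integrable_on_ball[OF f supp])
    define av where "av P = (\<integral>y. f y * indicator (cells P) y \<partial>\<mu>) / measure \<mu> (cells P)" for P
    define b where "b P y = f y * indicator (cells P) y - av P * indicator (cells P) y" for P y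
    define g where "g y = f y - (\<Sum>P\<in>F. b P y)" for y
    have ind_L2: "(\<lambda>y. indicator (cells P) y :: real) \<in> L2_space \<mu>" for P
    proof -
      have "(\<integral>\<^sup>+y. ennreal ((indicator (cells P) y)\<^sup>2) \<partial>\<mu>) = (\<integral>\<^sup>+y. indicator (cells P) y \<partial>\<mu>)"
        by (intro nn_integral_cong) (auto simp: indicator_def)
      then show ?thesis using emeasure_cell_finite by (simp add: L2_space_iff)
    qed
    have b_L2: "b P \<in> L2_space \<mu>" for P
      unfolding b_def[abs_def] by (intro L2_space_diff L2_space_cmult ind_L2 L2_space_indicator f) auto
    have g_L2: "g \<in> L2_space \<mu>"
      unfolding g_def[abs_def] by (intro L2_space_diff f L2_space_sum F(1) b_L2)
    note b_L2[measurable] g_L2[measurable] T_L2[OF b_L2, measurable] T_L2[OF g_L2, measurable]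
    have P_meas: "emeasure \<mu> (cells P) = ennreal (measure \<mu> (cells P))" "measure \<mu> (cells P) > 0"
      if "P \<in> F" for P
    proof -
      show e: "emeasure \<mu> (cells P) = ennreal (measure \<mu> (cells P))"
        using emeasure_cell_finite[of "fst P" "snd P"] by (simp add: emeasure_eq_ennreal_measure)
      show "measure \<mu> (cells P) > 0" using emeasure_cell_pos[OF FMC(1)[OF that]] by (simp add: e)
    qed
    have av_J: "ennreal \<bar>av P\<bar> * emeasure \<mu> (cells P) \<le> J (cells P)" if "P \<in> F" for P
    proof -
      have "ennreal \<bar>av P\<bar> * emeasure \<mu> (cells P) = ennreal \<bar>\<integral>y. f y * indicator (cells P) y \<partial>\<mu>\<bar>"
        using P_meas[OF that] by (simp add: av_def ennreal_mult[symmetric])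
      also have "\<dots> \<le> (\<integral>\<^sup>+y. ennreal \<bar>f y * indicator (cells P) y\<bar> \<partial>\<mu>)"
        using integral_norm_bound_ennreal[OF integrable_real_mult_indicator[OF cell_sets f_int]] by simp
      also have "\<dots> = J (cells P)"
        unfolding J_def by (intro nn_integral_cong) (auto simp: indicator_def)
      finally show ?thesis .
    qed
    have av_le: "\<bar>av P\<bar> \<le> D ^ 7 * t" if "P \<in> F" for P
    proof -
      have "ennreal \<bar>av P\<bar> * emeasure \<mu> (cells P) \<le> ennreal (t * D ^ 7) * emeasure \<mu> (cells P)"
        using av_J[OF that] FMC(3)[OF that] by (rule order_trans)
      then have "\<bar>av P\<bar> * measure \<mu> (cells P) \<le> t * D ^ 7 * measure \<mu> (cells P)"
        using t D_ge_1 by (simp add: P_meas(1)[OF that] ennreal_mult[symmetric])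
      then show ?thesis using P_meas(2)[OF that] by (simp add: mult.commute)
    qed
    have g_in: "g y = av P" if "P \<in> F" "y \<in> cells P" for P y
    proof -
      have "b Q y = 0" if "Q \<in> F" "Q \<noteq> P" for Q
        using F_disj that \<open>P \<in> F\<close> \<open>y \<in> cells P\<close> by (auto simp: b_def disjoint_family_on_def indicator_def)
      then have "(\<Sum>Q\<in>F. b Q y) = b P y"
        using F(1) \<open>P \<in> F\<close> by (subst sum.remove[of _ P]) auto
      then show ?thesis using that by (simp add: g_def b_def)
    qed
    have g_out: "g y = f y" if "y \<notin> U" for y
    proof -
      have "(\<Sum>Q\<in>F. b Q y) = 0" using that by (intro sum.neutral) (auto simp: b_def U_def)
      then show ?thesis by (simp add: g_def)
    qed
    have f_le: "AE y in \<mu>. y \<notin> \<Omega> \<longrightarrow> \<bar>f y\<bar> \<le> t"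
    proof -
      have "AE y in \<mu>. (\<forall>k\<ge>0. (\<integral>\<^sup>+x\<in>cell k (c k y). ennreal \<bar>f x\<bar> \<partial>\<mu>) \<le> ennreal t * emeasure \<mu> (cell k (c k y)))
          \<longrightarrow> ennreal \<bar>f y\<bar> \<le> ennreal t"
        by (rule AE_le_of_cell_averages_le) measurable
      then show ?thesis
      proof eventually_elim
        case (elim y)
        then show ?case using t unfolding \<Omega>_def MC_def UN_maximal_cells
          by (auto simp: S_def J_def not_less ennreal_le_iff)
      qed
    qed
    \<comment> \<open>Of the 2, one unit is the region outside \<open>\<Omega>\<close>, where |f| is
      at most \<open>t\<close>, and the other the selected cells left out of \<open>F\<close>. The
      averages on the cells of \<open>F\<close> contribute \<open>D ^ 7\<close>.\<close>
    have g_int: "(\<integral>\<^sup>+y. ennreal ((g y)\<^sup>2) \<partial>\<mu>) \<le> ennreal ((2 + D ^ 7) * t) * I1"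
    proof -
      have "(\<integral>\<^sup>+y. ennreal ((g y)\<^sup>2) \<partial>\<mu>)
          \<le> (\<integral>\<^sup>+y. (ennreal t * ennreal \<bar>f y\<bar> + ennreal ((f y)\<^sup>2) * indicator (\<Omega> - U) y)
              + (\<Sum>P\<in>F. ennreal (D ^ 7 * t) * ennreal \<bar>av P\<bar> * indicator (cells P) y) \<partial>\<mu>)"
      proof (rule nn_integral_mono_AE)
        show "AE y in \<mu>. ennreal ((g y)\<^sup>2) \<le> (ennreal t * ennreal \<bar>f y\<bar> + ennreal ((f y)\<^sup>2) * indicator (\<Omega> - U) y)
              + (\<Sum>P\<in>F. ennreal (D ^ 7 * t) * ennreal \<bar>av P\<bar> * indicator (cells P) y)"
          using f_le
        proof eventually_elim
          case (elim y)
          show ?case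
          proof (cases "y \<in> U")
            case True
            then obtain P where P: "P \<in> F" "y \<in> cells P" by (auto simp: U_def)
            have "(g y)\<^sup>2 = \<bar>av P\<bar> * \<bar>av P\<bar>" using g_in[OF P] by (simp add: power2_eq_square)
            also have "\<dots> \<le> D ^ 7 * t * \<bar>av P\<bar>" by (intro mult_right_mono av_le P) simp
            finally have "ennreal ((g y)\<^sup>2) \<le> ennreal (D ^ 7 * t) * ennreal \<bar>av P\<bar>"
              using t D_ge_1 by (simp add: ennreal_mult[symmetric] ennreal_leI)
            also have "\<dots> = ennreal (D ^ 7 * t) * ennreal \<bar>av P\<bar> * indicator (cells P) y" using P by simp
            also have "\<dots> \<le> (\<Sum>P\<in>F. ennreal (D ^ 7 * t) * ennreal \<bar>av P\<bar> * indicator (cells P) y)"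
              using P(1) F(1) by (intro member_le_sum) auto
            finally show ?thesis by (simp add: add_increasing)
          next
            case False
            have "ennreal ((g y)\<^sup>2) \<le> ennreal t * ennreal \<bar>f y\<bar> + ennreal ((f y)\<^sup>2) * indicator (\<Omega> - U) y"
            proof (cases "y \<in> \<Omega>")
              case True
              then show ?thesis using False g_out by (simp add: add_increasing)
            next
              case y: False
              have "(f y)\<^sup>2 = \<bar>f y\<bar> * \<bar>f y\<bar>" by (simp add: power2_eq_square)
              also have "\<dots> \<le> t * \<bar>f y\<bar>" using elim y by (intro mult_right_mono) auto
              finally show ?thesis using False y g_out t by (simp add: ennreal_mult[symmetric] ennreal_leI)
            qed
            then show ?thesis by (simp add: add_increasing2)
          qed
        qed
      qed
      also have "\<dots> = ennreal t * I1 + (\<integral>\<^sup>+y\<in>\<Omega> - U. ennreal ((f y)\<^sup>2) \<partial>\<mu>)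
          + (\<Sum>P\<in>F. ennreal (D ^ 7 * t) * ennreal \<bar>av P\<bar> * emeasure \<mu> (cells P))"
        by (simp add: nn_integral_add nn_integral_cmult nn_integral_sum nn_integral_cmult_indicator I1_def)
      also have "\<dots> \<le> ennreal t * I1 + ennreal t * I1 + ennreal (D ^ 7 * t) * I1"
      proof (intro add_mono order_refl)
        show "(\<integral>\<^sup>+y\<in>\<Omega> - U. ennreal ((f y)\<^sup>2) \<partial>\<mu>) \<le> ennreal t * I1" using F(3) by (simp add: U_def)
        have "(\<Sum>P\<in>F. ennreal (D ^ 7 * t) * ennreal \<bar>av P\<bar> * emeasure \<mu> (cells P))
            \<le> (\<Sum>P\<in>F. ennreal (D ^ 7 * t) * J (cells P))"
          unfolding mult.assoc by (intro sum_mono mult_left_mono av_J) auto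
        also have "\<dots> \<le> ennreal (D ^ 7 * t) * I1"
          unfolding sum_distrib_left[symmetric] by (intro mult_left_mono sum_J) simp
        finally show "(\<Sum>P\<in>F. ennreal (D ^ 7 * t) * ennreal \<bar>av P\<bar> * emeasure \<mu> (cells P)) \<le> ennreal (D ^ 7 * t) * I1" .
      qed
      also have "\<dots> = ennreal ((2 + D ^ 7) * t) * I1"
      proof -
        have "ennreal ((2 + D ^ 7) * t) = ennreal t + ennreal t + ennreal (D ^ 7 * t)"
          using t D_ge_1 by (simp add: ennreal_plus[symmetric] algebra_simps del: ennreal_plus)
        then show ?thesis by (simp add: distrib_right)
      qed
      finally show ?thesis .
    qed
    have good: "ennreal t * emeasure \<mu> {x. t < \<bar>T g x\<bar>} \<le> ennreal (N\<^sup>2 * (2 + D ^ 7)) * I1"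
    proof -
      let ?A = "{x. t < \<bar>T g x\<bar>}"
      have "ennreal (t\<^sup>2) * emeasure \<mu> ?A \<le> (\<integral>\<^sup>+x\<in>?A. ennreal ((T g x)\<^sup>2) \<partial>\<mu>)"
        using t by (intro nn_integral_ge_mult_emeasure set_meas ennreal_leI)
          (auto simp: abs_le_square_iff[symmetric])
      also have "\<dots> \<le> (\<integral>\<^sup>+x. ennreal ((T g x)\<^sup>2) \<partial>\<mu>)"
        by (intro nn_integral_mono) (auto simp: indicator_def)
      also have "\<dots> \<le> ennreal (N\<^sup>2) * (\<integral>\<^sup>+x. ennreal ((g x)\<^sup>2) \<partial>\<mu>)" by (rule T_nn_bound[OF g_L2])
      also have "\<dots> \<le> ennreal (N\<^sup>2) * (ennreal ((2 + D ^ 7) * t) * I1)" by (intro mult_left_mono g_int) simp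
      also have "\<dots> = ennreal t * (ennreal (N\<^sup>2 * (2 + D ^ 7)) * I1)"
        using t D_ge_1 by (simp add: ennreal_mult mult_ac)
      finally have "ennreal t * (ennreal t * emeasure \<mu> ?A) \<le> ennreal t * (ennreal (N\<^sup>2 * (2 + D ^ 7)) * I1)"
        using t by (simp add: power2_eq_square ennreal_mult mult.assoc)
      then show ?thesis using t by (subst (asm) ennreal_mult_le_mult_iff) auto
    qed
    \<comment> \<open>A cell lies in the ball of radius 2r about its centre; doubling that radius
      gives the separation required by \<open>T_mean_zero_bound\<close>.\<close>
    define H where "H = (\<Union>P\<in>F. ball (snd P) (4 * r (fst P)))"
    have H_sets [measurable]: "H \<in> sets \<mu>" unfolding H_def using F(1) by (intro sets.finite_UN) auto
    have H_le: "ennreal t * emeasure \<mu> H \<le> ennreal (D ^ 4) * I1"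
    proof -
      have "emeasure \<mu> H \<le> (\<Sum>P\<in>F. emeasure \<mu> (ball (snd P) (4 * r (fst P))))"
        unfolding H_def by (intro emeasure_subadditive_finite F(1)) auto
      also have "\<dots> \<le> (\<Sum>P\<in>F. ennreal (D ^ 4) * emeasure \<mu> (cells P))"
        using emeasure_ball_le_cell[OF FMC(1), of _ 4] by (intro sum_mono) simp
      finally have "ennreal t * emeasure \<mu> H \<le> ennreal t * (\<Sum>P\<in>F. ennreal (D ^ 4) * emeasure \<mu> (cells P))"
        by (rule mult_left_mono) simp
      also have "\<dots> = ennreal (D ^ 4) * (\<Sum>P\<in>F. ennreal t * emeasure \<mu> (cells P))"
        by (simp add: sum_distrib_left mult_ac)
      also have "\<dots> \<le> ennreal (D ^ 4) * (\<Sum>P\<in>F. J (cells P))"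
        by (intro mult_left_mono sum_mono FMC(2)) auto
      also have "\<dots> \<le> ennreal (D ^ 4) * I1" by (intro mult_left_mono sum_J) simp
      finally show ?thesis .
    qed
    have b_far: "(\<integral>\<^sup>+x\<in>- H. ennreal \<bar>T (b P) x\<bar> \<partial>\<mu>) \<le> ennreal (2 * tail_const) * J (cells P)"
      if P: "P \<in> F" for P
    proof -
      let ?R = "2 * r (fst P)" and ?z = "snd P"
      have b_supp: "b P y = 0" if "y \<notin> ball ?z ?R" for y
        using cell_subset_ball[of "fst P" ?z] that by (auto simp: b_def indicator_def)
      have ind_int: "integrable \<mu> (\<lambda>y. av P * indicator (cells P) y)"
        using emeasure_cell_finite[of "fst P" ?z] by auto
      have b_mean: "(\<integral>y. b P y \<partial>\<mu>) = 0"
        unfolding b_def using P_meas(2)[OF P] emeasure_cell_finite[of "fst P" ?z]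
        by (subst Bochner_Integration.integral_diff[OF integrable_real_mult_indicator[OF cell_sets f_int] ind_int])
          (simp add: av_def)
      have b_J: "(\<integral>\<^sup>+y. ennreal \<bar>b P y\<bar> \<partial>\<mu>) \<le> 2 * J (cells P)"
      proof -
        have "(\<integral>\<^sup>+y. ennreal \<bar>b P y\<bar> \<partial>\<mu>)
            \<le> (\<integral>\<^sup>+y. ennreal \<bar>f y\<bar> * indicator (cells P) y + ennreal \<bar>av P\<bar> * indicator (cells P) y \<partial>\<mu>)"
          by (intro nn_integral_mono)
            (auto simp: b_def indicator_def ennreal_plus[symmetric] simp del: ennreal_plus intro!: ennreal_leI)
        also have "\<dots> = J (cells P) + ennreal \<bar>av P\<bar> * emeasure \<mu> (cells P)"
          by (simp add: nn_integral_add nn_integral_cmult_indicator J_def)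
        also have "\<dots> \<le> J (cells P) + J (cells P)" by (intro add_left_mono av_J P)
        finally show ?thesis by (simp add: mult_2)
      qed
      let ?G = "{x. 2 * ?R \<le> dist x ?z}"
      have "?G = - ball ?z (2 * ?R)" by (auto simp: dist_commute)
      then have G_sets [measurable]: "?G \<in> sets \<mu>" by (simp add: sets_\<mu>)
      have dist_meas [measurable]: "(\<lambda>x. dist x ?z) \<in> borel_measurable \<mu>"
      proof -
        have "(\<lambda>x. dist x ?z) \<in> borel_measurable borel"
          by (intro borel_measurable_continuous_onI continuous_intros)
        then show ?thesis by (simp cong: measurable_cong_sets add: sets_\<mu>)
      qed
      have "(\<integral>\<^sup>+x\<in>- H. ennreal \<bar>T (b P) x\<bar> \<partial>\<mu>)
          \<le> (\<integral>\<^sup>+x. ennreal (?R powr \<epsilon> / dist x ?z powr (m + \<epsilon>)) * indicator ?G x * (2 * J (cells P)) \<partial>\<mu>)"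
      proof (rule nn_integral_mono_AE)
        have "AE x in \<mu>. 2 * ?R \<le> dist x ?z \<longrightarrow> ennreal \<bar>T (b P) x\<bar>
            \<le> ennreal (?R powr \<epsilon> / dist x ?z powr (m + \<epsilon>)) * (\<integral>\<^sup>+y. ennreal \<bar>b P y\<bar> \<partial>\<mu>)"
          by (rule T_mean_zero_bound[OF b_L2 _ b_supp b_mean]) auto
        then show "AE x in \<mu>. ennreal \<bar>T (b P) x\<bar> * indicator (- H) x
            \<le> ennreal (?R powr \<epsilon> / dist x ?z powr (m + \<epsilon>)) * indicator ?G x * (2 * J (cells P))"
        proof eventually_elim
          case (elim x)
          show ?case
          proof (cases "x \<in> H")
            case False
            then have x: "2 * ?R \<le> dist x ?z" using P by (auto simp: H_def dist_commute not_less)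
            with elim have "ennreal \<bar>T (b P) x\<bar>
              \<le> ennreal (?R powr \<epsilon> / dist x ?z powr (m + \<epsilon>)) * (\<integral>\<^sup>+y. ennreal \<bar>b P y\<bar> \<partial>\<mu>)" by blast
            also have "\<dots> \<le> ennreal (?R powr \<epsilon> / dist x ?z powr (m + \<epsilon>)) * (2 * J (cells P))"
              by (intro mult_left_mono b_J) simp
            finally show ?thesis using False x by simp
          qed simp
        qed
      qed
      also have "\<dots> = (\<integral>\<^sup>+x\<in>?G. ennreal (?R powr \<epsilon> / dist x ?z powr (m + \<epsilon>)) \<partial>\<mu>) * (2 * J (cells P))"
        by (rule nn_integral_multc) measurable
      also have "\<dots> \<le> ennreal tail_const * (2 * J (cells P))"
        by (intro mult_right_mono kernel_tail_integral) auto
      also have "\<dots> = ennreal (2 * tail_const) * J (cells P)"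
        using tail_const_pos by (simp add: ennreal_mult mult_ac)
      finally show ?thesis .
    qed
    have bad: "ennreal t * emeasure \<mu> {x. x \<notin> H \<and> t < (\<Sum>P\<in>F. \<bar>T (b P) x\<bar>)} \<le> ennreal (2 * tail_const) * I1"
    proof -
      let ?A = "{x. x \<notin> H \<and> t < (\<Sum>P\<in>F. \<bar>T (b P) x\<bar>)}"
      have "ennreal t * emeasure \<mu> ?A \<le> (\<integral>\<^sup>+x\<in>?A. ennreal (\<Sum>P\<in>F. \<bar>T (b P) x\<bar>) \<partial>\<mu>)"
      proof (rule nn_integral_ge_mult_emeasure)
        show "?A \<in> sets \<mu>" by (rule set_meas) measurable
      qed (auto intro!: ennreal_leI)
      also have "\<dots> \<le> (\<integral>\<^sup>+x. (\<Sum>P\<in>F. ennreal \<bar>T (b P) x\<bar> * indicator (- H) x) \<partial>\<mu>)"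
        by (intro nn_integral_mono) (auto simp: indicator_def sum_ennreal)
      also have "\<dots> = (\<Sum>P\<in>F. \<integral>\<^sup>+x\<in>- H. ennreal \<bar>T (b P) x\<bar> \<partial>\<mu>)"
        by (rule nn_integral_sum) measurable
      also have "\<dots> \<le> (\<Sum>P\<in>F. ennreal (2 * tail_const) * J (cells P))" by (intro sum_mono b_far)
      also have "\<dots> \<le> ennreal (2 * tail_const) * I1"
        unfolding sum_distrib_left[symmetric] by (intro mult_left_mono sum_J) simp
      finally show ?thesis .
    qed
    have AE_split: "AE x in \<mu>. \<bar>T f x\<bar> \<le> \<bar>T g x\<bar> + (\<Sum>P\<in>F. \<bar>T (b P) x\<bar>)"
    proof -
      have "AE x in \<mu>. T (\<lambda>y. g y + (\<Sum>P\<in>F. b P y)) x = T g x + T (\<lambda>y. \<Sum>P\<in>F. b P y) x"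
        by (intro T_add g_L2 L2_space_sum F(1) b_L2)
      moreover have "AE x in \<mu>. T (\<lambda>y. \<Sum>P\<in>F. b P y) x = (\<Sum>P\<in>F. T (b P) x)"
        by (intro T_sum F(1) b_L2)
      ultimately show ?thesis
      proof (eventually_elim)
        case (elim x)
        have "(\<lambda>y. g y + (\<Sum>P\<in>F. b P y)) = f" by (auto simp: g_def)
        then have "\<bar>T f x\<bar> \<le> \<bar>T g x\<bar> + \<bar>\<Sum>P\<in>F. T (b P) x\<bar>" using elim by simp
        also have "\<bar>\<Sum>P\<in>F. T (b P) x\<bar> \<le> (\<Sum>P\<in>F. \<bar>T (b P) x\<bar>)" by (rule sum_abs)
        finally show ?case by simp
      qed
    qed
    have "emeasure \<mu> {x. 2 * t < \<bar>T f x\<bar>}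
        \<le> emeasure \<mu> (({x. t < \<bar>T g x\<bar>} \<union> H) \<union> {x. x \<notin> H \<and> t < (\<Sum>P\<in>F. \<bar>T (b P) x\<bar>)})"
    proof (rule emeasure_mono_AE)
      show "AE x in \<mu>. x \<in> {x. 2 * t < \<bar>T f x\<bar>} \<longrightarrow>
          x \<in> ({x. t < \<bar>T g x\<bar>} \<union> H) \<union> {x. x \<notin> H \<and> t < (\<Sum>P\<in>F. \<bar>T (b P) x\<bar>)}"
        using AE_split by eventually_elim auto
    qed (intro sets.Un H_sets set_meas; measurable)
    also have "\<dots> \<le> emeasure \<mu> ({x. t < \<bar>T g x\<bar>} \<union> H) + emeasure \<mu> {x. x \<notin> H \<and> t < (\<Sum>P\<in>F. \<bar>T (b P) x\<bar>)}"
      by (intro emeasure_subadditive sets.Un H_sets set_meas; measurable)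
    also have "\<dots> \<le> (emeasure \<mu> {x. t < \<bar>T g x\<bar>} + emeasure \<mu> H) + emeasure \<mu> {x. x \<notin> H \<and> t < (\<Sum>P\<in>F. \<bar>T (b P) x\<bar>)}"
      by (intro add_right_mono emeasure_subadditive H_sets set_meas; measurable)
    finally have "ennreal t * emeasure \<mu> {x. 2 * t < \<bar>T f x\<bar>}
        \<le> ennreal t * ((emeasure \<mu> {x. t < \<bar>T g x\<bar>} + emeasure \<mu> H) + emeasure \<mu> {x. x \<notin> H \<and> t < (\<Sum>P\<in>F. \<bar>T (b P) x\<bar>)})"
      by (rule mult_left_mono) simp
    also have "\<dots> \<le> (ennreal (N\<^sup>2 * (2 + D ^ 7)) * I1 + ennreal (D ^ 4) * I1) + ennreal (2 * tail_const) * I1"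
      unfolding distrib_left[of "ennreal t"] by (intro add_mono good H_le bad)
    also have "\<dots> = ennreal weak_const * I1"
    proof -
      have "0 \<le> N\<^sup>2 * (2 + D ^ 7)" "0 \<le> D ^ 4" "0 \<le> 2 * tail_const" using D_ge_1 tail_const_pos by auto
      then show ?thesis by (simp add: weak_const_def distrib_right[symmetric] ennreal_plus[symmetric] del: ennreal_plus)
    qed
    finally show ?thesis unfolding I1_def .
  qed
qed

text \<open>At height \<open>level_const\<close> times the average, the weak bound together with the
  loss \<open>D ^ 6\<close> from dilated ball to cell leaves an exceptional set of at most one
  eighth of the cell. The maximum with 1 keeps the height above the average. This and the following
  constants precede the choice of a dyadic system, hence are uniform in its scale.\<close>

definition level_const :: real where "level_const = max 1 (8 * weak_const * D ^ 6)"

text \<open>The factors are the cell diameter of at most 4r raised to \<open>\<epsilon>\<close>, the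
  growth of a ball of radius 16r, and a geometric series of ratio
  \<open>8 powr (- \<epsilon>)\<close> over the ancestors.\<close>

definition osc_const :: real where
  "osc_const = 4 powr \<epsilon> * C * 16 powr m / (1 - 8 powr (- \<epsilon>))"

text \<open>In order: the threshold on the initial cell, the value at the comparison point for the
  parent, the oscillation over the parent, and the passage from parent to child. Averages before
  stopping exceed the initial one by at most the factor \<open>4 * D ^ 8\<close>.\<close>

definition step_const :: real where
  "step_const = 2 * level_const + 2 * level_const * (4 * D ^ 8) + osc_const * (4 * D ^ 8)
    + C * 128 powr m * (4 * D ^ 8)"

text \<open>\<open>2 * D ^ 6\<close> is the sparseness constant of the stopping family, inserted
  into the weighted bound for sparse sums.\<close>

definition sparse_const :: real where
  "sparse_const = step_const * (8 * D ^ 4 * (2 * D ^ 6))"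

end

section \<open>Sparse domination\<close>

locale CZ_dyadic = CZ_setting \<mu> D m C \<epsilon> N K T + dyadic_space \<mu> D x0 s c
  for \<mu> :: "'a::metric_space measure" and D m C \<epsilon> N :: real and K T and x0 :: 'a and s c
begin

text \<open>The dilation 16 is two to the sixth times the inner radius 1/4. It is large enough that
  the balls decrease along a chain of cells, and that points outside are at distance at least 14r
  from the cell, more than twice its diameter, as regularity of the kernel demands.\<close>

definition dball :: "nat \<Rightarrow> 'a \<Rightarrow> 'a set" where "dball k z = ball z (16 * r k)"

definition loc :: "('a \<Rightarrow> real) \<Rightarrow> nat \<Rightarrow> 'a \<Rightarrow> 'a \<Rightarrow> real" where
  "loc f k z y = f y * indicator (dball k z) y"

definition avg :: "('a \<Rightarrow> real) \<Rightarrow> nat \<Rightarrow> 'a \<Rightarrow> real" where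
  "avg f k z = (\<integral>y. \<bar>f y\<bar> * indicator (dball k z) y \<partial>\<mu>) / measure \<mu> (dball k z)"

lemma dball_sets [measurable, simp]: "dball k z \<in> sets \<mu>"
  by (simp add: dball_def)

lemma emeasure_dball: "emeasure \<mu> (dball k z) = ennreal (measure \<mu> (dball k z))"
  and measure_dball_pos: "measure \<mu> (dball k z) > 0"
proof -
  show e: "emeasure \<mu> (dball k z) = ennreal (measure \<mu> (dball k z))"
    using emeasure_ball_finite by (simp add: dball_def emeasure_eq_ennreal_measure less_top)
  show "measure \<mu> (dball k z) > 0"
    using emeasure_ball_pos[of "16 * r k" z] e by (simp add: dball_def)
qed

lemma emeasure_dball_le_cell:
  "c k z = z \<Longrightarrow> emeasure \<mu> (dball k z) \<le> ennreal (D ^ 6) * emeasure \<mu> (cell k z)"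
  using emeasure_ball_le_cell[of k z 6] by (simp add: dball_def)

lemma dball_mono:
  assumes "j \<le> k" "c k z = z"
  shows "dball k z \<subseteq> dball j (c j z)"
proof (cases "j = k")
  case False
  have d: "dist z (c j z) < 2 * r j" by (rule dist_c)
  have "(8::real) ^ Suc j \<le> 8 ^ k" using assms(1) False by (intro power_increasing) auto
  then have rk: "r k \<le> r j / 8" using s_pos by (simp add: r_def frac_le)
  show ?thesis
  proof
    fix y assume "y \<in> dball k z"
    then have "dist z y < 16 * r k" by (simp add: dball_def)
    moreover have "dist (c j z) y \<le> dist z (c j z) + dist z y" by (metis dist_commute dist_triangle)
    ultimately show "y \<in> dball j (c j z)" using rk d r_pos[of j] unfolding dball_def mem_ball by linarith
  qed
qed (use assms in simp)

lemma cell_subset_dball: "cell k z \<subseteq> dball k z"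
  unfolding dball_def by (rule order_trans[OF cell_subset_ball subset_ball]) simp

lemma loc_L2: "f \<in> L2_space \<mu> \<Longrightarrow> loc f k z \<in> L2_space \<mu>"
  unfolding loc_def[abs_def] by (rule L2_space_indicator) auto

lemma loc_integrable: "f \<in> L2_space \<mu> \<Longrightarrow> integrable \<mu> (loc f k z)"
  by (rule L2_integrable_on_ball[OF loc_L2, where z = z and R = "16 * r k"]) (auto simp: loc_def dball_def)

lemma avg_nonneg: "avg f k z \<ge> 0"
  unfolding avg_def by (intro divide_nonneg_nonneg integral_nonneg_AE) auto

lemma nn_integral_dball:
  assumes f: "f \<in> L2_space \<mu>"
  shows "(\<integral>\<^sup>+y\<in>dball k z. ennreal \<bar>f y\<bar> \<partial>\<mu>) = ennreal (avg f k z) * emeasure \<mu> (dball k z)"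
proof -
  note f[measurable]
  have "integrable \<mu> (\<lambda>y. \<bar>f y\<bar> * indicator (dball k z) y)"
    using integrable_abs[OF loc_integrable[OF f, of k z]] by (simp add: loc_def abs_mult)
  then have "(\<integral>\<^sup>+y. ennreal (\<bar>f y\<bar> * indicator (dball k z) y) \<partial>\<mu>)
      = ennreal (\<integral>y. \<bar>f y\<bar> * indicator (dball k z) y \<partial>\<mu>)"
    by (rule nn_integral_eq_integral) auto
  moreover have "(\<integral>y. \<bar>f y\<bar> * indicator (dball k z) y \<partial>\<mu>) = avg f k z * measure \<mu> (dball k z)"
    using measure_dball_pos[of k z] by (simp add: avg_def)
  moreover have "(\<integral>\<^sup>+y. ennreal (\<bar>f y\<bar> * indicator (dball k z) y) \<partial>\<mu>) = (\<integral>\<^sup>+y\<in>dball k z. ennreal \<bar>f y\<bar> \<partial>\<mu>)"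
    by (intro nn_integral_cong) (auto simp: indicator_def)
  ultimately show ?thesis
    by (simp add: emeasure_dball ennreal_mult avg_nonneg)
qed

lemma nn_integral_loc:
  assumes f: "f \<in> L2_space \<mu>"
  shows "(\<integral>\<^sup>+y. ennreal \<bar>loc f k z y\<bar> \<partial>\<mu>) = ennreal (avg f k z) * emeasure \<mu> (dball k z)"
  unfolding nn_integral_dball[OF f, symmetric]
  by (intro nn_integral_cong) (auto simp: loc_def indicator_def)

text \<open>The factor \<open>r k powr m\<close> is what a kernel of size
  \<open>1 / r k powr m\<close> cancels, leaving a multiple of the average.\<close>

lemma nn_integral_dball_growth:
  assumes f: "f \<in> L2_space \<mu>"
  shows "(\<integral>\<^sup>+y\<in>dball k z. ennreal \<bar>f y\<bar> \<partial>\<mu>) \<le> ennreal (C * 16 powr m * r k powr m * avg f k z)"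
proof -
  have "emeasure \<mu> (dball k z) \<le> ennreal (C * (16 * r k) powr m)"
    unfolding dball_def by (rule growth) simp
  also have "(16 * r k) powr m = 16 powr m * r k powr m"
    by (rule powr_mult)
  finally have "ennreal (avg f k z) * emeasure \<mu> (dball k z)
      \<le> ennreal (avg f k z) * ennreal (C * (16 powr m * r k powr m))" by (rule mult_left_mono) simp
  also have "\<dots> = ennreal (C * 16 powr m * r k powr m * avg f k z)"
    using avg_nonneg[of f k z] C_pos by (simp add: ennreal_mult[symmetric] mult_ac)
  finally show ?thesis unfolding nn_integral_dball[OF f] .
qed

lemma level_const_ge_1: "level_const \<ge> 1"
  by (simp add: level_const_def)

lemma T_loc_eq_0:
  assumes f: "f \<in> L2_space \<mu>" and "avg f k z = 0"
  shows "AE x in \<mu>. T (loc f k z) x = 0"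
proof (rule T_eq_0[OF loc_L2[OF f]])
  note loc_L2[OF f, measurable]
  have "(\<integral>\<^sup>+y. ennreal \<bar>loc f k z y\<bar> \<partial>\<mu>) = 0" using nn_integral_loc[OF f, of k z] assms(2) by simp
  then show "AE y in \<mu>. loc f k z y = 0" by (subst (asm) nn_integral_0_iff_AE) auto
qed

text \<open>The weak bound at a multiple of the average. A zero average is treated apart because the
  height must be positive; then \<open>T\<close> of the localised function vanishes almost
  everywhere.\<close>

lemma T_loc_exceptional_set:
  assumes f: "f \<in> L2_space \<mu>" and z: "c k z = z"
  shows "emeasure \<mu> {x. 2 * level_const * avg f k z < \<bar>T (loc f k z) x\<bar>} \<le> ennreal (1 / 8) * emeasure \<mu> (cell k z)"
proof (cases "avg f k z = 0")
  case True
  note loc_L2[OF f, measurable] T_L2[OF loc_L2[OF f], measurable]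
  have "AE x in \<mu>. T (loc f k z) x = 0" by (rule T_loc_eq_0[OF f True])
  then have "AE x in \<mu>. x \<notin> {x. 2 * level_const * avg f k z < \<bar>T (loc f k z) x\<bar>}"
    by eventually_elim (simp add: True)
  moreover have "{x \<in> space \<mu>. 2 * level_const * avg f k z < \<bar>T (loc f k z) x\<bar>} \<in> sets \<mu>" by measurable
  ultimately have "emeasure \<mu> {x. 2 * level_const * avg f k z < \<bar>T (loc f k z) x\<bar>} = 0"
    by (subst (asm) AE_iff_measurable[of "{x. 2 * level_const * avg f k z < \<bar>T (loc f k z) x\<bar>}"]) auto
  then show ?thesis by simp
next
  case False
  then have a: "avg f k z > 0" using avg_nonneg[of f k z] by simp
  define L where "L = level_const"
  have L: "L \<ge> 1" "8 * weak_const * D ^ 6 \<le> L" by (auto simp: L_def level_const_def)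
  let ?a = "avg f k z" and ?b = "emeasure \<mu> (dball k z)"
  let ?E = "{x. 2 * (L * ?a) < \<bar>T (loc f k z) x\<bar>}"
  have "ennreal (L * ?a) * emeasure \<mu> ?E \<le> ennreal weak_const * (\<integral>\<^sup>+y. ennreal \<bar>loc f k z y\<bar> \<partial>\<mu>)"
  proof (rule weak_type_bound[OF loc_L2[OF f]])
    show "(\<integral>\<^sup>+y. ennreal \<bar>loc f k z y\<bar> \<partial>\<mu>) \<le> ennreal (L * ?a) * emeasure \<mu> (ball z (16 * r k))"
      unfolding nn_integral_loc[OF f] dball_def
      using L a by (intro mult_right_mono ennreal_leI) auto
  qed (use a L in \<open>auto simp: loc_def dball_def\<close>)
  also have "\<dots> \<le> ennreal weak_const * (ennreal ?a * (ennreal (D ^ 6) * emeasure \<mu> (cell k z)))"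
    unfolding nn_integral_loc[OF f] by (intro mult_left_mono emeasure_dball_le_cell z) auto
  also have "\<dots> = ennreal (weak_const * D ^ 6 * ?a) * emeasure \<mu> (cell k z)"
    using weak_const_pos D_ge_1 a by (simp add: ennreal_mult mult_ac)
  also have "\<dots> \<le> ennreal (L * ?a * (1 / 8)) * emeasure \<mu> (cell k z)"
    using L a by (intro mult_right_mono ennreal_leI) auto
  also have "\<dots> = ennreal (L * ?a) * (ennreal (1 / 8) * emeasure \<mu> (cell k z))"
  proof -
    have "ennreal (L * ?a * (1 / 8)) = ennreal (L * ?a) * ennreal (1 / 8)"
      by (rule ennreal_mult) (use L a in auto)
    then show ?thesis by (simp only: mult.assoc)
  qed
  finally have "emeasure \<mu> ?E \<le> ennreal (1 / 8) * emeasure \<mu> (cell k z)"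
    using L a by (subst (asm) ennreal_mult_le_mult_iff) auto
  then show ?thesis by (simp add: L_def mult.assoc)
qed

text \<open>The part of \<open>f\<close> between two dilated balls does not reach the smaller cell, so there the kernel
  representation of \<open>T\<close> is available.\<close>

lemma T_loc_diff_kernel:
  assumes f: "f \<in> L2_space \<mu>" and kz: "n \<le> k" "c k p = p" "c n p = z"
  shows "AE x in \<mu>. x \<in> cell k p \<longrightarrow>
    T (loc f n z) x - T (loc f k p) x = (\<integral>y. K x y * (loc f n z y - loc f k p y) \<partial>\<mu>)"
  using T_diff[OF loc_L2[OF f, of n z] loc_L2[OF f, of k p]]
    T_kernel[OF L2_space_diff[OF loc_L2[OF f, of n z] loc_L2[OF f, of k p]]]
proof eventually_elim
  case (elim x)
  show ?case
  proof
    assume x: "x \<in> cell k p"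
    have "x \<notin> ae_support \<mu> (\<lambda>y. loc f n z y - loc f k p y)"
    proof (rule not_in_ae_support)
      show "open (dball k p)" by (simp add: dball_def)
      show "x \<in> dball k p" using x cell_subset_dball by blast
      show "loc f n z y - loc f k p y = 0" if "y \<in> dball k p" for y
        using that dball_mono[OF kz(1,2)] kz(3) by (auto simp: loc_def)
    qed
    then show "T (loc f n z) x - T (loc f k p) x = (\<integral>y. K x y * (loc f n z y - loc f k p y) \<partial>\<mu>)"
      using elim by simp
  qed
qed

lemma dist_cell_outside_dball:
  assumes "x \<in> cell k p" "y \<notin> dball k p"
  shows "dist x y \<ge> 14 * r k"
proof -
  have "dist p x < 2 * r k" using assms(1) cell_subset_ball[of k p] by auto
  moreover have "16 * r k \<le> dist p y" using assms(2) by (simp add: dball_def not_less)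
  moreover have "dist p y \<le> dist p x + dist x y" by (rule dist_triangle)
  ultimately show ?thesis by simp
qed

lemma kernel_loc_diff_bound:
  assumes x: "x \<in> cell k p" and that: "n \<le> k" "c k p = p" "c n p = z"
  shows "\<bar>K x y * (loc f n z y - loc f k p y)\<bar> \<le> 1 / r k powr m * \<bar>loc f n z y - loc f k p y\<bar>"
proof (cases "y \<in> dball k p")
  case True
  then show ?thesis using dball_mono[OF that(1,2)] that(3) by (auto simp: loc_def)
next
  case False
  have d: "14 * r k \<le> dist x y" by (rule dist_cell_outside_dball[OF x False])
  have ne: "x \<noteq> y" using d r_pos[of k] by (auto simp del: r_pos)
  have d': "r k \<le> dist x y" using d r_pos[of k] by linarith
  have "\<bar>K x y\<bar> \<le> 1 / dist x y powr m" by (rule K_size[OF ne])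
  also have "\<dots> \<le> 1 / r k powr m" using d' m_pos r_pos[of k] by (intro frac_le powr_mono2) auto
  finally show ?thesis unfolding abs_mult by (intro mult_right_mono) auto
qed

lemma kernel_loc_diff_integrable:
  assumes f: "f \<in> L2_space \<mu>" and x: "x \<in> cell k p" and kz: "n \<le> k" "c k p = p" "c n p = z"
  shows "integrable \<mu> (\<lambda>y. K x y * (loc f n z y - loc f k p y))"
proof (rule Bochner_Integration.integrable_bound)
  note loc_L2[OF f, measurable]
  show "integrable \<mu> (\<lambda>y. 1 / r k powr m * (loc f n z y - loc f k p y))"
    by (intro integrable_mult_right Bochner_Integration.integrable_diff loc_integrable f)
  show "AE y in \<mu>. norm (K x y * (loc f n z y - loc f k p y)) \<le> norm (1 / r k powr m * (loc f n z y - loc f k p y))"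
    using kernel_loc_diff_bound[OF x kz] by (intro AE_I2) (simp add: abs_mult)
  show "(\<lambda>y. K x y * (loc f n z y - loc f k p y)) \<in> borel_measurable \<mu>" by measurable
qed

text \<open>Between consecutive scales the size of the kernel is enough, as the part of
  \<open>f\<close> in question lives at distances comparable to the scale. The ball of radius
  \<open>16 * r j\<close> has radius 128 times the child scale.\<close>

lemma T_loc_child_bound:
  assumes f: "f \<in> L2_space \<mu>" and p: "c (Suc j) p = p"
  shows "AE x in \<mu>. x \<in> cell (Suc j) p \<longrightarrow>
    \<bar>T (loc f j (c j p)) x - T (loc f (Suc j) p) x\<bar> \<le> C * 128 powr m * avg f j (c j p)"
  using T_loc_diff_kernel[OF f le_SucI[OF order_refl] p refl]
proof eventually_elim
  case (elim x)
  note f[measurable]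
  show ?case
  proof
    assume x: "x \<in> cell (Suc j) p"
    let ?u = "\<lambda>y. loc f j (c j p) y - loc f (Suc j) p y"
    let ?q = "1 / r (Suc j) powr m"
    have jle: "j \<le> Suc j" by simp
    have "ennreal \<bar>\<integral>y. K x y * ?u y \<partial>\<mu>\<bar> \<le> (\<integral>\<^sup>+y. ennreal \<bar>K x y * ?u y\<bar> \<partial>\<mu>)"
      using integral_norm_bound_ennreal[OF kernel_loc_diff_integrable[OF f x jle p refl]] by simp
    also have "\<dots> \<le> (\<integral>\<^sup>+y. ennreal ?q * (ennreal \<bar>f y\<bar> * indicator (dball j (c j p)) y) \<partial>\<mu>)"
    proof (rule nn_integral_mono)
      fix y
      have "\<bar>K x y * ?u y\<bar> \<le> ?q * \<bar>?u y\<bar>" by (rule kernel_loc_diff_bound[OF x jle p refl])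
      also have "\<dots> \<le> ?q * (\<bar>f y\<bar> * indicator (dball j (c j p)) y)"
        using dball_mono[OF jle p] by (intro mult_left_mono) (auto simp: loc_def indicator_def)
      finally have "ennreal \<bar>K x y * ?u y\<bar> \<le> ennreal (?q * (\<bar>f y\<bar> * indicator (dball j (c j p)) y))"
        by (rule ennreal_leI)
      also have "\<dots> = ennreal ?q * (ennreal \<bar>f y\<bar> * indicator (dball j (c j p)) y)"
        by (subst ennreal_mult) (auto simp: indicator_def)
      finally show "ennreal \<bar>K x y * ?u y\<bar> \<le> ennreal ?q * (ennreal \<bar>f y\<bar> * indicator (dball j (c j p)) y)" .
    qed
    also have "\<dots> = ennreal ?q * (\<integral>\<^sup>+y\<in>dball j (c j p). ennreal \<bar>f y\<bar> \<partial>\<mu>)"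
      by (intro nn_integral_cmult) measurable
    also have "\<dots> \<le> ennreal ?q * ennreal (C * 16 powr m * r j powr m * avg f j (c j p))"
      by (intro mult_left_mono nn_integral_dball_growth f) simp
    also have "\<dots> = ennreal (?q * (C * 16 powr m * r j powr m * avg f j (c j p)))"
      by (rule ennreal_mult[symmetric]) (use C_pos avg_nonneg in auto)
    also have "?q * (C * 16 powr m * r j powr m * avg f j (c j p)) = C * 128 powr m * avg f j (c j p)"
    proof -
      have "r j powr m = 8 powr m * r (Suc j) powr m"
        by (simp add: r_Suc powr_mult[symmetric])
      moreover have "16 powr m * 8 powr m = (128 :: real) powr m" by (simp add: powr_mult[symmetric])
      ultimately show ?thesis by (simp add: r_Suc field_simps)
    qed
    finally show "\<bar>T (loc f j (c j p)) x - T (loc f (Suc j) p) x\<bar> \<le> C * 128 powr m * avg f j (c j p)"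
      using elim x C_pos avg_nonneg by (subst (asm) ennreal_le_iff) auto
  qed
qed

lemma eight_powr_minus_\<epsilon>: "0 < 8 powr (- \<epsilon>)" "8 powr (- \<epsilon>) < (1::real)"
  using \<epsilon>_pos powr_less_mono[of "- \<epsilon>" 0 8] by auto

lemma osc_const_pos: "osc_const > 0"
  using eight_powr_minus_\<epsilon> C_pos by (simp add: osc_const_def)

text \<open>Sort the points \<open>y\<close> by the ancestor ball they last belong to. At ancestor
  scale \<open>r i\<close> the kernel difference is of order
  \<open>(r k / r i) powr \<epsilon> / r i powr m\<close>, and growth turns the integral of |f| over
  that ball into \<open>r i powr m\<close> times an average at most \<open>M\<close>. The remaining
  powers of \<open>r k / r i\<close> form a geometric series whatever the number of
  ancestors.\<close>

lemma kernel_integral_oscillation: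
  assumes f: "f \<in> L2_space \<mu>" and kz: "n \<le> k" "c k p = p" "c n p = z"
    and x: "x \<in> cell k p" "x' \<in> cell k p"
    and M: "\<And>i. n \<le> i \<Longrightarrow> i < k \<Longrightarrow> avg f i (c i p) \<le> M" and M_nonneg: "M \<ge> 0"
  shows "\<bar>(\<integral>y. K x y * (loc f n z y - loc f k p y) \<partial>\<mu>)
      - (\<integral>y. K x' y * (loc f n z y - loc f k p y) \<partial>\<mu>)\<bar> \<le> osc_const * M"
proof -
  note f[measurable]
  let ?u = "\<lambda>y. loc f n z y - loc f k p y"
  define q where "q = 8 powr (- \<epsilon>)"
  have q: "0 < q" "q < 1" using eight_powr_minus_\<epsilon> by (auto simp: q_def)
  define w where "w i = (4 * r k) powr \<epsilon> / r i powr (m + \<epsilon>)" for i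
  have w: "w i \<ge> 0" for i by (simp add: w_def)
  have pointwise: "ennreal \<bar>K x y * ?u y - K x' y * ?u y\<bar>
      \<le> (\<Sum>i\<in>{n..<k}. ennreal (w i) * (ennreal \<bar>f y\<bar> * indicator (dball i (c i p)) y))" for y
  proof (cases "y \<in> dball n z \<and> y \<notin> dball k p")
    case False
    then have "?u y = 0" using dball_mono[OF kz(1,2)] kz(3) by (auto simp: loc_def indicator_def)
    then show ?thesis by simp
  next
    case True
    \<comment> \<open>The finest ancestor scale whose ball contains \<open>y\<close>. The ball one
      scale finer misses \<open>y\<close>, which bounds the distance from \<open>x\<close> to
      \<open>y\<close> below by \<open>14 * r (Suc i)\<close>, hence by \<open>r i\<close>.\<close>
    define i where "i = (GREATEST i. i \<le> k \<and> y \<in> dball i (c i p))"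
    have ex: "n \<le> k \<and> y \<in> dball n (c n p)" using True kz by simp
    have i: "i \<le> k" "y \<in> dball i (c i p)"
      using GreatestI_nat[of "\<lambda>i. i \<le> k \<and> y \<in> dball i (c i p)" n k, OF ex] by (auto simp: i_def)
    have ni: "n \<le> i"
      unfolding i_def by (rule Greatest_le_nat[of "\<lambda>i. i \<le> k \<and> y \<in> dball i (c i p)" n k, OF ex]) auto
    have "i \<noteq> k" using i(2) True kz(2) by auto
    then have ik: "i < k" using i(1) by simp
    have not_in: "y \<notin> dball (Suc i) (c (Suc i) p)"
    proof
      assume "y \<in> dball (Suc i) (c (Suc i) p)"
      then have "Suc i \<le> i" using ik unfolding i_def
        by (intro Greatest_le_nat[of "\<lambda>i. i \<le> k \<and> y \<in> dball i (c i p)" _ k]) (auto simp: i_def[symmetric])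
      then show False by simp
    qed
    have xi: "x \<in> cell (Suc i) (c (Suc i) p)"
      using cell_mono[OF kz(2), of "Suc i"] ik x(1) by auto
    have d: "14 * r (Suc i) \<le> dist x y" by (rule dist_cell_outside_dball[OF xi not_in])
    have rk: "r k \<le> r (Suc i)"
      using ik s_pos unfolding r_def by (intro divide_left_mono power_increasing) auto
    have "dist p x < 2 * r k" "dist p x' < 2 * r k" using x cell_subset_ball[of k p] by auto
    then have dxx: "dist x x' < 4 * r k" using dist_triangle3[of x x' p] by simp
    have ne: "x \<noteq> y" using d r_pos[of "Suc i"] by (auto simp del: r_pos)
    have "dist x x' \<le> dist x y / 2" using d dxx rk r_pos[of "Suc i"] by linarith
    then have "\<bar>K x y - K x' y\<bar> \<le> dist x x' powr \<epsilon> / dist x y powr (m + \<epsilon>)"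
      using K_smooth[OF ne, of x'] by linarith
    also have "\<dots> \<le> w i" unfolding w_def
    proof (rule frac_le)
      show "dist x x' powr \<epsilon> \<le> (4 * r k) powr \<epsilon>" using dxx \<epsilon>_pos by (intro powr_mono2) auto
      have "r i \<le> dist x y" using d r_Suc[of i] r_pos[of i] by linarith
      then show "r i powr (m + \<epsilon>) \<le> dist x y powr (m + \<epsilon>)"
        using m_pos \<epsilon>_pos by (intro powr_mono2) auto
    qed auto
    finally have Kw: "\<bar>K x y - K x' y\<bar> \<le> w i" .
    have "\<bar>K x y * ?u y - K x' y * ?u y\<bar> = \<bar>K x y - K x' y\<bar> * \<bar>?u y\<bar>"
      by (simp add: abs_mult[symmetric] left_diff_distrib)
    also have "\<dots> \<le> w i * \<bar>f y\<bar>"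
      using Kw w by (intro mult_mono) (auto simp: loc_def indicator_def)
    finally have "ennreal \<bar>K x y * ?u y - K x' y * ?u y\<bar> \<le> ennreal (w i) * ennreal \<bar>f y\<bar>"
      using w by (simp add: ennreal_mult[symmetric] ennreal_leI)
    also have "\<dots> = ennreal (w i) * (ennreal \<bar>f y\<bar> * indicator (dball i (c i p)) y)" using i(2) by simp
    also have "\<dots> \<le> (\<Sum>i\<in>{n..<k}. ennreal (w i) * (ennreal \<bar>f y\<bar> * indicator (dball i (c i p)) y))"
      using ni ik by (intro member_le_sum) auto
    finally show ?thesis .
  qed
  have int: "integrable \<mu> (\<lambda>y. K x y * ?u y)" "integrable \<mu> (\<lambda>y. K x' y * ?u y)"
    using kernel_loc_diff_integrable[OF f _ kz] x by auto
  have "ennreal \<bar>(\<integral>y. K x y * ?u y \<partial>\<mu>) - (\<integral>y. K x' y * ?u y \<partial>\<mu>)\<bar>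
      \<le> (\<integral>\<^sup>+y. ennreal \<bar>K x y * ?u y - K x' y * ?u y\<bar> \<partial>\<mu>)"
    using integral_norm_bound_ennreal[OF Bochner_Integration.integrable_diff[OF int]] int by simp
  also have "\<dots> \<le> (\<integral>\<^sup>+y. (\<Sum>i\<in>{n..<k}. ennreal (w i) * (ennreal \<bar>f y\<bar> * indicator (dball i (c i p)) y)) \<partial>\<mu>)"
    by (intro nn_integral_mono pointwise)
  also have "\<dots> = (\<Sum>i\<in>{n..<k}. ennreal (w i) * (\<integral>\<^sup>+y\<in>dball i (c i p). ennreal \<bar>f y\<bar> \<partial>\<mu>))"
    by (simp add: nn_integral_sum nn_integral_cmult)
  also have "\<dots> \<le> (\<Sum>i\<in>{n..<k}. ennreal (4 powr \<epsilon> * C * 16 powr m * M * q ^ (k - i)))"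
  proof (rule sum_mono)
    fix i assume i: "i \<in> {n..<k}"
    have "ennreal (w i) * (\<integral>\<^sup>+y\<in>dball i (c i p). ennreal \<bar>f y\<bar> \<partial>\<mu>)
        \<le> ennreal (w i) * ennreal (C * 16 powr m * r i powr m * avg f i (c i p))"
      by (intro mult_left_mono nn_integral_dball_growth f) simp
    also have "\<dots> = ennreal (w i * (C * 16 powr m * r i powr m * avg f i (c i p)))"
      by (rule ennreal_mult[symmetric]) (use w C_pos avg_nonneg in auto)
    also have "\<dots> \<le> ennreal (w i * (C * 16 powr m * r i powr m * M))"
      using M i w C_pos by (intro ennreal_leI mult_left_mono) auto
    also have "w i * (C * 16 powr m * r i powr m * M) = 4 powr \<epsilon> * C * 16 powr m * M * q ^ (k - i)"
    proof -
      have "r i = 8 ^ (k - i) * r k"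
      proof -
        have "(8::real) ^ k = 8 ^ i * 8 ^ (k - i)" using i by (simp add: power_add[symmetric])
        then show ?thesis by (simp add: r_def)
      qed
      then have "r i powr \<epsilon> = (8 ^ (k - i)) powr \<epsilon> * r k powr \<epsilon>" by (simp add: powr_mult)
      also have "(8 ^ (k - i) :: real) powr \<epsilon> = (8 powr \<epsilon>) ^ (k - i)"
        by (simp add: powr_realpow[symmetric] powr_powr mult.commute)
      finally have ri: "r i powr \<epsilon> = (8 powr \<epsilon>) ^ (k - i) * r k powr \<epsilon>" .
      have "q = 1 / 8 powr \<epsilon>" by (simp add: q_def powr_minus_divide)
      then have qi: "q ^ (k - i) = 1 / (8 powr \<epsilon>) ^ (k - i)" by (simp add: power_divide)
      have "w i * r i powr m = 4 powr \<epsilon> * (r k powr \<epsilon> / r i powr \<epsilon>)"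
        using r_pos[of i] by (simp add: w_def powr_add powr_mult)
      also have "r k powr \<epsilon> / r i powr \<epsilon> = q ^ (k - i)"
        unfolding ri qi using r_pos[of k] by simp
      finally show ?thesis by (simp add: mult_ac)
    qed
    finally show "ennreal (w i) * (\<integral>\<^sup>+y\<in>dball i (c i p). ennreal \<bar>f y\<bar> \<partial>\<mu>)
        \<le> ennreal (4 powr \<epsilon> * C * 16 powr m * M * q ^ (k - i))" .
  qed
  also have "\<dots> = ennreal (\<Sum>i\<in>{n..<k}. 4 powr \<epsilon> * C * 16 powr m * M * q ^ (k - i))"
    using C_pos M_nonneg q by (intro sum_ennreal) auto
  also have "\<dots> \<le> ennreal (osc_const * M)"
  proof (rule ennreal_leI)
    have "(\<Sum>i\<in>{n..<k}. q ^ (k - i)) = (\<Sum>j\<in>(\<lambda>i. k - i) ` {n..<k}. q ^ j)"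
      by (subst sum.reindex) (auto simp: inj_on_def)
    also have "\<dots> \<le> (\<Sum>j. q ^ j)"
      using q by (intro sum_le_suminf summable_geometric) auto
    also have "\<dots> = 1 / (1 - q)" using q by (simp add: suminf_geometric)
    finally have "4 powr \<epsilon> * C * 16 powr m * M * (\<Sum>i\<in>{n..<k}. q ^ (k - i)) \<le> 4 powr \<epsilon> * C * 16 powr m * M * (1 / (1 - q))"
      using C_pos M_nonneg by (intro mult_left_mono) auto
    then show "(\<Sum>i\<in>{n..<k}. 4 powr \<epsilon> * C * 16 powr m * M * q ^ (k - i)) \<le> osc_const * M"
      by (simp add: sum_distrib_left osc_const_def q_def mult_ac)
  qed
  finally show ?thesis
    using osc_const_pos M_nonneg by (subst (asm) ennreal_le_iff) auto
qed

text \<open>Both \<open>T f\<^sub>Q\<close> and \<open>T f\<^sub>P\<close> are small at some point of \<open>P\<close>, because each is large on less than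
  half of \<open>P\<close>; the regularity of the kernel carries the bound from that point to all of \<open>P\<close>.\<close>

lemma T_loc_diff_bound:
  assumes f: "f \<in> L2_space \<mu>" and kz: "n \<le> k" "c k p = p" "c n p = z"
    and M: "\<And>i. n \<le> i \<Longrightarrow> i \<le> k \<Longrightarrow> avg f i (c i p) \<le> M"
    and small: "emeasure \<mu> (cell k p \<inter> {x. t < \<bar>T (loc f n z) x\<bar>}) < ennreal (1 / 2) * emeasure \<mu> (cell k p)"
  shows "AE x in \<mu>. x \<in> cell k p \<longrightarrow>
    \<bar>T (loc f n z) x - T (loc f k p) x\<bar> \<le> t + 2 * level_const * M + osc_const * M"
proof -
  note loc_L2[OF f, measurable] T_L2[OF loc_L2[OF f], measurable]
  have set_meas: "{x. P x} \<in> sets \<mu>" if "Measurable.pred \<mu> P" for P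
    using that by (simp add: pred_def)
  have M_nonneg: "M \<ge> 0" using M[of k] kz avg_nonneg[of f k "c k p"] by simp
  define \<Phi> where "\<Phi> x = (\<integral>y. K x y * (loc f n z y - loc f k p y) \<partial>\<mu>)" for x
  define E where "E = {x. t < \<bar>T (loc f n z) x\<bar>}"
  define E' where "E' = {x. 2 * level_const * avg f k p < \<bar>T (loc f k p) x\<bar>}"
  have [measurable]: "E \<in> sets \<mu>" "E' \<in> sets \<mu>"
    unfolding E_def E'_def by (rule set_meas; measurable)+
  have \<Phi>_AE: "AE x in \<mu>. x \<in> cell k p \<longrightarrow> T (loc f n z) x - T (loc f k p) x = \<Phi> x"
    unfolding \<Phi>_def by (rule T_loc_diff_kernel[OF f kz])
  \<comment> \<open>The kernel identity holds only almost everywhere, so it is demanded of the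
    comparison point as well. Were there none, the exceptional sets would cover the cell up to a
    null set with less than 1/2 + 1/8 of its measure.\<close>
  have "\<exists>x'\<in>cell k p. x' \<notin> E \<and> x' \<notin> E' \<and> T (loc f n z) x' - T (loc f k p) x' = \<Phi> x'"
  proof (rule ccontr)
    assume neg: "\<not> ?thesis"
    let ?V = "(cell k p \<inter> E) \<union> E'"
    have "emeasure \<mu> (cell k p) \<le> emeasure \<mu> ?V"
    proof (rule emeasure_mono_AE)
      show "AE x in \<mu>. x \<in> cell k p \<longrightarrow> x \<in> ?V"
        using \<Phi>_AE by eventually_elim (use neg in blast)
    qed measurable
    also have "\<dots> \<le> emeasure \<mu> (cell k p \<inter> E) + emeasure \<mu> E'"
      by (rule emeasure_subadditive) measurable
    also have "\<dots> \<le> emeasure \<mu> (cell k p \<inter> E) + ennreal (1 / 8) * emeasure \<mu> (cell k p)"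
      using T_loc_exceptional_set[OF f kz(2)] unfolding E'_def by (rule add_left_mono)
    also have "\<dots> < ennreal (1 / 2) * emeasure \<mu> (cell k p) + ennreal (1 / 8) * emeasure \<mu> (cell k p)"
    proof -
      have "ennreal (1 / 8) * emeasure \<mu> (cell k p) < top"
        using emeasure_cell_finite[of k p] by (simp add: ennreal_mult_less_top)
      then show ?thesis
        using small unfolding E_def
        by (subst (1 2) add.commute) (simp add: ennreal_add_left_cancel_less)
    qed
    also have "\<dots> \<le> 1 * emeasure \<mu> (cell k p)"
    proof -
      have "ennreal (1 / 2) + ennreal (1 / 8) = ennreal (5 / 8)"
        by (subst ennreal_plus[symmetric]) auto
      moreover have "ennreal (5 / 8) \<le> 1" by (subst ennreal_le_1) simp
      ultimately show ?thesis unfolding distrib_right[symmetric] by (intro mult_right_mono) auto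
    qed
    finally show False by simp
  qed
  then obtain x' where x': "x' \<in> cell k p" "x' \<notin> E" "x' \<notin> E'"
    "T (loc f n z) x' - T (loc f k p) x' = \<Phi> x'" by blast
  have "2 * level_const * avg f k p \<le> 2 * level_const * M"
    using M[of k] kz level_const_ge_1 by (intro mult_left_mono) auto
  then have \<Phi>': "\<bar>\<Phi> x'\<bar> \<le> t + 2 * level_const * M"
    using x' by (auto simp: E_def E'_def not_less)
  show ?thesis using \<Phi>_AE
  proof eventually_elim
    case (elim x)
    show ?case
    proof
      assume x: "x \<in> cell k p"
      have "\<bar>\<Phi> x - \<Phi> x'\<bar> \<le> osc_const * M" unfolding \<Phi>_def
        by (rule kernel_integral_oscillation[OF f kz x x'(1)]) (use M M_nonneg in auto)
      then show "\<bar>T (loc f n z) x - T (loc f k p) x\<bar> \<le> t + 2 * level_const * M + osc_const * M"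
        using elim x \<Phi>' by auto
    qed
  qed
qed

text \<open>A weak bound for the maximal function of cells below a given one. In the factor
  \<open>4 * D ^ 8\<close>, \<open>D ^ 2\<close> pays for tripling the balls, \<open>D ^ 6\<close>
  for passing from the initial ball to its cell, and 4 yields the quarter.\<close>

lemma avg_maximal_bound:
  assumes f: "f \<in> L2_space \<mu>" and z: "c n z = z" and a: "avg f n z > 0"
  shows "emeasure \<mu> (\<Union>P\<in>{(k, p). n < k \<and> c k p = p \<and> c n p = z \<and> 4 * D ^ 8 * avg f n z < avg f k p}.
      dball (fst P) (snd P)) \<le> ennreal (1 / 4) * emeasure \<mu> (cell n z)"
proof -
  note f[measurable]
  let ?a = "avg f n z"
  define I where "I = {(k, p). n < k \<and> c k p = p \<and> c n p = z \<and> 4 * D ^ 8 * ?a < avg f k p}"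
  define U where "U = (\<Union>P\<in>I. dball (fst P) (snd P))"
  have I: "countable I"
  proof (rule countable_subset[OF _ countable_centres])
    show "I \<subseteq> (SIGMA k:UNIV. range (c k))" unfolding I_def by (auto intro: range_eqI[OF sym])
  qed
  have "ennreal (4 * D ^ 6 * ?a) * emeasure \<mu> U \<le> (\<integral>\<^sup>+y\<in>U. ennreal \<bar>f y\<bar> \<partial>\<mu>)"
    unfolding U_def dball_def
  proof (rule weak_maximal_inequality_countable[OF sets_\<mu> I])
    fix P assume "P \<in> I"
    then have aP: "4 * D ^ 8 * ?a < avg f (fst P) (snd P)" by (auto simp: I_def)
    let ?k = "fst P" and ?p = "snd P"
    have "emeasure \<mu> (ball ?p (3 * (16 * r ?k))) \<le> emeasure \<mu> (ball ?p (2 ^ 2 * (16 * r ?k)))"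
      by (intro emeasure_mono subset_ball) auto
    also have "\<dots> \<le> ennreal (D ^ 2) * emeasure \<mu> (dball ?k ?p)"
      unfolding dball_def by (rule doubling_power) simp
    finally have "ennreal (4 * D ^ 6 * ?a) * emeasure \<mu> (ball ?p (3 * (16 * r ?k)))
        \<le> ennreal (4 * D ^ 6 * ?a) * (ennreal (D ^ 2) * emeasure \<mu> (dball ?k ?p))"
      by (rule mult_left_mono) simp
    also have "\<dots> = ennreal (4 * D ^ 8 * ?a) * emeasure \<mu> (dball ?k ?p)"
    proof -
      have "ennreal (4 * D ^ 8 * ?a) = ennreal (4 * D ^ 6 * ?a * D ^ 2)"
        by (rule arg_cong[of _ _ ennreal]) (simp add: power_add[symmetric] mult_ac)
      also have "\<dots> = ennreal (4 * D ^ 6 * ?a) * ennreal (D ^ 2)"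
        by (rule ennreal_mult) (use a D_ge_1 in auto)
      finally show ?thesis by (simp only: mult.assoc)
    qed
    also have "\<dots> \<le> ennreal (avg f ?k ?p) * emeasure \<mu> (dball ?k ?p)"
      using aP by (intro mult_right_mono ennreal_leI) auto
    also have "\<dots> = (\<integral>\<^sup>+y\<in>ball ?p (16 * r ?k). ennreal \<bar>f y\<bar> \<partial>\<mu>)"
      using nn_integral_dball[OF f, of ?k ?p] by (simp add: dball_def)
    finally show "ennreal (4 * D ^ 6 * ?a) * emeasure \<mu> (ball ?p (3 * (16 * r ?k)))
        \<le> (\<integral>\<^sup>+y\<in>ball ?p (16 * r ?k). ennreal \<bar>f y\<bar> \<partial>\<mu>)" .
  qed measurable
  also have "\<dots> \<le> (\<integral>\<^sup>+y\<in>dball n z. ennreal \<bar>f y\<bar> \<partial>\<mu>)"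
  proof -
    have "dball (fst P) (snd P) \<subseteq> dball n z" if "P \<in> I" for P
      using dball_mono[of n "fst P" "snd P"] that by (auto simp: I_def)
    then have "U \<subseteq> dball n z" unfolding U_def by blast
    then show ?thesis by (intro nn_integral_mono) (auto simp: indicator_def)
  qed
  also have "\<dots> \<le> ennreal ?a * (ennreal (D ^ 6) * emeasure \<mu> (cell n z))"
    unfolding nn_integral_dball[OF f] by (intro mult_left_mono emeasure_dball_le_cell z) simp
  also have "\<dots> = ennreal (4 * D ^ 6 * ?a) * (ennreal (1 / 4) * emeasure \<mu> (cell n z))"
  proof -
    have "ennreal ?a * ennreal (D ^ 6) = ennreal (4 * D ^ 6 * ?a) * ennreal (1 / 4)"
      using a D_ge_1 by (simp add: ennreal_mult[symmetric] mult_ac)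
    then show ?thesis by (simp only: mult.assoc[symmetric])
  qed
  finally have "emeasure \<mu> U \<le> ennreal (1 / 4) * emeasure \<mu> (cell n z)"
    using a D_ge_1 by (subst (asm) ennreal_mult_le_mult_iff) auto
  then show ?thesis unfolding U_def I_def .
qed

lemma step_const_bounds: "2 * level_const \<le> step_const" "0 < step_const"
proof -
  have "0 \<le> 2 * level_const * (4 * D ^ 8)" "0 \<le> osc_const * (4 * D ^ 8)" "0 \<le> C * 128 powr m * (4 * D ^ 8)"
    using level_const_ge_1 osc_const_pos C_pos D_ge_1 by auto
  then show "2 * level_const \<le> step_const" unfolding step_const_def by linarith
  then show "0 < step_const" using level_const_ge_1 by linarith
qed

text \<open>Cells stopped for a large average fill at most 1/4. Those at least half exceptional fill
  at most twice the exceptional set, 2/8, so the total is at most 1/2. Inside a stopping cell, the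
  bound is first obtained on its parent, which is not stopped.\<close>

lemma stopping_cells:
  assumes f: "f \<in> L2_space \<mu>" and z: "c n z = z"
  shows "\<exists>\<P>. countable \<P> \<and> (\<forall>P\<in>\<P>. n < fst P \<and> c (fst P) (snd P) = snd P \<and> c n (snd P) = z) \<and>
    disjoint_family_on cells \<P> \<and> emeasure \<mu> (\<Union>P\<in>\<P>. cells P) \<le> ennreal (1 / 2) * emeasure \<mu> (cell n z) \<and>
    (AE x in \<mu>. x \<in> cell n z - (\<Union>P\<in>\<P>. cells P) \<longrightarrow> \<bar>T (loc f n z) x\<bar> \<le> step_const * avg f n z) \<and>
    (\<forall>P\<in>\<P>. AE x in \<mu>. x \<in> cells P \<longrightarrow>
      \<bar>T (loc f n z) x\<bar> \<le> \<bar>T (loc f (fst P) (snd P)) x\<bar> + step_const * avg f n z)"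
proof (cases "avg f n z = 0")
  case True
  have "AE x in \<mu>. T (loc f n z) x = 0" by (rule T_loc_eq_0[OF f True])
  then have "AE x in \<mu>. x \<in> cell n z \<longrightarrow> \<bar>T (loc f n z) x\<bar> \<le> step_const * avg f n z"
    by eventually_elim (simp add: True)
  then show ?thesis by (intro exI[of _ "{}"]) (auto simp: disjoint_family_on_def)
next
  case False
  define a where "a = avg f n z"
  have a: "a > 0" using False avg_nonneg[of f n z] by (simp add: a_def)
  define A where "A = 4 * D ^ 8"
  have A: "A \<ge> 1"
  proof -
    have "1 \<le> D ^ 8" using D_ge_1 by simp
    then show ?thesis by (simp add: A_def)
  qed
  define t where "t = 2 * level_const * a"
  note loc_L2[OF f, measurable] T_L2[OF loc_L2[OF f], measurable]
  define E where "E = {x. t < \<bar>T (loc f n z) x\<bar>}"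
  have E_sets [measurable]: "E \<in> sets \<mu>"
  proof -
    have "{x \<in> space \<mu>. t < \<bar>T (loc f n z) x\<bar>} \<in> sets \<mu>" by measurable
    then show ?thesis by (simp add: E_def)
  qed
  have E_small: "emeasure \<mu> E \<le> ennreal (1 / 8) * emeasure \<mu> (cell n z)"
    unfolding E_def t_def a_def by (rule T_loc_exceptional_set[OF f z])
  \<comment> \<open>Only proper subcells of the initial cell qualify, so maximality is automatically
    relative to it.\<close>
  define S where "S k p \<longleftrightarrow> n < k \<and> c n p = z \<and> (A * a < avg f k p \<or>
    ennreal (1 / 2) * emeasure \<mu> (cell k p) \<le> emeasure \<mu> (cell k p \<inter> E))" for k p
  define \<P> where "\<P> = maximal_cells S"
  define U where "U = (\<Union>P\<in>{(k, p). n < k \<and> c k p = p \<and> c n p = z \<and> 4 * D ^ 8 * avg f n z < avg f k p}.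
      dball (fst P) (snd P))"
  have U_small: "emeasure \<mu> U \<le> ennreal (1 / 4) * emeasure \<mu> (cell n z)"
    unfolding U_def by (rule avg_maximal_bound[OF f z]) (use a in \<open>simp add: a_def\<close>)
  have U_sets: "U \<in> sets \<mu>"
  proof -
    have "open U" unfolding U_def dball_def by auto
    then show ?thesis by (simp add: sets_\<mu>)
  qed
  define \<P>' where "\<P>' = {P \<in> \<P>. ennreal (1 / 2) * emeasure \<mu> (cells P) \<le> emeasure \<mu> (cells P \<inter> E)}"
  have \<P>: "countable \<P>" "disjoint_family_on cells \<P>"
    unfolding \<P>_def by (rule countable_maximal_cells, rule disjoint_maximal_cells)
  have \<P>': "countable \<P>'" "disjoint_family_on cells \<P>'"
    using \<P> unfolding \<P>'_def by (auto intro: countable_subset disjoint_family_on_mono[rotated])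
  have sub: "(\<Union>P\<in>\<P>. cells P) \<subseteq> U \<union> (\<Union>P\<in>\<P>'. cells P)"
  proof
    fix x assume "x \<in> (\<Union>P\<in>\<P>. cells P)"
    then obtain P where P: "P \<in> \<P>" "x \<in> cells P" by blast
    show "x \<in> U \<union> (\<Union>P\<in>\<P>'. cells P)"
    proof (cases "P \<in> \<P>'")
      case False
      then have "n < fst P" "c (fst P) (snd P) = snd P" "c n (snd P) = z" "4 * D ^ 8 * avg f n z < avg f (fst P) (snd P)"
        using P(1) by (auto simp: \<P>'_def \<P>_def maximal_cells_def S_def A_def a_def)
      moreover have "x \<in> dball (fst P) (snd P)" using P(2) cell_subset_dball by blast
      ultimately show ?thesis unfolding U_def by (cases P) auto
    qed (use P in blast)
  qed
  have half: "ennreal (1 / 2) * emeasure \<mu> (\<Union>P\<in>\<P>'. cells P) \<le> ennreal (1 / 8) * emeasure \<mu> (cell n z)"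
  proof -
    have "ennreal (1 / 2) * emeasure \<mu> (\<Union>P\<in>\<P>'. cells P)
        = (\<integral>\<^sup>+P. ennreal (1 / 2) * emeasure \<mu> (cells P) \<partial>count_space \<P>')"
      using \<P>' by (simp add: emeasure_UN_cells nn_integral_cmult)
    also have "\<dots> \<le> (\<integral>\<^sup>+P. emeasure \<mu> (cells P \<inter> E) \<partial>count_space \<P>')"
      by (intro nn_integral_mono) (auto simp: \<P>'_def)
    also have "\<dots> = emeasure \<mu> (\<Union>P\<in>\<P>'. cells P \<inter> E)"
    proof (rule emeasure_UN_countable[symmetric])
      show "disjoint_family_on (\<lambda>P. cells P \<inter> E) \<P>'"
        using \<P>'(2) unfolding disjoint_family_on_def by blast
    qed (use \<P>'(1) in auto)
    also have "\<dots> \<le> emeasure \<mu> E" by (rule emeasure_mono) auto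
    finally show ?thesis using E_small by (rule order_trans)
  qed
  have measure_small: "emeasure \<mu> (\<Union>P\<in>\<P>. cells P) \<le> ennreal (1 / 2) * emeasure \<mu> (cell n z)"
  proof -
    have sets': "(\<Union>P\<in>\<P>'. cells P) \<in> sets \<mu>" by (intro sets.countable_UN'' \<P>'(1)) simp
    have two: "ennreal 2 * ennreal (1 / 2) = 1" "ennreal 2 * ennreal (1 / 8) = ennreal (1 / 4)"
      by (subst ennreal_mult[symmetric]; simp)+
    have "emeasure \<mu> (\<Union>P\<in>\<P>. cells P) \<le> emeasure \<mu> U + emeasure \<mu> (\<Union>P\<in>\<P>'. cells P)"
      by (rule order_trans[OF emeasure_mono[OF sub] emeasure_subadditive]) (use U_sets sets' in auto)
    also have "emeasure \<mu> (\<Union>P\<in>\<P>'. cells P) = ennreal 2 * (ennreal (1 / 2) * emeasure \<mu> (\<Union>P\<in>\<P>'. cells P))"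
      by (simp only: mult.assoc[symmetric] two mult_1)
    also have "emeasure \<mu> U + ennreal 2 * (ennreal (1 / 2) * emeasure \<mu> (\<Union>P\<in>\<P>'. cells P))
        \<le> ennreal (1 / 4) * emeasure \<mu> (cell n z) + ennreal 2 * (ennreal (1 / 8) * emeasure \<mu> (cell n z))"
      by (intro add_mono U_small mult_left_mono half) simp
    also have "\<dots> = (ennreal (1 / 4) + ennreal (1 / 4)) * emeasure \<mu> (cell n z)"
      by (simp only: mult.assoc[symmetric] two distrib_right)
    also have "ennreal (1 / 4) + ennreal (1 / 4) = ennreal (1 / 2)"
      by (subst ennreal_plus[symmetric]) auto
    finally show ?thesis .
  qed
  \<comment> \<open>Every smaller cell about such a point is not stopped, so \<open>E\<close>
    occupies at most half of it. Differentiation of the indicator of \<open>E\<close> then yields a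
    value at most 1/2, hence 0.\<close>
  have outside: "AE x in \<mu>. x \<in> cell n z - (\<Union>P\<in>\<P>. cells P) \<longrightarrow> \<bar>T (loc f n z) x\<bar> \<le> step_const * avg f n z"
  proof -
    have "AE x in \<mu>. (\<forall>k\<ge>Suc n. (\<integral>\<^sup>+y\<in>cell k (c k x). indicator E y \<partial>\<mu>) \<le> ennreal (1 / 2) * emeasure \<mu> (cell k (c k x)))
        \<longrightarrow> indicator E x \<le> ennreal (1 / 2)"
      by (rule AE_le_of_cell_averages_le) measurable
    then show ?thesis
    proof eventually_elim
      case (elim x)
      show ?case
      proof
        assume x: "x \<in> cell n z - (\<Union>P\<in>\<P>. cells P)"
        then have nS: "\<not> S k (c k x)" for k unfolding \<P>_def UN_maximal_cells by blast
        have "(\<integral>\<^sup>+y\<in>cell k (c k x). indicator E y \<partial>\<mu>) \<le> ennreal (1 / 2) * emeasure \<mu> (cell k (c k x))"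
          if k: "k \<ge> Suc n" for k
        proof -
          have "c n (c k x) = z" using c_ancestor[of n k x] k x by (simp add: cell_def)
          then have "emeasure \<mu> (cell k (c k x) \<inter> E) \<le> ennreal (1 / 2) * emeasure \<mu> (cell k (c k x))"
            using nS[of k] k by (auto simp: S_def)
          moreover have "(\<integral>\<^sup>+y\<in>cell k (c k x). indicator E y \<partial>\<mu>) = (\<integral>\<^sup>+y. indicator (cell k (c k x) \<inter> E) y \<partial>\<mu>)"
            by (intro nn_integral_cong) (auto simp: indicator_def)
          ultimately show ?thesis by simp
        qed
        then have "indicator E x \<le> ennreal (1 / 2)" using elim by blast
        moreover have "\<not> (1 \<le> ennreal (1 / 2))" by (subst ennreal_ge_1) simp
        ultimately have "x \<notin> E" by (auto simp: indicator_def split: if_splits)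
        then have "\<bar>T (loc f n z) x\<bar> \<le> 2 * level_const * a" by (simp add: E_def t_def)
        also have "\<dots> \<le> step_const * a" using step_const_bounds a by (intro mult_right_mono) auto
        finally show "\<bar>T (loc f n z) x\<bar> \<le> step_const * avg f n z" by (simp add: a_def)
      qed
    qed
  qed
  have inside: "AE x in \<mu>. x \<in> cells P \<longrightarrow> \<bar>T (loc f n z) x\<bar> \<le> \<bar>T (loc f (fst P) (snd P)) x\<bar> + step_const * avg f n z"
    if P: "P \<in> \<P>" for P
  proof -
    obtain k p where kp: "P = (k, p)" by (cases P)
    have cp: "c k p = p" and Sp: "n < k" "c n p = z" and max: "\<And>j. j < k \<Longrightarrow> \<not> S j (c j p)"
      using P by (auto simp: \<P>_def maximal_cells_def kp S_def)
    \<comment> \<open>The scale of the parent. By maximality neither stopping condition holds at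
      scales strictly between \<open>n\<close> and \<open>k\<close>.\<close>
    obtain j where j: "k = Suc j" "n \<le> j" using Sp(1) by (cases k) auto
    let ?q = "c j p"
    have cq: "c j ?q = ?q" "c n ?q = z" using c_ancestor[OF j(2), of p] Sp(2) by auto
    have anc: "c i ?q = c i p" if "i \<le> j" for i using c_ancestor[OF that] .
    have avg_le: "avg f i (c i p) \<le> A * a" if "n \<le> i" "i \<le> j" for i
    proof (cases "i = n")
      case True
      have "1 * a \<le> A * a" using A a by (intro mult_right_mono) auto
      then show ?thesis using Sp(2) True by (simp add: a_def)
    next
      case False
      have "c n (c i p) = z" using c_ancestor[OF that(1), of p] Sp(2) by simp
      then show ?thesis using max[of i] that False j by (auto simp: S_def)
    qed
    have "AE x in \<mu>. x \<in> cell j ?q \<longrightarrow>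
        \<bar>T (loc f n z) x - T (loc f j ?q) x\<bar> \<le> t + 2 * level_const * (A * a) + osc_const * (A * a)"
    \<comment> \<open>If the parent is the initial cell, both functions coincide. The case is
      separate because \<open>S\<close> is false at scale \<open>n\<close> by definition and carries
      no information there.\<close>
    proof (cases "j = n")
      case True
      then have "?q = z" using Sp(2) by simp
      moreover have "0 \<le> t + 2 * level_const * (A * a) + osc_const * (A * a)"
        using a A level_const_ge_1 osc_const_pos by (intro add_nonneg_nonneg) (auto simp: t_def)
      ultimately show ?thesis using True by (intro AE_I2) simp
    next
      case False
      show ?thesis
      proof (rule T_loc_diff_bound[OF f j(2) cq])
        show "avg f i (c i ?q) \<le> A * a" if "n \<le> i" "i \<le> j" for i
          using avg_le[OF that] anc[OF that(2)] by simp
        show "emeasure \<mu> (cell j ?q \<inter> {x. t < \<bar>T (loc f n z) x\<bar>}) < ennreal (1 / 2) * emeasure \<mu> (cell j ?q)"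
          using max[of j] j False cq by (auto simp: S_def E_def)
      qed
    qed
    moreover have "AE x in \<mu>. x \<in> cell (Suc j) p \<longrightarrow>
        \<bar>T (loc f j ?q) x - T (loc f (Suc j) p) x\<bar> \<le> C * 128 powr m * avg f j ?q"
      by (rule T_loc_child_bound[OF f]) (use cp j in simp)
    ultimately show ?thesis
    proof eventually_elim
      case (elim x)
      show ?case
      proof
        assume x: "x \<in> cells P"
        then have xk: "x \<in> cell (Suc j) p" using kp j by simp
        then have "x \<in> cell j ?q" using cell_mono[of "Suc j" p j] cp j by auto
        then have 1: "\<bar>T (loc f n z) x - T (loc f j ?q) x\<bar> \<le> t + 2 * level_const * (A * a) + osc_const * (A * a)"
          and 2: "\<bar>T (loc f j ?q) x - T (loc f (Suc j) p) x\<bar> \<le> C * 128 powr m * avg f j ?q"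
          using elim xk by blast+
        have 3: "C * 128 powr m * avg f j ?q \<le> C * 128 powr m * (A * a)"
          using avg_le[OF j(2) order_refl] C_pos by (intro mult_left_mono) auto
        have "\<bar>T (loc f n z) x\<bar> \<le> \<bar>T (loc f (Suc j) p) x\<bar>
            + (t + 2 * level_const * (A * a) + osc_const * (A * a) + C * 128 powr m * (A * a))"
          using 1 2 3 by linarith
        also have "t + 2 * level_const * (A * a) + osc_const * (A * a) + C * 128 powr m * (A * a) = step_const * a"
          by (simp add: step_const_def t_def A_def algebra_simps)
        finally show "\<bar>T (loc f n z) x\<bar> \<le> \<bar>T (loc f (fst P) (snd P)) x\<bar> + step_const * avg f n z"
          using kp j by (simp add: a_def)
      qed
    qed
  qed
  have "\<forall>P\<in>\<P>. n < fst P \<and> c (fst P) (snd P) = snd P \<and> c n (snd P) = z"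
    by (auto simp: \<P>_def maximal_cells_def S_def)
  then show ?thesis using \<P> measure_small outside inside by blast
qed

text \<open>The stopping construction is iterated from the cell about \<open>x0\<close>. Each
  generation fills at most half of the previous one, so almost every point leaves after finitely
  many steps and is dominated by a finite sum whose length depends on the point.\<close>

theorem T_loc_weighted_bound:
  assumes f: "f \<in> L2_space \<mu>" and w: "A2_weight \<mu> w"
  shows "(\<integral>\<^sup>+x\<in>cell 0 x0. ennreal ((T (loc f 0 x0) x)\<^sup>2) * ennreal (w x) \<partial>\<mu>)
    \<le> (ennreal sparse_const * A2_char \<mu> w)\<^sup>2 * (\<integral>\<^sup>+x. ennreal ((f x)\<^sup>2) * ennreal (w x) \<partial>\<mu>)"
proof -
  note f[measurable] loc_L2[OF f, measurable] T_L2[OF loc_L2[OF f], measurable]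
  have [measurable]: "w \<in> borel_measurable \<mu>" using w by (simp add: A2_weight_def)
  define Tf where "Tf P = T (loc f (fst P) (snd P))" for P
  define av where "av P = avg f (fst P) (snd P)" for P
  define dB where "dB P = dball (fst P) (snd P)" for P
  define stops where "stops P \<P> \<longleftrightarrow> countable \<P> \<and>
    (\<forall>Q\<in>\<P>. fst P < fst Q \<and> c (fst Q) (snd Q) = snd Q \<and> c (fst P) (snd Q) = snd P) \<and>
    disjoint_family_on cells \<P> \<and> emeasure \<mu> (\<Union>Q\<in>\<P>. cells Q) \<le> ennreal (1 / 2) * emeasure \<mu> (cells P) \<and>
    (AE x in \<mu>. x \<in> cells P - (\<Union>Q\<in>\<P>. cells Q) \<longrightarrow> \<bar>Tf P x\<bar> \<le> step_const * av P) \<and>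
    (\<forall>Q\<in>\<P>. AE x in \<mu>. x \<in> cells Q \<longrightarrow> \<bar>Tf P x\<bar> \<le> \<bar>Tf Q x\<bar> + step_const * av P)" for P \<P>
  define ch where "ch P = (SOME \<P>. stops P \<P>)" for P
  have ch: "stops P (ch P)" if "c (fst P) (snd P) = snd P" for P
    unfolding ch_def using stopping_cells[OF f that]
    by (intro someI_ex[of "stops P"]) (simp only: stops_def Tf_def av_def)
  define F where "F = rec_nat {(0, x0)} (\<lambda>_ \<Q>. \<Union>P\<in>\<Q>. ch P)"
  have F_0: "F 0 = {(0, x0)}" and F_Suc: "F (Suc i) = (\<Union>P\<in>F i. ch P)" for i
    by (simp_all add: F_def)
  have F_valid: "c (fst P) (snd P) = snd P" if "P \<in> F i" for P i
    using that
  proof (induction i arbitrary: P)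
    case 0
    then show ?case using c_top[of x0] s_pos by (simp add: F_0)
  next
    case (Suc i)
    then obtain Q where "Q \<in> F i" "P \<in> ch Q" by (auto simp: F_Suc)
    then show ?case using ch[of Q] Suc.IH unfolding stops_def by blast
  qed
  have F_ch: "stops P (ch P)" if "P \<in> F i" for P i by (rule ch[OF F_valid[OF that]])
  define V where "V P = (\<Union>Q\<in>ch P. cells Q)" for P
  have ch_sub: "cells Q \<subseteq> cells P" if "P \<in> F i" "Q \<in> ch P" for P Q i
  proof -
    have "fst P < fst Q" "c (fst Q) (snd Q) = snd Q" "c (fst P) (snd Q) = snd P"
      using F_ch[OF that(1)] that(2) unfolding stops_def by blast+
    then show ?thesis using cell_mono[of "fst Q" "snd Q" "fst P"] by simp
  qed
  then have V_sub: "V P \<subseteq> cells P" if "P \<in> F i" for P i using that unfolding V_def by blast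
  have V_sets: "V P \<in> sets \<mu>" if "P \<in> F i" for P i
    unfolding V_def using F_ch[OF that] by (intro sets.countable_UN'') (auto simp: stops_def)
  have F_count: "countable (F i)" for i
  proof (induction i)
    case (Suc i)
    then show ?case unfolding F_Suc using F_ch by (intro countable_UN) (auto simp: stops_def)
  qed (simp add: F_0)
  have F_disj: "disjoint_family_on cells (F i)" for i
  proof (induction i)
    case (Suc i)
    show ?case unfolding disjoint_family_on_def
    proof (intro ballI impI)
      fix P P' assume "P \<in> F (Suc i)" "P' \<in> F (Suc i)" and ne: "P \<noteq> P'"
      then obtain Q Q' where Q: "Q \<in> F i" "P \<in> ch Q" "Q' \<in> F i" "P' \<in> ch Q'" by (auto simp: F_Suc)
      show "cells P \<inter> cells P' = {}"
      proof (cases "Q = Q'")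
        case True
        then show ?thesis using F_ch[OF Q(1)] Q ne unfolding stops_def disjoint_family_on_def by blast
      next
        case False
        then have "cells Q \<inter> cells Q' = {}" using Suc Q unfolding disjoint_family_on_def by blast
        then show ?thesis using ch_sub[OF Q(1,2)] ch_sub[OF Q(3,4)] by blast
      qed
    qed
  qed (simp add: F_0 disjoint_family_on_def)
  define U where "U i = (\<Union>P\<in>F i. cells P)" for i
  have U_sets: "U i \<in> sets \<mu>" for i unfolding U_def by (intro sets.countable_UN'' F_count) simp
  have U_Suc: "U (Suc i) = (\<Union>P\<in>F i. V P)" for i by (auto simp: U_def F_Suc V_def)
  have U_dec: "U j \<subseteq> U i" if "i \<le> j" for i j
    using that
  proof (induction j rule: dec_induct)
    case (step j)
    have "U (Suc j) \<subseteq> U j" unfolding U_Suc unfolding U_def using V_sub by blast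
    then show ?case using step.IH by blast
  qed simp
  have U_small: "emeasure \<mu> (U i) \<le> ennreal ((1 / 2) ^ i) * emeasure \<mu> (cell 0 x0)" for i
  proof (induction i)
    case (Suc i)
    have "emeasure \<mu> (U (Suc i)) = (\<integral>\<^sup>+P. emeasure \<mu> (V P) \<partial>count_space (F i))"
      unfolding U_Suc
    proof (rule emeasure_UN_countable)
      show "disjoint_family_on V (F i)"
        using F_disj[of i] V_sub[of _ i] unfolding disjoint_family_on_def by blast
    qed (use F_count V_sets in auto)
    also have "\<dots> \<le> (\<integral>\<^sup>+P. ennreal (1 / 2) * emeasure \<mu> (cells P) \<partial>count_space (F i))"
      using F_ch by (intro nn_integral_mono) (auto simp: stops_def V_def)
    also have "\<dots> = ennreal (1 / 2) * emeasure \<mu> (U i)"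
      unfolding U_def using F_count F_disj by (simp add: emeasure_UN_cells nn_integral_cmult)
    also have "\<dots> \<le> ennreal (1 / 2) * (ennreal ((1 / 2) ^ i) * emeasure \<mu> (cell 0 x0))"
      by (intro mult_left_mono Suc) simp
    also have "\<dots> = ennreal ((1 / 2) ^ Suc i) * emeasure \<mu> (cell 0 x0)"
    proof -
      have "ennreal ((1 / 2) ^ Suc i) = ennreal (1 / 2) * ennreal ((1 / 2) ^ i)"
        unfolding power_Suc by (rule ennreal_mult) auto
      then show ?thesis by (simp only: mult.assoc)
    qed
    finally show ?case .
  qed (simp add: U_def F_0)
  have AE_terminates: "AE x in \<mu>. \<exists>i. x \<notin> U i"
  proof -
    define b where "b = measure \<mu> (cell 0 x0)"
    have b: "emeasure \<mu> (cell 0 x0) = ennreal b"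
      using emeasure_cell_finite[of 0 x0] by (simp add: b_def emeasure_eq_ennreal_measure)
    have "emeasure \<mu> (\<Inter>i. U i) \<le> ennreal ((1 / 2) ^ i * b)" for i
    proof -
      have "emeasure \<mu> (\<Inter>i. U i) \<le> emeasure \<mu> (U i)" by (rule emeasure_mono) (use U_sets in auto)
      also have "\<dots> \<le> ennreal ((1 / 2) ^ i) * ennreal b" using U_small[of i] by (simp add: b)
      also have "\<dots> = ennreal ((1 / 2) ^ i * b)" by (rule ennreal_mult[symmetric]) (auto simp: b_def)
      finally show ?thesis .
    qed
    moreover have "(\<lambda>i. ennreal ((1 / 2) ^ i * b)) \<longlonglongrightarrow> ennreal (0 * b)"
      by (intro tendsto_ennrealI tendsto_mult tendsto_const LIMSEQ_power_zero) simp
    ultimately have "emeasure \<mu> (\<Inter>i. U i) \<le> ennreal (0 * b)"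
      by (intro LIMSEQ_le_const) auto
    then have "(\<Inter>i. U i) \<in> null_sets \<mu>"
      using U_sets by (auto simp: null_sets_def)
    from AE_not_in[OF this] show ?thesis by eventually_elim auto
  qed
  define J where "J = (SIGMA i:UNIV. F i)"
  have J_count: "countable J" unfolding J_def by (intro countable_SIGMA F_count) simp
  define S where "S G x = (\<Sum>j\<in>G. av (snd j) * indicator (dB (snd j)) x)"
    for G :: "(nat \<times> nat \<times> 'a) set" and x
  have S_mono: "S G x \<le> S G' x" if "G \<subseteq> G'" "finite G'" for G G' x
    unfolding S_def using that by (intro sum_mono2) (auto simp: av_def avg_nonneg)
  have step_AE: "AE x in \<mu>. \<forall>i. \<forall>P\<in>F i. (x \<in> cells P - V P \<longrightarrow> \<bar>Tf P x\<bar> \<le> step_const * av P) \<and>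
      (\<forall>Q\<in>ch P. x \<in> cells Q \<longrightarrow> \<bar>Tf P x\<bar> \<le> \<bar>Tf Q x\<bar> + step_const * av P)"
    unfolding AE_all_countable
  proof (intro allI, subst AE_ball_countable[OF F_count], intro ballI AE_conjI)
    fix i P assume P: "P \<in> F i"
    show "AE x in \<mu>. x \<in> cells P - V P \<longrightarrow> \<bar>Tf P x\<bar> \<le> step_const * av P"
      using F_ch[OF P] unfolding stops_def V_def by blast
    have "countable (ch P)" using F_ch[OF P] unfolding stops_def by blast
    then show "AE x in \<mu>. \<forall>Q\<in>ch P. x \<in> cells Q \<longrightarrow> \<bar>Tf P x\<bar> \<le> \<bar>Tf Q x\<bar> + step_const * av P"
      using F_ch[OF P] unfolding stops_def by (subst AE_ball_countable) blast+
  qed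
  have chain: "AE x in \<mu>. x \<in> cell 0 x0 \<longrightarrow> (\<exists>G\<subseteq>J. finite G \<and> \<bar>T (loc f 0 x0) x\<bar> \<le> step_const * S G x)"
    using step_AE AE_terminates
  proof eventually_elim
    case (elim x)
    \<comment> \<open>Induction on the number of generations left before \<open>x\<close> leaves.
      Requiring generations at least \<open>i\<close> in \<open>G\<close> ensures that the new pair
      is not already there when its average is added.\<close>
    have "\<exists>G\<subseteq>J. finite G \<and> (\<forall>j\<in>G. i \<le> fst j) \<and> \<bar>Tf P x\<bar> \<le> step_const * S G x"
      if "P \<in> F i" "x \<in> cells P" "x \<notin> U (i + d)" for i d P
      using that
    proof (induction d arbitrary: i P)
      case 0
      then show ?case by (auto simp: U_def)
    next
      case (Suc d)
      have xB: "x \<in> dB P" using Suc.prems(2) cell_subset_dball unfolding dB_def by blast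
      show ?case
      proof (cases "x \<in> V P")
        case False
        then have "\<bar>Tf P x\<bar> \<le> step_const * av P" using elim(1) Suc.prems by blast
        then show ?thesis using Suc.prems(1) xB
          by (intro exI[of _ "{(i, P)}"]) (auto simp: S_def J_def)
      next
        case True
        then obtain Q where Q: "Q \<in> ch P" "x \<in> cells Q" unfolding V_def by blast
        have "Q \<in> F (Suc i)" using Q(1) Suc.prems(1) by (auto simp: F_Suc)
        then obtain G where G: "G \<subseteq> J" "finite G" "\<forall>j\<in>G. Suc i \<le> fst j" "\<bar>Tf Q x\<bar> \<le> step_const * S G x"
          using Suc.IH[of Q "Suc i"] Q(2) Suc.prems(3) by auto
        have "(i, P) \<notin> G" using G(3) by force
        then have SG: "S (insert (i, P) G) x = av P + S G x"
          unfolding S_def using G(2) xB by (subst sum.insert) simp_all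
        have "\<bar>Tf P x\<bar> \<le> \<bar>Tf Q x\<bar> + step_const * av P" using elim(1) Suc.prems(1) Q by blast
        then have "\<bar>Tf P x\<bar> \<le> step_const * S (insert (i, P) G) x"
          using G(4) unfolding SG by (simp add: distrib_left)
        moreover have "insert (i, P) G \<subseteq> J" "\<forall>j\<in>insert (i, P) G. i \<le> fst j"
          using G(1,3) Suc.prems(1) by (auto simp: J_def)
        ultimately show ?thesis using G(2) by (intro exI[of _ "insert (i, P) G"]) auto
      qed
    qed
    note * = this
    obtain d where "x \<notin> U d" using elim(2) by blast
    then show ?case using *[of "(0, x0)" 0 d] by (auto simp: F_0 Tf_def)
  qed
  \<comment> \<open>The part of a cell not covered by its stopping children. It has at least half
    the measure of the cell, and it is disjoint from all later generations because these lie inside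
    the children.\<close>
  define EE where "EE j = cells (snd j) - V (snd j)" for j :: "nat \<times> nat \<times> 'a"
  have EE_sets: "EE j \<in> sets \<mu>" if "j \<in> J" for j
    unfolding EE_def using V_sets that by (auto simp: J_def)
  have EE_disj: "disjoint_family_on EE J"
  proof -
    have False if "P \<in> F i" "Q \<in> F j" "i < j" "x \<in> cells P - V P" "x \<in> cells Q" for i j P Q x
    proof -
      have "x \<in> U (Suc i)" using that U_dec[of "Suc i" j] by (auto simp: U_def)
      then obtain R where R: "R \<in> F i" "x \<in> V R" unfolding U_Suc by blast
      then have "x \<in> cells R" using V_sub by blast
      then have "R = P" using F_disj[of i] R(1) that unfolding disjoint_family_on_def by blast
      then show False using R(2) that by blast
    qed
    note less = this
    show ?thesis unfolding disjoint_family_on_def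
    proof (intro ballI impI)
      fix j j' assume j: "j \<in> J" "j' \<in> J" "j \<noteq> j'"
      show "EE j \<inter> EE j' = {}"
      proof (rule ccontr)
        assume "EE j \<inter> EE j' \<noteq> {}"
        then obtain x where x: "x \<in> EE j" "x \<in> EE j'" by blast
        have in_F: "snd j \<in> F (fst j)" "snd j' \<in> F (fst j')" using j by (auto simp: J_def)
        have "fst j = fst j'"
          using less[OF in_F, of x] less[OF in_F(2,1), of x] x by (force simp: EE_def)
        then have "snd j \<noteq> snd j'" using j(3) by (simp add: prod_eq_iff)
        then show False using F_disj[of "fst j"] in_F \<open>fst j = fst j'\<close> x
          unfolding disjoint_family_on_def EE_def by auto
      qed
    qed
  qed
  have EE_large: "emeasure \<mu> (dB (snd j)) \<le> ennreal (2 * D ^ 6) * emeasure \<mu> (EE j)" if j: "j \<in> J" for j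
  proof -
    let ?P = "snd j"
    have P: "?P \<in> F (fst j)" using j by (auto simp: J_def)
    define b where "b = measure \<mu> (cells ?P)"
    have b: "emeasure \<mu> (cells ?P) = ennreal b"
      using emeasure_cell_finite by (simp add: b_def emeasure_eq_ennreal_measure less_top)
    have "emeasure \<mu> (V ?P) \<le> ennreal (1 / 2) * ennreal b"
      using F_ch[OF P] unfolding stops_def V_def b[symmetric] by blast
    also have "\<dots> = ennreal (b / 2)" by (subst ennreal_mult[symmetric]) (auto simp: b_def)
    finally have Vb: "emeasure \<mu> (V ?P) \<le> ennreal (b / 2)" .
    have "emeasure \<mu> (EE j) = ennreal b - emeasure \<mu> (V ?P)"
      unfolding EE_def b[symmetric]
      by (rule emeasure_Diff) (use Vb V_sub[OF P] V_sets[OF P] in \<open>auto simp: top_unique\<close>)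
    also have "\<dots> \<ge> ennreal b - ennreal (b / 2)" by (rule ennreal_minus_mono[OF order_refl Vb])
    also (xtrans) have "ennreal b - ennreal (b / 2) = ennreal (b / 2)"
      by (subst ennreal_minus) (auto simp: b_def)
    finally have E_ge: "ennreal (b / 2) \<le> emeasure \<mu> (EE j)" .
    have "emeasure \<mu> (dB ?P) \<le> ennreal (D ^ 6) * ennreal b"
      using emeasure_dball_le_cell[OF F_valid[OF P]] by (simp add: dB_def b)
    also have "\<dots> = ennreal (2 * D ^ 6) * ennreal (b / 2)"
      using D_ge_1 by (subst (1 2) ennreal_mult[symmetric]) (auto simp: b_def)
    also have "\<dots> \<le> ennreal (2 * D ^ 6) * emeasure \<mu> (EE j)" by (intro mult_left_mono E_ge) simp
    finally show ?thesis .
  qed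
  define A where "A = A2_char \<mu> w"
  define W where "W = (\<integral>\<^sup>+x. ennreal ((f x)\<^sup>2) * ennreal (w x) \<partial>\<mu>)"
  have S_bound: "(\<integral>\<^sup>+x. ennreal ((step_const * S G x)\<^sup>2) * ennreal (w x) \<partial>\<mu>) \<le> (ennreal sparse_const * A)\<^sup>2 * W"
    if G: "G \<subseteq> J" "finite G" for G
  proof -
    have S_nonneg: "S G x \<ge> 0" for x unfolding S_def by (intro sum_nonneg) (auto simp: av_def avg_nonneg)
    have av_eq: "(\<integral>\<^sup>+y\<in>dB P. ennreal \<bar>f y\<bar> \<partial>\<mu>) / emeasure \<mu> (dB P) = ennreal (av P)" for P
    proof -
      have "0 < emeasure \<mu> (dB P)" "emeasure \<mu> (dB P) < \<infinity>"
        using measure_dball_pos[of "fst P" "snd P"] emeasure_dball[of "fst P" "snd P"] by (auto simp: dB_def)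
      then show ?thesis
        unfolding dB_def av_def nn_integral_dball[OF f] by (intro ennreal_mult_divide_eq) auto
    qed
    have S_eq: "ennreal (S G x) = (\<Sum>j\<in>G. (\<integral>\<^sup>+y\<in>dB (snd j). ennreal \<bar>f y\<bar> \<partial>\<mu>) / emeasure \<mu> (dB (snd j))
        * indicator (dB (snd j)) x)" for x
    proof -
      have "ennreal (S G x) = (\<Sum>j\<in>G. ennreal (av (snd j) * indicator (dB (snd j)) x))"
        unfolding S_def by (rule sum_ennreal[symmetric]) (simp add: av_def avg_nonneg)
      also have "\<dots> = (\<Sum>j\<in>G. ennreal (av (snd j)) * indicator (dB (snd j)) x)"
        by (intro sum.cong) (auto simp: indicator_def)
      finally show ?thesis by (simp only: av_eq)
    qed
    have sparse: "(\<integral>\<^sup>+x. (ennreal (S G x))\<^sup>2 * ennreal (w x) \<partial>\<mu>)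
        \<le> (8 * ennreal (D ^ 4) * ennreal (2 * D ^ 6) * A2_char \<mu> w)\<^sup>2 * (\<integral>\<^sup>+x. ennreal ((f x)\<^sup>2) * ennreal (w x) \<partial>\<mu>)"
      unfolding S_eq unfolding dB_def dball_def
    proof (rule sparse_operator_weighted_bound[OF w G(2), where E = EE])
      fix j assume "j \<in> G"
      then have j: "j \<in> J" using G(1) by blast
      show "EE j \<in> sets \<mu>" by (rule EE_sets[OF j])
      show "EE j \<subseteq> ball (snd (snd j)) (16 * r (fst (snd j)))"
        using cell_subset_dball[of "fst (snd j)" "snd (snd j)"] by (auto simp: EE_def dball_def)
      show "emeasure \<mu> (ball (snd (snd j)) (16 * r (fst (snd j)))) \<le> ennreal (2 * D ^ 6) * emeasure \<mu> (EE j)"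
        using EE_large[OF j] by (simp add: dB_def dball_def)
      show "(\<integral>\<^sup>+y\<in>ball (snd (snd j)) (16 * r (fst (snd j))). ennreal \<bar>f y\<bar> \<partial>\<mu>) < \<infinity>"
        using nn_integral_dball[OF f, of "fst (snd j)" "snd (snd j)"] emeasure_ball_finite
        by (simp add: dball_def ennreal_mult_less_top)
    qed (use EE_disj G(1) in \<open>auto intro: disjoint_family_on_mono\<close>)
    have "(\<integral>\<^sup>+x. ennreal ((step_const * S G x)\<^sup>2) * ennreal (w x) \<partial>\<mu>)
        = (\<integral>\<^sup>+x. (ennreal step_const)\<^sup>2 * ((ennreal (S G x))\<^sup>2 * ennreal (w x)) \<partial>\<mu>)"
    proof (rule nn_integral_cong)
      fix x
      have "ennreal ((step_const * S G x)\<^sup>2) = (ennreal (step_const * S G x))\<^sup>2"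
        using step_const_bounds S_nonneg by (simp add: ennreal_power)
      also have "\<dots> = (ennreal step_const)\<^sup>2 * (ennreal (S G x))\<^sup>2"
        using step_const_bounds S_nonneg by (simp add: ennreal_mult power_mult_distrib)
      finally show "ennreal ((step_const * S G x)\<^sup>2) * ennreal (w x)
          = (ennreal step_const)\<^sup>2 * ((ennreal (S G x))\<^sup>2 * ennreal (w x))"
        by (simp only: mult.assoc)
    qed
    also have "\<dots> = (ennreal step_const)\<^sup>2 * (\<integral>\<^sup>+x. (ennreal (S G x))\<^sup>2 * ennreal (w x) \<partial>\<mu>)"
      unfolding S_def dB_def by (rule nn_integral_cmult) measurable
    also have "\<dots> \<le> (ennreal step_const)\<^sup>2 * ((8 * ennreal (D ^ 4) * ennreal (2 * D ^ 6) * A)\<^sup>2 * W)"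
      unfolding A_def W_def by (intro mult_left_mono sparse) simp
    also have "\<dots> = (ennreal step_const * (8 * ennreal (D ^ 4) * ennreal (2 * D ^ 6)) * A)\<^sup>2 * W"
      by (simp only: power_mult_distrib mult.assoc)
    also have "ennreal step_const * (8 * ennreal (D ^ 4) * ennreal (2 * D ^ 6)) = ennreal sparse_const"
    proof -
      have "8 * ennreal (D ^ 4) * ennreal (2 * D ^ 6) = ennreal 8 * ennreal (D ^ 4) * ennreal (2 * D ^ 6)" by simp
      also have "\<dots> = ennreal (8 * D ^ 4 * (2 * D ^ 6))"
        using D_ge_1 by (subst ennreal_mult[symmetric], simp, simp)+ simp
      finally show ?thesis
        unfolding sparse_const_def using step_const_bounds D_ge_1 by (subst ennreal_mult) auto
    qed
    finally show ?thesis .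
  qed
  \<comment> \<open>The sparse bound is for finite families, while the chain varies with the point.
    An increasing exhaustion of the countable index set absorbs every chain, and monotone
    convergence takes the bound to the limit.\<close>
  define G where "G n = {j \<in> J. to_nat_on J j < n}" for n
  have G: "finite (G n)" "G n \<subseteq> J" for n
    unfolding G_def using finite_initial_segment[OF J_count] by auto
  have absorb: "\<exists>n. H \<subseteq> G n" if "finite H" "H \<subseteq> J" for H
  proof -
    have "H \<subseteq> G (Suc (Max (to_nat_on J ` H)))"
      using that by (auto simp: G_def less_Suc_eq_le)
    then show ?thesis by blast
  qed
  have [measurable]: "S (G n) \<in> borel_measurable \<mu>" for n
    unfolding S_def[abs_def] dB_def by measurable
  have "(\<integral>\<^sup>+x\<in>cell 0 x0. ennreal ((T (loc f 0 x0) x)\<^sup>2) * ennreal (w x) \<partial>\<mu>)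
      \<le> (\<integral>\<^sup>+x. (SUP n. ennreal ((step_const * S (G n) x)\<^sup>2) * ennreal (w x)) \<partial>\<mu>)"
  proof (rule nn_integral_mono_AE)
    show "AE x in \<mu>. ennreal ((T (loc f 0 x0) x)\<^sup>2) * ennreal (w x) * indicator (cell 0 x0) x
        \<le> (SUP n. ennreal ((step_const * S (G n) x)\<^sup>2) * ennreal (w x))"
      using chain
    proof eventually_elim
      case (elim x)
      show ?case
      proof (cases "x \<in> cell 0 x0")
        case True
        then obtain H where H: "H \<subseteq> J" "finite H" "\<bar>T (loc f 0 x0) x\<bar> \<le> step_const * S H x"
          using elim by blast
        obtain n where n: "H \<subseteq> G n" using absorb[OF H(2,1)] by blast
        have "step_const * S H x \<le> step_const * S (G n) x"
          using step_const_bounds by (intro mult_left_mono S_mono n G) auto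
        then have "\<bar>T (loc f 0 x0) x\<bar> \<le> \<bar>step_const * S (G n) x\<bar>" using H(3) by linarith
        then have "(T (loc f 0 x0) x)\<^sup>2 \<le> (step_const * S (G n) x)\<^sup>2" by (simp add: abs_le_square_iff)
        then have "ennreal ((T (loc f 0 x0) x)\<^sup>2) * ennreal (w x) \<le> ennreal ((step_const * S (G n) x)\<^sup>2) * ennreal (w x)"
          by (intro mult_right_mono ennreal_leI) auto
        also have "\<dots> \<le> (SUP n. ennreal ((step_const * S (G n) x)\<^sup>2) * ennreal (w x))"
          by (rule SUP_upper) simp
        finally show ?thesis using True by simp
      qed simp
    qed
  qed
  also have "\<dots> = (SUP n. \<integral>\<^sup>+x. ennreal ((step_const * S (G n) x)\<^sup>2) * ennreal (w x) \<partial>\<mu>)"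
  proof (rule nn_integral_monotone_convergence_SUP)
    show "incseq (\<lambda>n x. ennreal ((step_const * S (G n) x)\<^sup>2) * ennreal (w x))"
    proof (intro monoI le_funI mult_right_mono ennreal_leI power_mono mult_left_mono S_mono)
      show "G n \<subseteq> G n'" if "n \<le> n'" for n n' using that by (auto simp: G_def)
      show "0 \<le> step_const * S (G n) x" for n x
        using step_const_bounds unfolding S_def
        by (intro mult_nonneg_nonneg sum_nonneg) (auto simp: av_def avg_nonneg)
    qed (use step_const_bounds G in auto)
  qed measurable
  also have "\<dots> \<le> (ennreal sparse_const * A)\<^sup>2 * W"
    by (intro SUP_least S_bound G)
  finally show ?thesis unfolding A_def W_def .
qed

end

section \<open>Exhaustion of the space by balls\<close>

context CZ_setting
begin

text \<open>With coarsest scale n + 1 the localised function is \<open>f\<close> cut off at radius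
  \<open>16 * (n + 1)\<close>, and the bound holds on the ball of radius \<open>(n + 1) / 4\<close>
  with the same constant for all n. The cut-offs converge to \<open>f\<close> in the unweighted
  space, so the images converge almost everywhere along a subsequence, and Fatou's lemma transfers
  the weighted bound.\<close>

theorem T_weighted_bound:
  assumes f: "f \<in> L2_space \<mu>" and w: "A2_weight \<mu> w"
  shows "(\<integral>\<^sup>+x. ennreal ((T f x)\<^sup>2) * ennreal (w x) \<partial>\<mu>)
    \<le> (ennreal sparse_const * A2_char \<mu> w)\<^sup>2 * (\<integral>\<^sup>+x. ennreal ((f x)\<^sup>2) * ennreal (w x) \<partial>\<mu>)"
proof -
  fix x0 :: 'a
  have [measurable]: "w \<in> borel_measurable \<mu>" using w by (simp add: A2_weight_def)
  define g where "g n y = f y * indicator (ball x0 (16 * real (Suc n))) y" for n y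
  have g_L2: "g n \<in> L2_space \<mu>" for n
    unfolding g_def[abs_def] by (rule L2_space_indicator[OF f]) simp
  note f[measurable] g_L2[measurable] T_L2[OF f, measurable] T_L2[OF g_L2, measurable]
  define B where "B = (ennreal sparse_const * A2_char \<mu> w)\<^sup>2 * (\<integral>\<^sup>+x. ennreal ((f x)\<^sup>2) * ennreal (w x) \<partial>\<mu>)"
  have local_bound: "(\<integral>\<^sup>+x\<in>ball x0 (real (Suc n) / 4). ennreal ((T (g n) x)\<^sup>2) * ennreal (w x) \<partial>\<mu>) \<le> B" for n
  proof -
    obtain c where c: "dyadic_system x0 (real (Suc n)) c"
      using dyadic_system_exists[OF geometrically_doubling, of "real (Suc n)" x0] by auto
    interpret CZ_dyadic \<mu> D m C \<epsilon> N K T x0 "real (Suc n)" c by unfold_locales (rule c)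
    have "loc f 0 x0 = g n" unfolding loc_def g_def dball_def r_def fun_eq_iff by simp
    then have "(\<integral>\<^sup>+x\<in>cell 0 x0. ennreal ((T (g n) x)\<^sup>2) * ennreal (w x) \<partial>\<mu>) \<le> B"
      using T_loc_weighted_bound[OF f w] by (simp add: B_def)
    moreover have "ball x0 (real (Suc n) / 4) \<subseteq> cell 0 x0"
      using c_top by (auto simp: cell_def dist_commute)
    then have "(\<integral>\<^sup>+x\<in>ball x0 (real (Suc n) / 4). ennreal ((T (g n) x)\<^sup>2) * ennreal (w x) \<partial>\<mu>)
        \<le> (\<integral>\<^sup>+x\<in>cell 0 x0. ennreal ((T (g n) x)\<^sup>2) * ennreal (w x) \<partial>\<mu>)"
      by (intro nn_integral_mono) (auto simp: indicator_def)
    ultimately show ?thesis by (rule order_trans[rotated])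
  qed
  define u where "u n x = (T (g n) x - T f x)\<^sup>2" for n x
  have u_L1: "integrable \<mu> (u n)" for n
    using L2_space_diff[OF T_L2[OF g_L2] T_L2[OF f], of n] by (simp add: u_def[abs_def] L2_space_def)
  have u_lim: "(\<lambda>n. \<integral>\<^sup>+x. ennreal (u n x) \<partial>\<mu>) \<longlonglongrightarrow> 0"
  proof -
    define M where "M = density \<mu> (\<lambda>y. ennreal ((f y)\<^sup>2))"
    define R where "R n = - ball x0 (16 * real (Suc n))" for n
    have R_sets: "R n \<in> sets \<mu>" for n by (simp add: R_def sets_\<mu>)
    have eM: "emeasure M (R n) = (\<integral>\<^sup>+y. ennreal ((g n y - f y)\<^sup>2) \<partial>\<mu>)" for n
    proof -
      have "emeasure M (R n) = (\<integral>\<^sup>+y. ennreal ((f y)\<^sup>2) * indicator (R n) y \<partial>\<mu>)"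
        unfolding M_def using R_sets by (simp add: emeasure_density)
      also have "\<dots> = (\<integral>\<^sup>+y. ennreal ((g n y - f y)\<^sup>2) \<partial>\<mu>)"
        by (intro nn_integral_cong) (auto simp: g_def R_def indicator_def)
      finally show ?thesis .
    qed
    have "(\<lambda>n. emeasure M (R n)) \<longlonglongrightarrow> emeasure M (\<Inter>n. R n)"
    proof (rule Lim_emeasure_decseq)
      show "range R \<subseteq> sets M" using R_sets by (auto simp: M_def)
      show "decseq R" unfolding decseq_def R_def by auto
      show "emeasure M (R n) \<noteq> \<infinity>" for n
        unfolding eM using L2_space_diff[OF g_L2 f, of n] by (auto simp: L2_space_iff)
    qed
    moreover have "(\<Inter>n. R n) = {}"
    proof -
      have "\<exists>n. x \<in> ball x0 (16 * real (Suc n))" for x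
      proof -
        obtain n where "dist x0 x < real n" using reals_Archimedean2 by blast
        then show ?thesis by (intro exI[of _ n]) auto
      qed
      then show ?thesis unfolding R_def by blast
    qed
    ultimately have "(\<lambda>n. emeasure M (R n)) \<longlonglongrightarrow> 0" by simp
    then have lim: "(\<lambda>n. ennreal (N\<^sup>2) * emeasure M (R n)) \<longlonglongrightarrow> ennreal (N\<^sup>2) * 0"
      by (intro tendsto_mult_ennreal tendsto_const) auto
    have le: "(\<integral>\<^sup>+x. ennreal (u n x) \<partial>\<mu>) \<le> ennreal (N\<^sup>2) * emeasure M (R n)" for n
    proof -
      have "(\<integral>\<^sup>+x. ennreal (u n x) \<partial>\<mu>) = (\<integral>\<^sup>+x. ennreal ((T (\<lambda>y. g n y - f y) x)\<^sup>2) \<partial>\<mu>)"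
        using T_diff[OF g_L2 f, of n] by (intro nn_integral_cong_AE, eventually_elim) (simp add: u_def)
      also have "\<dots> \<le> ennreal (N\<^sup>2) * emeasure M (R n)"
        unfolding eM by (rule T_nn_bound[OF L2_space_diff[OF g_L2 f]])
      finally show ?thesis .
    qed
    show ?thesis
      by (rule tendsto_sandwich[OF _ _ tendsto_const lim[simplified]]) (use le in auto)
  qed
  have "(\<integral>\<^sup>+x. ennreal (u n x) \<partial>\<mu>) = ennreal (\<integral>x. norm (u n x) \<partial>\<mu>)" for n
  proof -
    have "norm (u n x) = u n x" for x by (simp add: u_def)
    moreover have "(\<integral>\<^sup>+x. ennreal (u n x) \<partial>\<mu>) = ennreal (\<integral>x. u n x \<partial>\<mu>)"
      by (rule nn_integral_eq_integral[OF u_L1]) (simp add: u_def)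
    ultimately show ?thesis by (simp only:)
  qed
  then have "(\<lambda>n. ennreal (\<integral>x. norm (u n x) \<partial>\<mu>)) \<longlonglongrightarrow> ennreal 0"
    using u_lim by simp
  then have "(\<lambda>n. \<integral>x. norm (u n x) \<partial>\<mu>) \<longlonglongrightarrow> 0"
    by (subst (asm) tendsto_ennreal_iff) auto
  from tendsto_L1_AE_subseq[OF u_L1 this] obtain r where
    r: "strict_mono r" "AE x in \<mu>. (\<lambda>n. u (r n) x) \<longlonglongrightarrow> 0" by blast
  \<comment> \<open>The balls exhaust the space, so at each point the indicator is eventually 1 and
    leaves the limit unchanged.\<close>
  define h where "h n x = ennreal ((T (g (r n)) x)\<^sup>2) * ennreal (w x) * indicator (ball x0 (real (Suc (r n)) / 4)) x" for n x
  have "AE x in \<mu>. ennreal ((T f x)\<^sup>2) * ennreal (w x) = liminf (\<lambda>n. h n x)"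
    using r(2)
  proof eventually_elim
    case (elim x)
    have "(\<lambda>n. sqrt (u (r n) x)) \<longlonglongrightarrow> sqrt 0" by (intro tendsto_real_sqrt elim)
    then have "(\<lambda>n. \<bar>T (g (r n)) x - T f x\<bar>) \<longlonglongrightarrow> 0" by (simp add: u_def)
    then have "(\<lambda>n. T (g (r n)) x - T f x) \<longlonglongrightarrow> 0" by (simp add: tendsto_rabs_zero_iff)
    then have "(\<lambda>n. T (g (r n)) x) \<longlonglongrightarrow> T f x" by (simp add: LIM_zero_iff)
    then have "(\<lambda>n. ennreal ((T (g (r n)) x)\<^sup>2 * w x)) \<longlonglongrightarrow> ennreal ((T f x)\<^sup>2 * w x)"
      by (intro tendsto_ennrealI tendsto_mult tendsto_power tendsto_const)
    moreover have "\<forall>\<^sub>F n in sequentially. ennreal ((T (g (r n)) x)\<^sup>2 * w x) = h n x"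
    proof -
      obtain k where k: "4 * dist x0 x < real k" using reals_Archimedean2 by blast
      show ?thesis
      proof (rule eventually_sequentiallyI)
        fix n assume "k \<le> n"
        then have "k \<le> r n" using seq_suble[OF r(1), of n] by simp
        then have "4 * dist x0 x < real (Suc (r n))" using k by simp
        then show "ennreal ((T (g (r n)) x)\<^sup>2 * w x) = h n x" by (simp add: h_def ennreal_mult')
      qed
    qed
    ultimately have "(\<lambda>n. h n x) \<longlonglongrightarrow> ennreal ((T f x)\<^sup>2 * w x)"
      by (rule Lim_transform_eventually)
    then have "liminf (\<lambda>n. h n x) = ennreal ((T f x)\<^sup>2 * w x)" by (rule lim_imp_Liminf[rotated]) simp
    then show ?case by (simp add: ennreal_mult')
  qed
  then have "(\<integral>\<^sup>+x. ennreal ((T f x)\<^sup>2) * ennreal (w x) \<partial>\<mu>) = (\<integral>\<^sup>+x. liminf (\<lambda>n. h n x) \<partial>\<mu>)"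
    by (rule nn_integral_cong_AE)
  also have "\<dots> \<le> liminf (\<lambda>n. \<integral>\<^sup>+x. h n x \<partial>\<mu>)"
    by (rule nn_integral_liminf) (unfold h_def, measurable)
  also have "\<dots> \<le> B"
  proof -
    have "(\<integral>\<^sup>+x. h n x \<partial>\<mu>) \<le> B" for n unfolding h_def by (rule local_bound)
    then have "liminf (\<lambda>n. \<integral>\<^sup>+x. h n x \<partial>\<mu>) \<le> liminf (\<lambda>n::nat. B)"
      by (intro Liminf_mono always_eventually) auto
    then show ?thesis by (simp add: Liminf_const)
  qed
  finally show ?thesis unfolding B_def .
qed

end

section \<open>From integrals to norms\<close>

lemma nn_integral_square_weighted:
  assumes "w \<in> borel_measurable M" "g \<in> borel_measurable M"
  shows "(\<integral>\<^sup>+x. ennreal ((g x)\<^sup>2) \<partial>weighted M w) = (\<integral>\<^sup>+x. ennreal ((g x)\<^sup>2) * ennreal (w x) \<partial>M)"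
  using assms by (subst nn_integral_density) (auto simp: mult.commute)

theorem theorem7p1:
  fixes \<mu> :: "'a::metric_space measure"
    and m C :: real
    and K :: "'a \<Rightarrow> 'a \<Rightarrow> real"
    and T :: "('a \<Rightarrow> real) \<Rightarrow> 'a \<Rightarrow> real"
  assumes "geometrically_doubling (UNIV :: 'a set)"
    and "m > 0"
    and "sets \<mu> = sets borel"
    and "doubling_measure \<mu>"
    and "\<And>x \<rho>. \<rho> > 0 \<Longrightarrow> emeasure \<mu> (ball x \<rho>) \<le> ennreal (C * \<rho> powr m)"
    and "CZ_kernel m K"
    and "CZ_operator \<mu> K T"
  shows "\<exists>C\<^sub>T::real. \<forall>w. A2_weight \<mu> w \<longrightarrow>
           (\<forall>f \<in> L2_space \<mu> \<inter> L2_space (weighted \<mu> w).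
              T f \<in> L2_space (weighted \<mu> w) \<and>
              L2_norm (weighted \<mu> w) (T f)
                \<le> C\<^sub>T * enn2real (A2_char \<mu> w) * L2_norm (weighted \<mu> w) f)"
proof -
  obtain C' :: real where C': "\<And>x \<rho>. \<rho> > 0 \<Longrightarrow> 0 < emeasure \<mu> (ball x (2 * \<rho>))"
    "\<And>x \<rho>. \<rho> > 0 \<Longrightarrow> emeasure \<mu> (ball x (2 * \<rho>)) \<le> ennreal C' * emeasure \<mu> (ball x \<rho>)"
    using assms(4) unfolding doubling_measure_def by blast
  define D where "D = max 1 C'"
  from assms(6)[unfolded CZ_kernel_def] obtain \<epsilon> where \<epsilon>: "\<epsilon> > 0"
    and size: "\<forall>x y. x \<noteq> y \<longrightarrow> \<bar>K x y\<bar> \<le> 1 / dist x y powr m"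
    and smooth: "\<forall>x x' y. x \<noteq> y \<and> dist x x' \<le> dist x y / 2 \<longrightarrow>
      \<bar>K x y - K x' y\<bar> + \<bar>K y x - K y x'\<bar> \<le> dist x x' powr \<epsilon> / dist x y powr (m + \<epsilon>)"
    by (elim conjE exE)
  obtain N' where N': "\<And>f. f \<in> L2_space \<mu> \<Longrightarrow> L2_norm \<mu> (T f) \<le> N' * L2_norm \<mu> f"
    using assms(7) unfolding CZ_operator_def bounded_linear_L2_def by blast
  define N where "N = max 0 N'"
  have ball_pos: "0 < emeasure \<mu> (ball x \<rho>)" if "\<rho> > 0" for x \<rho>
    using C'(1)[of "\<rho> / 2" x] that by simp
  interpret CZ_setting \<mu> D m C \<epsilon> N K T
  proof
    show "sets \<mu> = sets borel" by fact
    show "D \<ge> 1" by (simp add: D_def)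
    show "0 < emeasure \<mu> (ball x \<rho>)" if "\<rho> > 0" for x \<rho> using ball_pos[OF that] .
    show "emeasure \<mu> (ball x \<rho>) < \<infinity>" for x \<rho>
    proof (cases "\<rho> > 0")
      case True
      then show ?thesis using assms(5)[OF True, of x] by (auto elim: le_less_trans)
    qed (simp add: ball_empty not_less)
    show "emeasure \<mu> (ball x (2 * \<rho>)) \<le> ennreal D * emeasure \<mu> (ball x \<rho>)" if "\<rho> > 0" for x \<rho>
      by (rule order_trans[OF C'(2)[OF that] mult_right_mono]) (auto simp: D_def intro: ennreal_leI)
    \<comment> \<open>Positivity of \<open>C\<close> is read off from any ball of radius 1, which
      has positive measure bounded by \<open>C\<close>; \<open>undefined\<close> merely names a
      point.\<close>
    have "0 < ennreal (C * 1 powr m)"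
      using ball_pos[of 1 undefined] assms(5)[of 1 undefined] by (rule less_le_trans) auto
    then show "C > 0" by simp
    show "N \<ge> 0" by (simp add: N_def)
    show "L2_norm \<mu> (T f) \<le> N * L2_norm \<mu> f" if "f \<in> L2_space \<mu>" for f
      by (rule order_trans[OF N'[OF that] mult_right_mono]) (auto simp: N_def L2_norm_def)
    show "(\<lambda>(x, y). K x y) \<in> borel_measurable (restrict_space borel {(x, y). x \<noteq> y})"
      using assms(6) unfolding CZ_kernel_def by blast
    show "\<bar>K x y\<bar> \<le> 1 / dist x y powr m" if "x \<noteq> y" for x y
      using size that by blast
    show "\<bar>K x y - K x' y\<bar> + \<bar>K y x - K y x'\<bar> \<le> dist x x' powr \<epsilon> / dist x y powr (m + \<epsilon>)"
      if "x \<noteq> y" "dist x x' \<le> dist x y / 2" for x x' y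
      using smooth that by blast
  qed (use assms \<epsilon> in \<open>auto simp: CZ_operator_def bounded_linear_L2_def\<close>)
  show ?thesis
  proof (intro exI allI impI ballI)
    fix w f assume w: "A2_weight \<mu> w" and "f \<in> L2_space \<mu> \<inter> L2_space (weighted \<mu> w)"
    then have f: "f \<in> L2_space \<mu>" "f \<in> L2_space (weighted \<mu> w)" by auto
    note f(1)[measurable] T_L2[OF f(1), measurable]
    have w_meas [measurable]: "w \<in> borel_measurable \<mu>" and "A2_char \<mu> w < \<infinity>"
      using w by (auto simp: A2_weight_def)
    define A where "A = enn2real (A2_char \<mu> w)"
    have A: "A2_char \<mu> w = ennreal A" "A \<ge> 0"
      using \<open>A2_char \<mu> w < \<infinity>\<close> by (auto simp: A_def)
    have sc: "sparse_const \<ge> 0"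
    proof -
      have "step_const \<ge> 0"
        unfolding step_const_def level_const_def osc_const_def
        using C_pos D_ge_1 powr_less_mono[of "- \<epsilon>" 0 8] \<epsilon>_pos by auto
      then show ?thesis unfolding sparse_const_def using D_ge_1 by auto
    qed
    have f_int: "(\<integral>\<^sup>+x. ennreal ((f x)\<^sup>2) * ennreal (w x) \<partial>\<mu>) = ennreal ((L2_norm (weighted \<mu> w) f)\<^sup>2)"
      using L2_norm_nn_integral[OF f(2)] nn_integral_square_weighted[OF w_meas, of f] by simp
    have "(\<integral>\<^sup>+x. ennreal ((T f x)\<^sup>2) \<partial>weighted \<mu> w)
        \<le> (ennreal sparse_const * A2_char \<mu> w)\<^sup>2 * ennreal ((L2_norm (weighted \<mu> w) f)\<^sup>2)"
      using T_weighted_bound[OF f(1) w] nn_integral_square_weighted[OF w_meas, of "T f"] f_int by simp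
    also have "\<dots> = ennreal ((sparse_const * A * L2_norm (weighted \<mu> w) f)\<^sup>2)"
      using sc A by (simp add: ennreal_mult[symmetric] ennreal_power power_mult_distrib)
    finally have le: "(\<integral>\<^sup>+x. ennreal ((T f x)\<^sup>2) \<partial>weighted \<mu> w)
        \<le> ennreal ((sparse_const * A * L2_norm (weighted \<mu> w) f)\<^sup>2)" .
    then have Tf: "T f \<in> L2_space (weighted \<mu> w)"
      by (auto simp: L2_space_iff elim: le_less_trans)
    have "(L2_norm (weighted \<mu> w) (T f))\<^sup>2 \<le> (sparse_const * A * L2_norm (weighted \<mu> w) f)\<^sup>2"
      using le unfolding L2_norm_nn_integral[OF Tf] by (subst (asm) ennreal_le_iff) auto
    moreover have "0 \<le> sparse_const * A * L2_norm (weighted \<mu> w) f"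
      using sc A by (simp add: L2_norm_def)
    ultimately have "L2_norm (weighted \<mu> w) (T f) \<le> sparse_const * A * L2_norm (weighted \<mu> w) f"
      by (rule power2_le_imp_le)
    then show "T f \<in> L2_space (weighted \<mu> w) \<and>
        L2_norm (weighted \<mu> w) (T f) \<le> sparse_const * enn2real (A2_char \<mu> w) * L2_norm (weighted \<mu> w) f"
      using Tf by (simp add: A_def)
  qed
qed

end
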